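(* Let $N\ge1$ be an integer, and let $0<\sigma<\infty$ if $N\le4$, $0<\sigma<\frac4{N-4}$ if $N\ge5$. The mapping $c\longmapsto t(c)$ is strictly increasing on $(0,\infty)$ and there is $C>0$ such that $t(c)\le C\sqrt c$ for all sufficiently small $c>0$. In particular, $t(c)\to0$ as $c\to0$.
   Context: All functions are complex-valued. For $c\ge0$ and $u\in H^2(\mathbb{R}^N)$, $T_c(u)=\int_{\mathbb{R}^N}|\Delta u|^2dx-2\int_{\mathbb{R}^N}|\nabla u|^2dx+(1+c)\int_{\mathbb{R}^N}|u|^2dx$, and $t(c)=\inf\{T_c(u):u\in H^2(\mathbb{R}^N),\ \int_{\mathbb{R}^N}|u|^{2\sigma+2}dx=1\}$. *)

theory Defs
  imports "HOL-Analysis.Analysis"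
begin

text \<open>
  \<open>\<real>\<^sup>N\<close> is rendered as \<open>real ^ 'n\<close> with \<open>N = CARD('n)\<close>.  Elements of \<open>L\<^sup>2\<close> and \<open>H\<^sup>2\<close> are
  represented by Borel measurable functions; every class modulo Lebesgue null sets contains one.
\<close>

definition partial_derivative :: "'n::finite \<Rightarrow> (real ^ 'n \<Rightarrow> complex) \<Rightarrow> real ^ 'n \<Rightarrow> complex" where
  "partial_derivative i f x = frechet_derivative f (at x) (axis i 1)"

primrec cont_diff :: "nat \<Rightarrow> (real ^ 'n::finite \<Rightarrow> complex) \<Rightarrow> bool" where
  "cont_diff 0 f \<longleftrightarrow> continuous_on UNIV f"
| "cont_diff (Suc k) f \<longleftrightarrow>
     (\<forall>x. f differentiable at x) \<and> (\<forall>i. cont_diff k (partial_derivative i f))"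

definition test_function :: "(real ^ 'n::finite \<Rightarrow> complex) \<Rightarrow> bool" where
  "test_function \<phi> \<longleftrightarrow> (\<forall>k. cont_diff k \<phi>) \<and> compact (closure {x. \<phi> x \<noteq> 0})"

definition locally_integrable :: "(real ^ 'n::finite \<Rightarrow> complex) \<Rightarrow> bool" where
  "locally_integrable f \<longleftrightarrow>
     f \<in> borel_measurable borel \<and> (\<forall>K. compact K \<longrightarrow> set_integrable lborel K f)"

definition square_integrable :: "(real ^ 'n::finite \<Rightarrow> complex) \<Rightarrow> bool" where
  "square_integrable f \<longleftrightarrow>
     f \<in> borel_measurable borel \<and> integrable lborel (\<lambda>x. (cmod (f x))\<^sup>2)"

definition has_weak_derivative ::
    "'n::finite \<Rightarrow> (real ^ 'n \<Rightarrow> complex) \<Rightarrow> (real ^ 'n \<Rightarrow> complex) \<Rightarrow> bool" where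
  "has_weak_derivative i u g \<longleftrightarrow> locally_integrable u \<and> locally_integrable g \<and>
     (\<forall>\<phi>. test_function \<phi> \<longrightarrow>
        (\<integral>x. u x * partial_derivative i \<phi> x \<partial>lborel) = - (\<integral>x. g x * \<phi> x \<partial>lborel))"

text \<open>
  A representative of the \<open>i\<close>-th weak derivative.  Weak derivatives are unique almost everywhere and
  depend only on the almost-everywhere class of \<open>u\<close>, so the choice does not affect any integral below.
\<close>
definition weak_derivative :: "'n::finite \<Rightarrow> (real ^ 'n \<Rightarrow> complex) \<Rightarrow> real ^ 'n \<Rightarrow> complex" where
  "weak_derivative i u = (SOME g. has_weak_derivative i u g)"

text \<open>The Sobolev space \<open>H\<^sup>k(\<real>\<^sup>N) = W\<^sup>k\<^sup>,\<^sup>2(\<real>\<^sup>N)\<close>.\<close>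
primrec sobolev_H :: "nat \<Rightarrow> (real ^ 'n::finite \<Rightarrow> complex) set" where
  "sobolev_H 0 = {u. square_integrable u}"
| "sobolev_H (Suc k) =
     {u. square_integrable u \<and> (\<forall>i. \<exists>g. has_weak_derivative i u g \<and> g \<in> sobolev_H k)}"

definition weak_gradient :: "(real ^ 'n::finite \<Rightarrow> complex) \<Rightarrow> real ^ 'n \<Rightarrow> complex ^ 'n" where
  "weak_gradient u x = (\<chi> i. weak_derivative i u x)"

definition weak_laplacian :: "(real ^ 'n::finite \<Rightarrow> complex) \<Rightarrow> real ^ 'n \<Rightarrow> complex" where
  "weak_laplacian u x = (\<Sum>i\<in>UNIV. weak_derivative i (weak_derivative i u) x)"

definition T_functional :: "real \<Rightarrow> (real ^ 'n::finite \<Rightarrow> complex) \<Rightarrow> real" where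
  "T_functional c u =
     (\<integral>x. (cmod (weak_laplacian u x))\<^sup>2 \<partial>lborel)
     - 2 * (\<integral>x. (norm (weak_gradient u x))\<^sup>2 \<partial>lborel)
     + (1 + c) * (\<integral>x. (cmod (u x))\<^sup>2 \<partial>lborel)"

text \<open>
  The first argument only carries the dimension.  As a Bochner integral of a non-integrable function
  is \<open>0\<close>, the normalisation entails that \<open>|u|\<close> to the power \<open>2\<sigma> + 2\<close> is integrable.
\<close>
definition t_inf :: "'n::finite itself \<Rightarrow> real \<Rightarrow> real \<Rightarrow> real" where
  "t_inf N \<sigma> c = Inf {T_functional c u | u :: real ^ 'n \<Rightarrow> complex.
     u \<in> sobolev_H 2 \<and> (\<integral>x. cmod (u x) powr (2 * \<sigma> + 2) \<partial>lborel) = 1}"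

end

(*
  Integration by parts turns T_c(u) into the sum of the squared norm of Delta u + u and of c times that
  of u.  This bounds the H^2 norm of a normalised u with T_c(u) <= M when c > 0.  By a Sobolev bound with
  an exponent slightly above 2 sigma + 2, the L^2 norm of such u stays away from 0; as c enters T_c
  only as a factor of the square of this norm, t is strictly increasing.

  The Sobolev bound compares u with its averages P_h u over cubes of side 2 h.  By symmetry of the cube,
  u - P_h u has L^2 norm O(h^2), and the suprema of P_h u grow at most like h^(2 - N/2), or like
  any negative power of h if N <= 4; one then estimates |u|^p on dyadic level sets at the matching scale.  All facts on weak derivatives come from
  difference quotients: u(x + h e_i) - u(x) is almost everywhere the integral of the i-th weak derivative
  along the segment, and translations are continuous in L^2.

  For the upper bound, a radial solution v of Delta v + v = 0 satisfies |v| + |grad v| = O(r^(-(N-1)/2)).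
  Cut off at radius R, it has squared L^2 norm O(R), while Delta v + v becomes O(1/R) relative to v;
  with R of order c^(-1/2) this gives T_c = O(sqrt c), and the L^(2 sigma + 2) norm stays bounded below.
*)
theory Submission
  imports Defs "HOL-Probability.Probability_Measure" "HOL-Real_Asymp.Real_Asymp"
begin

subsection \<open>Test functions\<close>

text \<open>Two obstacles shape the proof. The infimum t(c) is not known to be attained, so
  strictness cannot be read off a minimiser; a lower bound of the L^2 norm, uniform over all
  normalised u of bounded energy, takes its place. Subcriticality enters there: the dyadic series
  behind the Sobolev bound has ratio 2^((p - 2) beta - 4) with beta at least N/2 - 2, and sigma <
  4/(N - 4) is what makes it smaller than 1 for some p above 2 sigma + 2. Moreover the energy
  controls only Delta u, while the averages need every D_i D_i u. These are recovered because the
  real part of the inner product of D_i D_i u and D_j D_j u is a limit of squared L^2 norms of mixed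
  difference quotients, hence nonnegative. The radial solution is forced by the symbol (1 -
  |xi|^2)^2 of T_0: it vanishes on the unit sphere only, so good competitors have their Fourier
  transform near that sphere. Up to a factor the solution is the transform of the uniform measure on
  it, and a cutoff at radius R smears the sphere to thickness 1/R.\<close>

lemma partial_derivative_eq:
  fixes f :: "real ^ 'n::finite \<Rightarrow> complex"
  assumes "(f has_derivative f') (at x)"
  shows "partial_derivative i f x = f' (axis i 1)"
  using frechet_derivative_at[OF assms] by (simp add: partial_derivative_def)

lemma has_derivative_frechet:
  fixes f :: "real ^ 'n::finite \<Rightarrow> complex"
  shows "f differentiable at x \<Longrightarrow> (f has_derivative frechet_derivative f (at x)) (at x)"
  using frechet_derivative_works by blast

lemma cont_diff_Suc_imp:
  "cont_diff (Suc k) f \<Longrightarrow> cont_diff k f"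
proof (induction k arbitrary: f)
  case 0
  then show ?case
    by (auto intro!: continuous_at_imp_continuous_on differentiable_imp_continuous_within)
next
  case (Suc k)
  then show ?case by (metis cont_diff.simps(2))
qed

lemma cont_diff_const: "cont_diff k (\<lambda>x :: real ^ 'n::finite. c)"
proof (induction k arbitrary: c)
  case (Suc k)
  have "partial_derivative i (\<lambda>x. c) = (\<lambda>x::real^'n. 0)" for i and c :: complex
    by (rule ext, subst partial_derivative_eq) (auto intro!: derivative_eq_intros)
  then show ?case by (simp add: Suc)
qed simp

lemma cont_diff_add:
  "cont_diff k f \<Longrightarrow> cont_diff k g \<Longrightarrow> cont_diff k (\<lambda>x. f x + g x)"
proof (induction k arbitrary: f g)
  case (Suc k)
  have "partial_derivative i (\<lambda>x. f x + g x) = (\<lambda>x. partial_derivative i f x + partial_derivative i g x)" for i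
    using Suc.prems
    by (intro ext) (subst partial_derivative_eq[OF has_derivative_add[OF has_derivative_frechet has_derivative_frechet]],
       auto simp: partial_derivative_def)
  with Suc show ?case by simp
qed (simp add: continuous_on_add)

lemma cont_diff_mult:
  "cont_diff k f \<Longrightarrow> cont_diff k g \<Longrightarrow> cont_diff k (\<lambda>x. f x * g x)"
proof (induction k arbitrary: f g)
  case (Suc k)
  have "partial_derivative i (\<lambda>x. f x * g x)
      = (\<lambda>x. f x * partial_derivative i g x + partial_derivative i f x * g x)" for i
    using Suc.prems
    by (intro ext) (subst partial_derivative_eq[OF has_derivative_mult[OF has_derivative_frechet has_derivative_frechet]],
       auto simp: partial_derivative_def)
  \<comment> \<open>The product rule leaves one factor undifferentiated, so the factors themselves
    are needed at order k.\<close>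
  moreover have "cont_diff k f" "cont_diff k g"
    using Suc.prems cont_diff_Suc_imp by blast+
  ultimately show ?case using Suc by (auto intro!: cont_diff_add)
qed (simp add: continuous_on_mult)

lemma cont_diff_prod:
  "(\<And>i. i \<in> I \<Longrightarrow> cont_diff k (f i)) \<Longrightarrow> cont_diff k (\<lambda>x. \<Prod>i\<in>I. f i x)"
  by (induction I rule: infinite_finite_induct) (auto intro!: cont_diff_mult cont_diff_const)

lemma partial_derivative_translate:
  assumes "\<And>x. f differentiable at x"
  shows "partial_derivative i (\<lambda>x. f (x + a)) = (\<lambda>x. partial_derivative i f (x + a))"
proof
  fix x
  have "((\<lambda>x. f (x + a)) has_derivative frechet_derivative f (at (x + a))) (at x)"
    using diff_chain_at[OF has_derivative_add_const[OF has_derivative_ident] has_derivative_frechet[OF assms, of "x + a"]]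
    by (simp add: o_def)
  from partial_derivative_eq[OF this]
  show "partial_derivative i (\<lambda>x. f (x + a)) x = partial_derivative i f (x + a)"
    by (simp add: partial_derivative_def)
qed

lemma differentiable_translate:
  fixes f :: "real ^ 'n::finite \<Rightarrow> complex"
  assumes "f differentiable at (x + a)"
  shows "(\<lambda>x. f (x + a)) differentiable at x"
  using differentiable_chain_at[of "\<lambda>x. x + a" x f] assms by (simp add: o_def)

lemma cont_diff_translate:
  "cont_diff k f \<Longrightarrow> cont_diff k (\<lambda>x. f (x + a))"
proof (induction k arbitrary: f)
  case 0
  then show ?case by (auto intro!: continuous_intros continuous_on_compose2[of UNIV f])
next
  case (Suc k)
  then show ?case by (auto simp: partial_derivative_translate intro!: differentiable_translate)
qed

lemma test_function_translate:
  assumes "test_function \<phi>"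
  shows "test_function (\<lambda>x. \<phi> (x + a))"
proof -
  have "{x. \<phi> (x + a) \<noteq> 0} = (+) (- a) ` {x. \<phi> x \<noteq> 0}"
    by (auto simp: image_iff intro!: exI[of _ "_ + a"])
  then have "closure {x. \<phi> (x + a) \<noteq> 0} = (+) (- a) ` closure {x. \<phi> x \<noteq> 0}"
    by (simp only: closure_translation)
  with assms show ?thesis
    unfolding test_function_def by (metis cont_diff_translate compact_translation)
qed

lemma test_functionD:
  assumes "test_function \<phi>"
  shows "\<phi> differentiable at x" "continuous_on UNIV \<phi>" "continuous_on UNIV (partial_derivative i \<phi>)"
proof -
  from assms have "cont_diff (Suc 0) \<phi>" "cont_diff 0 \<phi>"
    unfolding test_function_def by blast+
  then show "\<phi> differentiable at x" "continuous_on UNIV \<phi>" "continuous_on UNIV (partial_derivative i \<phi>)"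
    by simp_all
qed

section \<open>Smooth bumps and the fundamental lemma of the calculus of variations\<close>

definition exp_bump :: "real \<Rightarrow> nat \<Rightarrow> real \<Rightarrow> real" where
  "exp_bump c k x = (if x > 0 then exp (- c * inverse x) * inverse x ^ k else 0)"

text \<open>The power k makes the family closed under differentiation up to linear combinations, so
  smoothness becomes a plain induction. At 0 the exponential beats every negative power.\<close>

lemma exp_bump_deriv:
  assumes "c > 0"
  shows "(exp_bump c k has_real_derivative c * exp_bump c (k + 2) x - real k * exp_bump c (k + 1) x) (at x)"
proof -
  consider "x < 0" | "x > 0" | "x = 0" by linarith
  then show ?thesis
  proof cases
    case 1
    have "((\<lambda>x. 0) has_real_derivative 0) (at x)" by simp
    moreover have "eventually (\<lambda>y. exp_bump c k y = 0) (nhds x)"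
      using eventually_nhds_in_open[of "{..<0}" x] 1
      by (auto elim!: eventually_mono simp: exp_bump_def)
    ultimately have "(exp_bump c k has_real_derivative 0) (at x)"
      using DERIV_cong_ev[of x x "exp_bump c k" "\<lambda>x. 0" 0 0] by simp
    with 1 show ?thesis by (simp add: exp_bump_def)
  next
    case 2
    have "((\<lambda>x. exp (- c * inverse x) * inverse x ^ k) has_real_derivative
        c * exp_bump c (k + 2) x - real k * exp_bump c (k + 1) x) (at x)"
    proof -
      have "((\<lambda>x. inverse x ^ k) has_real_derivative - real k * inverse x ^ (k + 1)) (at x)"
        using DERIV_power[OF DERIV_inverse[of x UNIV], of k] 2
        by (cases k) (auto simp: algebra_simps power2_eq_square)
      moreover have "((\<lambda>x. exp (- c * inverse x)) has_real_derivative exp (- c * inverse x) * (c * inverse x ^ 2)) (at x)"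
        using 2 by (auto intro!: derivative_eq_intros simp: power2_eq_square)
      ultimately show ?thesis
        using DERIV_mult 2 by (fastforce simp: exp_bump_def algebra_simps power_add power2_eq_square)
    qed
    moreover have "eventually (\<lambda>y. exp_bump c k y = exp (- c * inverse y) * inverse y ^ k) (nhds x)"
      using eventually_nhds_in_open[of "{0<..}" x] 2
      by (auto elim!: eventually_mono simp: exp_bump_def)
    ultimately show ?thesis
      using DERIV_cong_ev[of x x "exp_bump c k" "\<lambda>y. exp (- c * inverse y) * inverse y ^ k"] by simp
  next
    case 3
    \<comment> \<open>As \<open>exp_bump c k 0 = 0\<close>, this is the difference quotient at
      0.\<close>
    have "((\<lambda>h. exp_bump c k h / h) \<longlongrightarrow> 0) (at_right 0)"
    proof (rule Lim_transform_eventually)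
      show "((\<lambda>h. exp (- c * inverse h) * inverse h ^ Suc k) \<longlongrightarrow> 0) (at_right 0)"
        using assms by real_asymp
      show "eventually (\<lambda>h. exp (- c * inverse h) * inverse h ^ Suc k = exp_bump c k h / h) (at_right 0)"
        by (auto simp: eventually_at_filter exp_bump_def divide_inverse)
    qed
    moreover have "((\<lambda>h. exp_bump c k h / h) \<longlongrightarrow> 0) (at_left 0)"
      by (rule Lim_transform_eventually[OF tendsto_const])
         (auto simp: eventually_at_filter exp_bump_def)
    ultimately have "((\<lambda>h. exp_bump c k h / h) \<longlongrightarrow> 0) (at 0)"
      by (simp add: filterlim_split_at)
    then show ?thesis using 3 by (simp add: DERIV_def exp_bump_def)
  qed
qed

text \<open>The induction runs over all k because each differentiation raises k. The affine argument
  serves both faces of a box, through x_i - a_i and b_i - x_i.\<close>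

lemma cont_diff_exp_bump:
  fixes i :: "'n::finite"
  assumes "c > 0"
  shows "cont_diff n (\<lambda>x. complex_of_real (exp_bump c k (s * x $ i + t)))"
proof (induction n arbitrary: k)
  case 0
  have "continuous_on UNIV (exp_bump c k)"
    using exp_bump_deriv[OF assms] by (intro DERIV_continuous_on[OF has_field_derivative_at_within])
  then show ?case
    by (auto intro!: continuous_intros continuous_on_compose2[of UNIV "exp_bump c k"])
next
  case (Suc n)
  let ?B = "\<lambda>k (x::real^'n). complex_of_real (exp_bump c k (s * x $ i + t))"
  have D: "(?B k has_derivative (\<lambda>h. of_real (s * h $ i) * (of_real c * ?B (k + 2) x - of_real (real k) * ?B (k + 1) x))) (at x)" for x
  proof -
    have 1: "((\<lambda>x. s * x $ i + t) has_derivative (\<lambda>h. s * h $ i)) (at x)"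
      by (auto intro!: derivative_eq_intros bounded_linear.has_derivative[OF bounded_linear_vec_nth])
    have "((\<lambda>x. exp_bump c k (s * x $ i + t)) has_derivative
       (\<lambda>h. (s * h $ i) * (c * exp_bump c (k + 2) (s * x $ i + t) - real k * exp_bump c (k + 1) (s * x $ i + t)))) (at x)"
      using DERIV_compose_FDERIV[OF exp_bump_deriv[OF assms] 1] by simp
    from has_derivative_of_real[OF this] show ?thesis by simp
  qed
  have "partial_derivative j (?B k) = (\<lambda>x. of_real (s * axis j 1 $ i) * (of_real c * ?B (k + 2) x + (- of_real (real k)) * ?B (k + 1) x))" for j
    by (rule ext, subst partial_derivative_eq[OF D]) simp
  moreover have "cont_diff n (\<lambda>x. of_real (s * axis j 1 $ i) * (of_real c * ?B (k + 2) x + (- of_real (real k)) * ?B (k + 1) x))" for j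
    by (intro cont_diff_add cont_diff_mult cont_diff_const Suc)
  ultimately have "cont_diff n (partial_derivative j (?B k))" for j
    by (simp only:)
  moreover have "?B k differentiable at x" for x
    by (rule differentiableI[OF D])
  ultimately show ?case
    unfolding cont_diff.simps by (intro conjI allI)
qed

text \<open>Products of bumps in x_i - a_i and b_i - x_i with parameter c = 1/(m + 1): for y > 0,
  exp(-c/y) tends to 1 as c tends to 0, and off the open box some factor vanishes. The bound by the
  closed box is the dominating function for limits under the integral.\<close>

lemma box_indicator_limit:
  fixes a b :: "real ^ 'n::finite"
  obtains \<phi> where "\<And>m::nat. test_function (\<phi> m)" "\<And>m x. cmod (\<phi> m x) \<le> indicator (cbox a b) x"
    "\<And>x. (\<lambda>m. \<phi> m x) \<longlonglongrightarrow> indicator (box a b) x"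
proof
  let ?c = "\<lambda>m. inverse (real (Suc m))"
  define \<phi> where "\<phi> m x = (\<Prod>i\<in>UNIV. complex_of_real (exp_bump (?c m) 0 (1 * x $ i + (- a $ i)))
     * complex_of_real (exp_bump (?c m) 0 ((-1) * x $ i + b $ i)))" for m x
  have 0: "\<phi> m x = 0" if "x \<notin> box a b" for m x
  proof -
    from that obtain i where "x $ i \<le> a $ i \<or> b $ i \<le> x $ i"
      by (auto simp: mem_box_cart not_less)
    then have "exp_bump (?c m) 0 (1 * x $ i + (- a $ i)) = 0 \<or> exp_bump (?c m) 0 ((-1) * x $ i + b $ i) = 0"
      by (auto simp: exp_bump_def)
    then show ?thesis unfolding \<phi>_def by (intro prod_zero bexI[of _ i]) auto
  qed
  have "closure {x. \<phi> m x \<noteq> 0} \<subseteq> cbox a b" for m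
    using 0[of _ m] box_subset_cbox[of a b] by (intro closure_minimal) auto
  then have "compact (closure {x. \<phi> m x \<noteq> 0})" for m
    by (meson bounded_cbox bounded_closure bounded_subset closed_closure closure_subset compact_eq_bounded_closed)
  moreover have "cont_diff k (\<phi> m)" for k m
    unfolding \<phi>_def by (intro cont_diff_prod cont_diff_mult cont_diff_exp_bump) auto
  ultimately show "test_function (\<phi> m)" for m
    by (simp add: test_function_def)
  have b: "\<bar>exp_bump (?c m) 0 y\<bar> \<le> 1" for m y
    by (auto simp: exp_bump_def)
  have "cmod (\<phi> m x) \<le> 1" for m x
    unfolding \<phi>_def prod_norm[symmetric]
    by (intro prod_le_1) (auto simp del: of_nat_Suc simp: norm_mult b intro!: mult_le_one)
  then show "cmod (\<phi> m x) \<le> indicator (cbox a b) x" for m x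
    using 0[of x m] box_subset_cbox[of a b] by (auto simp: indicator_def)
  have L: "(\<lambda>m. exp_bump (?c m) 0 y) \<longlonglongrightarrow> 1" if "y > 0" for y
  proof -
    have "(\<lambda>m. exp (- ?c m * inverse y)) \<longlonglongrightarrow> exp (- 0 * inverse y)"
      by (intro tendsto_intros LIMSEQ_inverse_real_of_nat) (use that in auto)
    then show ?thesis using that by (simp add: exp_bump_def)
  qed
  show "(\<lambda>m. \<phi> m x) \<longlonglongrightarrow> indicator (box a b) x" for x
  proof (cases "x \<in> box a b")
    case True
    have "(\<lambda>m. \<phi> m x) \<longlonglongrightarrow> (\<Prod>i\<in>(UNIV::'n set). of_real 1 * of_real 1)"
      unfolding \<phi>_def using True
      by (intro tendsto_prod tendsto_mult tendsto_of_real L) (auto simp: mem_box_cart)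
    with True show ?thesis by simp
  qed (simp add: 0)
qed

text \<open>Dominated convergence passes from test functions to open boxes. These form an
  intersection-stable generator of the Borel sets, so inside a fixed box w has integral 0 over every
  Borel set and vanishes almost everywhere there; countably many boxes cover the space.\<close>

lemma AE_zero_if_orthogonal_to_test_functions:
  fixes w :: "real ^ 'n::finite \<Rightarrow> complex"
  assumes w: "locally_integrable w"
    and orth: "\<And>\<phi>. test_function \<phi> \<Longrightarrow> (\<integral>x. w x * \<phi> x \<partial>lborel) = 0"
  shows "AE x in lborel. w x = 0"
proof -
  have [measurable]: "w \<in> borel_measurable borel" using w by (simp add: locally_integrable_def)
  have int: "integrable lborel (\<lambda>x. indicator (cbox a b) x *\<^sub>R w x)" for a b
    using w by (auto simp: locally_integrable_def set_integrable_def)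
  have intb: "integrable lborel (\<lambda>x. indicator A x *\<^sub>R (indicator (box a b) x *\<^sub>R w x))"
    if "A \<in> sets borel" for A a b
    by (rule Bochner_Integration.integrable_bound[OF int[of a b]])
       (use that box_subset_cbox[of a b] in \<open>auto simp: indicator_def\<close>)
  have intb': "integrable lborel (\<lambda>x. indicator (box a b) x *\<^sub>R w x)" for a b
    using intb[of UNIV] by simp
  have box0: "(\<integral>x. indicator (box a b) x *\<^sub>R w x \<partial>lborel) = 0" for a b
  proof -
    obtain \<phi> where \<phi>: "\<And>m::nat. test_function (\<phi> m)" "\<And>m x. cmod (\<phi> m x) \<le> indicator (cbox a b) x"
      "\<And>x. (\<lambda>m. \<phi> m x) \<longlonglongrightarrow> indicator (box a b) x"
      using box_indicator_limit by metis
    have [measurable]: "\<phi> m \<in> borel_measurable borel" for m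
      using test_functionD(2)[OF \<phi>(1)] borel_measurable_continuous_onI by blast
    have "(\<lambda>m. \<integral>x. w x * \<phi> m x \<partial>lborel) \<longlonglongrightarrow> (\<integral>x. indicator (box a b) x *\<^sub>R w x \<partial>lborel)"
    proof (rule integral_dominated_convergence[where w="\<lambda>x. norm (indicator (cbox a b) x *\<^sub>R w x)"])
      show "AE x in lborel. (\<lambda>m. w x * \<phi> m x) \<longlonglongrightarrow> indicator (box a b) x *\<^sub>R w x"
      proof (rule AE_I2)
        fix x show "(\<lambda>m. w x * \<phi> m x) \<longlonglongrightarrow> indicator (box a b) x *\<^sub>R w x"
          using tendsto_mult[OF tendsto_const[of "w x"] \<phi>(3)[of x]]
          by (auto simp: indicator_def split: if_splits)
      qed
      show "AE x in lborel. norm (w x * \<phi> m x) \<le> norm (indicator (cbox a b) x *\<^sub>R w x)" for m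
        using \<phi>(2)[of m] by (intro AE_I2) (simp add: norm_mult mult.commute mult_left_mono)
    qed (use integrable_norm[OF int[of a b]] in simp_all)
    with orth[OF \<phi>(1)] show ?thesis by (simp add: LIMSEQ_const_iff)
  qed
  have "AE x in lborel. indicator (box a b) x *\<^sub>R w x = 0" for a b :: "real^'n"
  proof (rule sigma_finite_measure.density_zero[OF sigma_finite_lborel intb'])
    fix A :: "(real^'n) set" assume "A \<in> sets lborel"
    then have A: "A \<in> sigma_sets UNIV (range (\<lambda>(a, b). box a b))"
      by (simp add: borel_eq_box)
    let ?I = "\<lambda>A. (\<integral>x. indicator A x *\<^sub>R (indicator (box a b) x *\<^sub>R w x) \<partial>lborel)"
    have st: "Int_stable (range (\<lambda>(a, b). box a b :: (real^'n) set))"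
      by (auto simp: Int_stable_def box_Int_box)
    have pow: "range (\<lambda>(a, b). box a b :: (real^'n) set) \<subseteq> Pow UNIV" by simp
    \<comment> \<open>Dynkin's argument: complements use that the whole box has integral 0, disjoint
      unions use countable additivity.\<close>
    have "?I A = 0" using st pow A
    proof (induction rule: sigma_sets_induct_disjoint)
      case (basic A)
      then obtain c d where A: "A = box c d" by auto
      have eq: "indicator A x *\<^sub>R (indicator (box a b) x *\<^sub>R w x) = indicator (A \<inter> box a b) x *\<^sub>R w x" for x
        by (auto simp: indicator_def)
      show ?case unfolding eq unfolding A box_Int_box by (rule box0)
    next
      case (compl A)
      then have [measurable]: "A \<in> sets borel" by (simp add: borel_eq_box)
      have "?I (UNIV - A) = (\<integral>x. indicator (box a b) x *\<^sub>R w x - indicator A x *\<^sub>R (indicator (box a b) x *\<^sub>R w x) \<partial>lborel)"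
        by (intro Bochner_Integration.integral_cong) (auto simp: indicator_def)
      also have "\<dots> = 0"
        by (subst Bochner_Integration.integral_diff[OF intb' intb]) (use compl box0 in auto)
      finally show ?case .
    next
      case (union F)
      then have [measurable]: "\<And>i. F i \<in> sets borel"
        by (simp add: borel_eq_box subset_eq)
      have "set_lebesgue_integral lborel (\<Union>i. F i) (\<lambda>x. indicator (box a b) x *\<^sub>R w x)
         = (\<Sum>i. set_lebesgue_integral lborel (F i) (\<lambda>x. indicator (box a b) x *\<^sub>R w x))"
      proof (rule lebesgue_integral_countable_add)
        show "set_integrable lborel (\<Union>i. F i) (\<lambda>x. indicator (box a b) x *\<^sub>R w x)"
          unfolding set_integrable_def by (rule intb) simp
      qed (use union(1) in \<open>auto simp: disjoint_family_on_def\<close>)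
      then show ?case using union.IH by (simp add: set_lebesgue_integral_def)
    qed simp
    then show "set_lebesgue_integral lborel A (\<lambda>x. indicator (box a b) x *\<^sub>R w x) = 0"
      by (simp add: set_lebesgue_integral_def)
  qed
  then have "AE x in lborel. \<forall>m::nat. indicator (box (- (real m *\<^sub>R One)) (real m *\<^sub>R One)) x *\<^sub>R w x = 0"
    unfolding AE_all_countable by blast
  then show ?thesis
  proof eventually_elim
    case (elim x)
    have "x \<in> (\<Union>m::nat. box (- (real m *\<^sub>R One)) (real m *\<^sub>R One))"
      unfolding UN_box_eq_UNIV by simp
    then obtain m :: nat where "x \<in> box (- (real m *\<^sub>R One)) (real m *\<^sub>R One)"
      by blast
    with elim[rule_format, of m] show ?case by simp
  qed
qed

lemma AE_eq_if_equal_on_test_functions: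
  fixes v w :: "real ^ 'n::finite \<Rightarrow> complex"
  assumes v: "locally_integrable v" and w: "locally_integrable w"
    and eq: "\<And>\<phi>. test_function \<phi> \<Longrightarrow> (\<integral>x. v x * \<phi> x \<partial>lborel) = (\<integral>x. w x * \<phi> x \<partial>lborel)"
  shows "AE x in lborel. v x = w x"
proof -
  \<comment> \<open>A test function is bounded with compact support, so these products are
    integrable and the integral of the difference may be split.\<close>
  have int: "integrable lborel (\<lambda>x. f x * \<phi> x)" if f: "locally_integrable f" and \<phi>: "test_function \<phi>" for f \<phi> :: "real ^ 'n \<Rightarrow> complex"
  proof -
    let ?K = "closure {x. \<phi> x \<noteq> 0}"
    have K: "compact ?K" using \<phi> by (simp add: test_function_def)
    have "compact (\<phi> ` ?K)"
      using K test_functionD(2)[OF \<phi>] by (meson compact_continuous_image continuous_on_subset subset_UNIV)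
    then obtain B where B: "\<And>x. x \<in> ?K \<Longrightarrow> cmod (\<phi> x) \<le> B"
      using bounded_iff[of "\<phi> ` ?K"] compact_imp_bounded by blast
    have [measurable]: "f \<in> borel_measurable borel" "\<phi> \<in> borel_measurable borel"
      using f test_functionD(2)[OF \<phi>] borel_measurable_continuous_onI by (auto simp: locally_integrable_def)
    have "integrable lborel (\<lambda>x. indicator ?K x *\<^sub>R f x)"
      using f K by (auto simp: locally_integrable_def set_integrable_def)
    from integrable_scaleR_right[OF this, of B] show ?thesis
    proof (rule Bochner_Integration.integrable_bound)
      show "AE x in lborel. norm (f x * \<phi> x) \<le> norm (B *\<^sub>R indicator ?K x *\<^sub>R f x)"
      proof (rule AE_I2)
        fix x show "norm (f x * \<phi> x) \<le> norm (B *\<^sub>R indicator ?K x *\<^sub>R f x)"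
        proof (cases "x \<in> ?K")
          case True
          have "cmod (\<phi> x) \<le> \<bar>B\<bar>" using B[OF True] by linarith
          then have "cmod (f x) * cmod (\<phi> x) \<le> cmod (f x) * \<bar>B\<bar>"
            by (rule mult_left_mono) simp
          with True show ?thesis by (simp add: norm_mult mult.commute)
        next
          case False
          then have "\<phi> x = 0" using closure_subset[of "{x. \<phi> x \<noteq> 0}"] by blast
          with False show ?thesis by simp
        qed
      qed
    qed measurable
  qed
  have "locally_integrable (\<lambda>x. v x - w x)"
    using v w by (auto simp: locally_integrable_def set_integral_diff)
  moreover have "(\<integral>x. (v x - w x) * \<phi> x \<partial>lborel) = 0" if "test_function \<phi>" for \<phi>
    using eq[OF that] by (simp add: left_diff_distrib int that v w)
  ultimately have "AE x in lborel. v x - w x = 0"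
    by (rule AE_zero_if_orthogonal_to_test_functions)
  then show ?thesis by simp
qed

subsection \<open>Square-integrable functions\<close>

text \<open>The squared L^2 norm with values in \<open>ennreal\<close>: estimates and Tonelli then
  carry no integrability hypotheses, and square integrability becomes finiteness.\<close>

definition sq_norm :: "('a::euclidean_space \<Rightarrow> complex) \<Rightarrow> ennreal" where
  "sq_norm f = (\<integral>\<^sup>+x. ennreal ((cmod (f x))\<^sup>2) \<partial>lborel)"

lemma square_integrable_measurable [measurable_dest]:
  "square_integrable f \<Longrightarrow> f \<in> borel_measurable borel"
  by (simp add: square_integrable_def)

lemma square_integrable_iff:
  assumes "f \<in> borel_measurable borel"
  shows "square_integrable f \<longleftrightarrow> sq_norm f < \<infinity>"
  using assms by (simp add: square_integrable_def integrable_iff_bounded sq_norm_def)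

lemma sq_norm_finite: "square_integrable f \<Longrightarrow> sq_norm f < \<infinity>"
  using square_integrable_iff square_integrable_measurable by blast

lemma sq_norm_eq_integral:
  "square_integrable f \<Longrightarrow> sq_norm f = ennreal (\<integral>x. (cmod (f x))\<^sup>2 \<partial>lborel)"
  unfolding sq_norm_def square_integrable_def by (intro nn_integral_eq_integral) auto

lemma sq_norm_cong_AE: "AE x in lborel. f x = g x \<Longrightarrow> sq_norm f = sq_norm g"
  unfolding sq_norm_def by (rule nn_integral_cong_AE) (auto elim!: eventually_mono)

lemma nn_integral_translate:
  fixes f :: "'a::euclidean_space \<Rightarrow> ennreal"
  assumes [measurable]: "f \<in> borel_measurable borel"
  shows "(\<integral>\<^sup>+x. f (x + a) \<partial>lborel) = (\<integral>\<^sup>+x. f x \<partial>lborel)"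
proof -
  have "(\<integral>\<^sup>+x. f x \<partial>lborel) = (\<integral>\<^sup>+x. f x \<partial>distr lborel borel ((+) a))"
    by (simp add: lborel_distr_plus)
  also have "\<dots> = (\<integral>\<^sup>+x. f (x + a) \<partial>lborel)"
    by (subst nn_integral_distr) (auto simp: add.commute)
  finally show ?thesis by simp
qed

lemma integrable_translate:
  fixes f :: "'a::euclidean_space \<Rightarrow> 'b::{banach, second_countable_topology}"
  assumes "integrable lborel f"
  shows "integrable lborel (\<lambda>x. f (x + a))"
proof -
  have [measurable]: "f \<in> borel_measurable borel" using assms by auto
  show ?thesis
    using assms nn_integral_translate[of "\<lambda>x. ennreal (norm (f x))" a]
    by (simp add: integrable_iff_bounded)
qed

lemma integral_translate:
  fixes f :: "'a::euclidean_space \<Rightarrow> 'b::{banach, second_countable_topology}"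
  assumes [measurable]: "f \<in> borel_measurable borel"
  shows "(\<integral>x. f (x + a) \<partial>lborel) = (\<integral>x. f x \<partial>lborel)"
proof -
  have "(\<integral>x. f x \<partial>lborel) = (\<integral>x. f x \<partial>distr lborel borel ((+) a))"
    by (simp add: lborel_distr_plus)
  also have "\<dots> = (\<integral>x. f (x + a) \<partial>lborel)"
    by (subst integral_distr) (auto simp: add.commute)
  finally show ?thesis by simp
qed

lemma sq_norm_translate:
  fixes f :: "'a::euclidean_space \<Rightarrow> complex"
  assumes [measurable]: "f \<in> borel_measurable borel"
  shows "sq_norm (\<lambda>x. f (x + a)) = sq_norm f"
  unfolding sq_norm_def by (rule nn_integral_translate) measurable

lemma cmod_add_sq_le: "(cmod (a + b))\<^sup>2 \<le> 2 * (cmod a)\<^sup>2 + 2 * (cmod b)\<^sup>2"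
proof -
  have "(cmod (a + b))\<^sup>2 \<le> (cmod a + cmod b)\<^sup>2"
    by (intro power_mono norm_triangle_ineq) auto
  also have "\<dots> \<le> 2 * (cmod a)\<^sup>2 + 2 * (cmod b)\<^sup>2"
    using sum_squares_bound[of "cmod a" "cmod b"] by (simp add: power2_sum)
  finally show ?thesis .
qed

text \<open>The factor 2 stands in for Minkowski's inequality and keeps the estimates free of square
  roots; only the order of magnitude of constants matters later.\<close>

lemma sq_norm_add_le:
  assumes [measurable]: "f \<in> borel_measurable borel" "g \<in> borel_measurable borel"
  shows "sq_norm (\<lambda>x. f x + g x) \<le> 2 * sq_norm f + 2 * sq_norm g"
proof -
  have "sq_norm (\<lambda>x. f x + g x)
      \<le> (\<integral>\<^sup>+x. 2 * ennreal ((cmod (f x))\<^sup>2) + 2 * ennreal ((cmod (g x))\<^sup>2) \<partial>lborel)"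
    unfolding sq_norm_def
    using ennreal_leI[OF cmod_add_sq_le]
    by (intro nn_integral_mono) (simp add: ennreal_mult'')
  also have "\<dots> = 2 * sq_norm f + 2 * sq_norm g"
    unfolding sq_norm_def by (simp add: nn_integral_add nn_integral_cmult)
  finally show ?thesis .
qed

lemma sq_norm_cmult:
  assumes [measurable]: "f \<in> borel_measurable borel"
  shows "sq_norm (\<lambda>x. c * f x) = ennreal ((cmod c)\<^sup>2) * sq_norm f"
  unfolding sq_norm_def
  by (subst nn_integral_cmult[symmetric]) (auto simp: norm_mult power_mult_distrib ennreal_mult)

lemma sq_norm_minus: "sq_norm (\<lambda>x. - f x) = sq_norm f"
  by (simp add: sq_norm_def)

lemma sq_norm_diff_le:
  assumes [measurable]: "f \<in> borel_measurable borel" "g \<in> borel_measurable borel"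
  shows "sq_norm (\<lambda>x. f x - g x) \<le> 2 * sq_norm f + 2 * sq_norm g"
  using sq_norm_add_le[of f "\<lambda>x. - g x"] by (simp add: sq_norm_minus)

lemma square_integrable_add:
  assumes f: "square_integrable f" and g: "square_integrable g"
  shows "square_integrable (\<lambda>x. f x + g x)"
proof -
  note [measurable] = f[THEN square_integrable_measurable] g[THEN square_integrable_measurable]
  have "sq_norm (\<lambda>x. f x + g x) \<le> 2 * sq_norm f + 2 * sq_norm g"
    by (rule sq_norm_add_le) auto
  also have "\<dots> < \<infinity>"
    using sq_norm_finite[OF f] sq_norm_finite[OF g] by (simp add: ennreal_mult_less_top)
  finally show ?thesis by (subst square_integrable_iff) auto
qed

lemma square_integrable_cmult:
  assumes f: "square_integrable f"
  shows "square_integrable (\<lambda>x. c * f x)"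
proof -
  note [measurable] = f[THEN square_integrable_measurable]
  show ?thesis
    using sq_norm_finite[OF f]
    by (subst square_integrable_iff) (auto simp: sq_norm_cmult ennreal_mult_less_top)
qed

lemma square_integrable_diff:
  "square_integrable f \<Longrightarrow> square_integrable g \<Longrightarrow> square_integrable (\<lambda>x. f x - g x)"
  using square_integrable_add[of f "\<lambda>x. -1 * g x"] square_integrable_cmult[of g "-1"] by simp

lemma square_integrable_sum:
  "(\<And>i. i \<in> I \<Longrightarrow> square_integrable (f i)) \<Longrightarrow> square_integrable (\<lambda>x. \<Sum>i\<in>I. f i x)"
proof (induction I rule: infinite_finite_induct)
  case (insert i I)
  then show ?case by (auto intro!: square_integrable_add)
qed (auto simp: square_integrable_def)

lemma square_integrable_cnj: "square_integrable f \<Longrightarrow> square_integrable (\<lambda>x. cnj (f x))"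
  by (auto simp: square_integrable_def intro: borel_measurable_continuous_on[of cnj] continuous_intros)

lemma square_integrable_translate:
  assumes f: "square_integrable f"
  shows "square_integrable (\<lambda>x. f (x + a))"
proof -
  note [measurable] = f[THEN square_integrable_measurable]
  show ?thesis
    using sq_norm_finite[OF f] by (subst square_integrable_iff) (auto simp: sq_norm_translate)
qed

lemma square_integrable_cong_AE:
  assumes "square_integrable f" "g \<in> borel_measurable borel" "AE x in lborel. f x = g x"
  shows "square_integrable g"
  using assms square_integrable_iff sq_norm_cong_AE[OF assms(3)] sq_norm_finite by metis

section \<open>Cauchy-Schwarz and averages over probability spaces\<close>

lemma norm_mult_le_sum_squares:
  fixes a b :: complex
  shows "norm (a * b) \<le> norm ((cmod a)\<^sup>2 + (cmod b)\<^sup>2)"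
proof -
  have "cmod a * cmod b \<le> 2 * cmod a * cmod b" by simp
  also have "\<dots> \<le> (cmod a)\<^sup>2 + (cmod b)\<^sup>2" by (rule sum_squares_bound)
  finally show ?thesis by (simp add: norm_mult)
qed

lemma integrable_mult_square_integrable:
  assumes f: "square_integrable f" and g: "square_integrable g"
  shows "integrable lborel (\<lambda>x. f x * g x)"
proof (rule Bochner_Integration.integrable_bound)
  note [measurable] = f[THEN square_integrable_measurable] g[THEN square_integrable_measurable]
  show "integrable lborel (\<lambda>x. (cmod (f x))\<^sup>2 + (cmod (g x))\<^sup>2)"
    using f g by (auto simp: square_integrable_def)
  show "AE x in lborel. norm (f x * g x) \<le> norm ((cmod (f x))\<^sup>2 + (cmod (g x))\<^sup>2)"
    by (rule AE_I2) (rule norm_mult_le_sum_squares)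
  show "(\<lambda>x. f x * g x) \<in> borel_measurable lborel" by measurable
qed

text \<open>Valid for every f, since the Bochner integral of a non-integrable function is 0.\<close>

lemma norm_integral_le_nn_integral:
  fixes f :: "'a \<Rightarrow> 'b::{banach, second_countable_topology}"
  shows "ennreal (norm (\<integral>x. f x \<partial>M)) \<le> (\<integral>\<^sup>+x. ennreal (norm (f x)) \<partial>M)"
  by (cases "integrable M f") (auto simp: integral_norm_bound_ennreal not_integrable_integral_eq)

lemma Cauchy_Schwarz_sq_norm:
  assumes f: "square_integrable f" and g: "square_integrable g"
  shows "ennreal (cmod (\<integral>x. f x * g x \<partial>lborel)) ^ 2 \<le> sq_norm f * sq_norm g"
proof -
  note [measurable] = f[THEN square_integrable_measurable] g[THEN square_integrable_measurable]
  have "ennreal (cmod (\<integral>x. f x * g x \<partial>lborel)) ^ 2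
      \<le> (\<integral>\<^sup>+x. ennreal (cmod (f x)) * ennreal (cmod (g x)) \<partial>lborel) ^ 2"
    using norm_integral_le_nn_integral[of lborel "\<lambda>x. f x * g x"]
    by (intro power_mono) (auto simp: norm_mult ennreal_mult)
  also have "\<dots> \<le> sq_norm f * sq_norm g"
    unfolding sq_norm_def
    using Cauchy_Schwarz_nn_integral[of "\<lambda>x. ennreal (cmod (f x))" lborel "\<lambda>x. ennreal (cmod (g x))"]
    by (simp add: ennreal_power)
  finally show ?thesis .
qed

text \<open>Jensen's inequality for the square, obtained from Cauchy-Schwarz against the constant
  1.\<close>

lemma (in prob_space) cmod_integral_sq_le:
  assumes [measurable]: "f \<in> borel_measurable M"
  shows "ennreal ((cmod (\<integral>r. f r \<partial>M))\<^sup>2) \<le> (\<integral>\<^sup>+r. ennreal ((cmod (f r))\<^sup>2) \<partial>M)"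
proof -
  have "ennreal ((cmod (\<integral>r. f r \<partial>M))\<^sup>2) \<le> (\<integral>\<^sup>+r. ennreal (cmod (f r)) * 1 \<partial>M) ^ 2"
    using power_mono[OF norm_integral_le_nn_integral[of M f], of 2] by (simp add: ennreal_power)
  also have "\<dots> \<le> (\<integral>\<^sup>+r. ennreal (cmod (f r)) ^ 2 \<partial>M) * (\<integral>\<^sup>+r. 1 ^ 2 \<partial>M)"
    by (rule Cauchy_Schwarz_nn_integral) auto
  also have "\<dots> = (\<integral>\<^sup>+r. ennreal ((cmod (f r))\<^sup>2) \<partial>M)"
    by (simp add: emeasure_space_1 ennreal_power)
  finally show ?thesis .
qed

lemma (in prob_space) integrable_if_cmod_sq:
  assumes [measurable]: "f \<in> borel_measurable M" and sq: "integrable M (\<lambda>r. (cmod (f r))\<^sup>2)"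
  shows "integrable M f"
proof (rule Bochner_Integration.integrable_bound)
  show "integrable M (\<lambda>r. 1 + (cmod (f r))\<^sup>2)" using sq by auto
  have "cmod (f r) \<le> 1 + (cmod (f r))\<^sup>2" for r
    using sum_squares_bound[of 1 "cmod (f r)"] by (simp add: power2_eq_square) (smt (verit) norm_ge_zero)
  then show "AE r in M. norm (f r) \<le> norm (1 + (cmod (f r))\<^sup>2)" by simp
qed measurable

lemma nn_integral_sq_swap:
  assumes "sigma_finite_measure M"
    and F[measurable]: "(\<lambda>(r, x). F r x) \<in> borel_measurable (M \<Otimes>\<^sub>M lborel)"
  shows "(\<integral>\<^sup>+x. (\<integral>\<^sup>+r. ennreal ((cmod (F r x))\<^sup>2) \<partial>M) \<partial>lborel) = (\<integral>\<^sup>+r. sq_norm (F r) \<partial>M)"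
proof -
  interpret sigma_finite_measure M by fact
  interpret pair_sigma_finite M lborel ..
  show ?thesis unfolding sq_norm_def by (rule Fubini') measurable
qed

text \<open>Jensen for each x, then Tonelli. This one estimate serves segment averages and box
  averages alike.\<close>

lemma sq_norm_average_le:
  assumes "prob_space M"
    and F[measurable]: "(\<lambda>(r, x). F r x) \<in> borel_measurable (M \<Otimes>\<^sub>M lborel)"
  shows "sq_norm (\<lambda>x. \<integral>r. F r x \<partial>M) \<le> (\<integral>\<^sup>+r. sq_norm (F r) \<partial>M)"
proof -
  interpret prob_space M by fact
  have "sq_norm (\<lambda>x. \<integral>r. F r x \<partial>M) \<le> (\<integral>\<^sup>+x. (\<integral>\<^sup>+r. ennreal ((cmod (F r x))\<^sup>2) \<partial>M) \<partial>lborel)"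
    unfolding sq_norm_def by (intro nn_integral_mono cmod_integral_sq_le) measurable
  also have "\<dots> = (\<integral>\<^sup>+r. sq_norm (F r) \<partial>M)"
    by (rule nn_integral_sq_swap) (auto intro: sigma_finite_measure_axioms)
  finally show ?thesis .
qed

text \<open>By Tonelli the square is integrable in r for almost every x, and on a probability space
  so is the function. This licenses splitting the average of a sum, which the default value 0 of the
  integral would otherwise spoil.\<close>

lemma AE_integrable_average:
  assumes "prob_space M"
    and F[measurable]: "(\<lambda>(r, x). F r x) \<in> borel_measurable (M \<Otimes>\<^sub>M lborel)"
    and fin: "(\<integral>\<^sup>+r. sq_norm (F r) \<partial>M) < \<infinity>"
  shows "AE x in lborel. integrable M (\<lambda>r. F r x)"
proof -
  interpret prob_space M by fact
  have "AE x in lborel. (\<integral>\<^sup>+r. ennreal ((cmod (F r x))\<^sup>2) \<partial>M) \<noteq> \<infinity>"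
    using fin by (intro nn_integral_noteq_infinite)
      (auto simp: nn_integral_sq_swap[OF sigma_finite_measure_axioms])
  then show ?thesis
  proof eventually_elim
    case (elim x)
    have "integrable M (\<lambda>r. (cmod (F r x))\<^sup>2)"
      using elim by (auto simp: integrable_iff_bounded top.not_eq_extremum)
    then show ?case
      by (rule integrable_if_cmod_sq[rotated]) measurable
  qed
qed

subsection \<open>Continuity of translations\<close>

lemma integral_norm_translate_diff_le:
  fixes f g :: "'a::euclidean_space \<Rightarrow> 'b::{banach, second_countable_topology}"
  assumes f: "integrable lborel f" and g: "integrable lborel g"
  shows "(\<integral>x. norm (f (x + a) - f x) \<partial>lborel)
    \<le> (\<integral>x. norm (g (x + a) - g x) \<partial>lborel) + 2 * (\<integral>x. norm (f x - g x) \<partial>lborel)"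
proof -
  have [measurable]: "f \<in> borel_measurable borel" "g \<in> borel_measurable borel" using f g by auto
  have int: "integrable lborel (\<lambda>x. norm (f x - g x))" using f g by auto
  have "(\<integral>x. norm (f (x + a) - f x) \<partial>lborel)
      \<le> (\<integral>x. norm (g (x + a) - g x) + (norm (f (x + a) - g (x + a)) + norm (f x - g x)) \<partial>lborel)"
  proof (rule integral_mono)
    show "norm (f (x + a) - f x) \<le> norm (g (x + a) - g x) + (norm (f (x + a) - g (x + a)) + norm (f x - g x))" for x
      by norm
  qed (use f g integrable_translate[OF f] integrable_translate[OF g] in auto)
  also have "\<dots> = (\<integral>x. norm (g (x + a) - g x) \<partial>lborel) + ((\<integral>x. norm (f (x + a) - g (x + a)) \<partial>lborel) + (\<integral>x. norm (f x - g x) \<partial>lborel))"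
    using f g integrable_translate[OF f] integrable_translate[OF g] by auto
  also have "(\<integral>x. norm (f (x + a) - g (x + a)) \<partial>lborel) = (\<integral>x. norm (f x - g x) \<partial>lborel)"
    by (rule integral_translate[of "\<lambda>x. norm (f x - g x)"]) measurable
  finally show ?thesis by simp
qed

text \<open>Translation is an isometry of L^1, so functions with continuous translations form a
  closed set: the approximation error is paid twice, once before and once after the shift.\<close>

lemma L1_translate_approx:
  fixes f :: "'a::euclidean_space \<Rightarrow> 'b::{banach, second_countable_topology}"
  assumes f: "integrable lborel f"
    and approx: "\<And>e. e > 0 \<Longrightarrow> \<exists>g. integrable lborel g \<and> (\<integral>x. norm (f x - g x) \<partial>lborel) < e \<and>
      (\<lambda>n. \<integral>x. norm (g (x + y n) - g x) \<partial>lborel) \<longlonglongrightarrow> 0"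
  shows "(\<lambda>n. \<integral>x. norm (f (x + y n) - f x) \<partial>lborel) \<longlonglongrightarrow> 0"
proof (rule LIMSEQ_I)
  fix e :: real assume "e > 0"
  then obtain g where g: "integrable lborel g" "(\<integral>x. norm (f x - g x) \<partial>lborel) < e / 4"
      "(\<lambda>n. \<integral>x. norm (g (x + y n) - g x) \<partial>lborel) \<longlonglongrightarrow> 0"
    using approx[of "e / 4"] by auto
  from LIMSEQ_D[OF g(3), of "e / 2"] \<open>e > 0\<close> obtain no where
    no: "\<And>n. n \<ge> no \<Longrightarrow> norm ((\<integral>x. norm (g (x + y n) - g x) \<partial>lborel) - 0) < e / 2" by auto
  have "norm ((\<integral>x. norm (f (x + y n) - f x) \<partial>lborel) - 0) < e" if "n \<ge> no" for n
    using no[OF that] integral_norm_translate_diff_le[OF f g(1), of "y n"] g(2) by simp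
  then show "\<exists>no. \<forall>n\<ge>no. norm ((\<integral>x. norm (f (x + y n) - f x) \<partial>lborel) - 0) < e" by blast
qed

text \<open>Induction over integrable functions: indicators are approximated by those of open
  supersets through outer regularity, sums use the triangle inequality, and limits use
  \<open>L1_translate_approx\<close>.\<close>

lemma L1_translate_tendsto:
  fixes f :: "'a::euclidean_space \<Rightarrow> complex"
  assumes f: "integrable lborel f" and y: "y \<longlonglongrightarrow> 0"
  shows "(\<lambda>n. \<integral>x. norm (f (x + y n) - f x) \<partial>lborel) \<longlonglongrightarrow> 0"
  using f
proof (induction rule: integrable_induct)
  case (base A c)
  show ?case
  proof (rule L1_translate_approx)
    show "integrable lborel (\<lambda>x. indicat_real A x *\<^sub>R c)"
      using base by (intro integrable_scaleR_left) auto
    fix e :: real assume e: "e > 0"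
    \<comment> \<open>The summand 1 covers the case c = 0.\<close>
    have "e / (1 + cmod c) > 0" using e by (simp add: add_pos_nonneg)
    then obtain U where U: "open U" "A \<subseteq> U" "emeasure lborel (U - A) < ennreal (e / (1 + cmod c))"
      using outer_regular_lborel[of A] base by auto
    have [measurable]: "A \<in> sets borel" "U \<in> sets borel" using base U by auto
    have fin: "emeasure lborel U < \<infinity>"
    proof -
      have "emeasure lborel U \<le> emeasure lborel A + emeasure lborel (U - A)"
        using U(2) emeasure_subadditive[of A lborel "U - A"] by (simp add: Un_absorb1)
      also have "\<dots> < \<infinity>" using base U(3) by (auto simp: less_top[symmetric])
      finally show ?thesis .
    qed
    let ?g = "\<lambda>x. indicat_real U x *\<^sub>R c"
    have g: "integrable lborel ?g" using fin by (intro integrable_scaleR_left) auto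
    have "(\<integral>x. norm (indicat_real A x *\<^sub>R c - ?g x) \<partial>lborel) = (\<integral>x. cmod c * indicat_real (U - A) x \<partial>lborel)"
      using U(2) by (intro Bochner_Integration.integral_cong) (auto simp: indicator_def)
    also have "\<dots> = cmod c * measure lborel (U - A)" by simp
    also have "\<dots> \<le> cmod c * (e / (1 + cmod c))"
      using U(3) by (intro mult_left_mono) (use e in \<open>auto simp: measure_def add_pos_nonneg intro!: enn2real_leI\<close>)
    also have "\<dots> < e" using e by (simp add: field_simps add_pos_nonneg)
    finally have 1: "(\<integral>x. norm (indicat_real A x *\<^sub>R c - ?g x) \<partial>lborel) < e" .
    text \<open>Since \<open>U\<close> is open, \<open>indicator U x * indicator U (x + y n)\<close> tends to \<open>indicator U x\<close> pointwise.\<close>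
    have lim: "(\<lambda>n. \<integral>x. indicat_real U x * indicat_real U (x + y n) \<partial>lborel) \<longlonglongrightarrow> (\<integral>x. indicat_real U x \<partial>lborel)"
    proof (rule integral_dominated_convergence[where w="indicat_real U"])
      show "AE x in lborel. (\<lambda>n. indicat_real U x * indicat_real U (x + y n)) \<longlonglongrightarrow> indicat_real U x"
      proof (rule AE_I2)
        fix x
        show "(\<lambda>n. indicat_real U x * indicat_real U (x + y n)) \<longlonglongrightarrow> indicat_real U x"
        proof (cases "x \<in> U")
          case True
          have "(\<lambda>n. x + y n) \<longlonglongrightarrow> x + 0" by (intro tendsto_intros y)
          then have "eventually (\<lambda>n. x + y n \<in> U) sequentially"
            using topological_tendstoD[OF _ U(1)] True by auto
          then have "eventually (\<lambda>n. indicat_real U x * indicat_real U (x + y n) = indicat_real U x) sequentially"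
            by eventually_elim auto
          then show ?thesis by (rule tendsto_eventually)
        qed auto
      qed
    qed (use fin in \<open>auto simp: indicator_def\<close>)
    have gU: "integrable lborel (indicat_real U)" using fin by simp
    have gUU: "integrable lborel (\<lambda>x. indicat_real U x * indicat_real U (x + a))" for a
      by (rule Bochner_Integration.integrable_bound[OF gU]) (auto simp: indicator_def)
    have eq: "(\<integral>x. norm (?g (x + a) - ?g x) \<partial>lborel) = cmod c * (2 * (\<integral>x. indicat_real U x \<partial>lborel)
       - 2 * (\<integral>x. indicat_real U x * indicat_real U (x + a) \<partial>lborel))" for a
    proof -
      \<comment> \<open>For indicators |p - q| = p + q - 2 p q, so after integration only the
        overlap of U with its translate depends on a.\<close>
      have "(\<integral>x. norm (?g (x + a) - ?g x) \<partial>lborel) = (\<integral>x. cmod c * ((indicat_real U (x + a) + indicat_real U x) - 2 * (indicat_real U x * indicat_real U (x + a))) \<partial>lborel)"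
        by (intro Bochner_Integration.integral_cong) (auto simp: indicator_def)
      also have "\<dots> = cmod c * (((\<integral>x. indicat_real U (x + a) \<partial>lborel) + (\<integral>x. indicat_real U x \<partial>lborel)) - 2 * (\<integral>x. indicat_real U x * indicat_real U (x + a) \<partial>lborel))"
        using gU gUU[of a] integrable_translate[OF gU, of a] by simp
      also have "(\<integral>x. indicat_real U (x + a) \<partial>lborel) = (\<integral>x. indicat_real U x \<partial>lborel)"
        by (rule integral_translate) measurable
      finally show ?thesis by simp
    qed
    have "(\<lambda>n. \<integral>x. norm (?g (x + y n) - ?g x) \<partial>lborel) \<longlonglongrightarrow> cmod c * (2 * (\<integral>x. indicat_real U x \<partial>lborel) - 2 * (\<integral>x. indicat_real U x \<partial>lborel))"
      unfolding eq by (intro tendsto_intros lim)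
    with g 1 show "\<exists>g. integrable lborel g \<and> (\<integral>x. norm (indicat_real A x *\<^sub>R c - g x) \<partial>lborel) < e \<and>
      (\<lambda>n. \<integral>x. norm (g (x + y n) - g x) \<partial>lborel) \<longlonglongrightarrow> 0"
      by (intro exI[of _ ?g]) auto
  qed
next
  case (add f g)
  note int = add.hyps integrable_translate[OF add.hyps(1)] integrable_translate[OF add.hyps(2)]
  have "(\<lambda>n. (\<integral>x. norm (f (x + y n) - f x) \<partial>lborel) + (\<integral>x. norm (g (x + y n) - g x) \<partial>lborel)) \<longlonglongrightarrow> 0"
    using tendsto_add[OF add.IH] by simp
  then show ?case
  proof (rule Lim_null_comparison[rotated])
    have "(\<integral>x. norm (f (x + a) + g (x + a) - (f x + g x)) \<partial>lborel)
        \<le> (\<integral>x. norm (f (x + a) - f x) + norm (g (x + a) - g x) \<partial>lborel)" for a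
      using int by (intro integral_mono) (auto intro: norm_diff_triangle_ineq)
    then show "\<forall>\<^sub>F n in sequentially. norm (\<integral>x. norm (f (x + y n) + g (x + y n) - (f x + g x)) \<partial>lborel)
        \<le> (\<integral>x. norm (f (x + y n) - f x) \<partial>lborel) + (\<integral>x. norm (g (x + y n) - g x) \<partial>lborel)"
      using int by (intro always_eventually) simp
  qed
next
  case (lim f s)
  have [measurable]: "f \<in> borel_measurable borel" "\<And>i. s i \<in> borel_measurable borel"
    using lim.hyps(1,4) by auto
  have L: "(\<lambda>i. \<integral>x. norm (f x - s i x) \<partial>lborel) \<longlonglongrightarrow> (\<integral>x. 0 \<partial>(lborel :: 'a measure))"
  \<comment> \<open>The approximants satisfy |s_i| <= 2 |f|, whence the dominating function 3
    |f|.\<close>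
  proof (rule integral_dominated_convergence[where w="\<lambda>x. 3 * norm (f x)"])
    show "AE x in lborel. (\<lambda>i. norm (f x - s i x)) \<longlonglongrightarrow> 0"
    proof (rule AE_I2)
      fix x
      have "(\<lambda>i. norm (f x - s i x)) \<longlonglongrightarrow> norm (f x - f x)"
        using lim.hyps(2)[of x] by (intro tendsto_intros) auto
      then show "(\<lambda>i. norm (f x - s i x)) \<longlonglongrightarrow> 0" by simp
    qed
    show "AE x in lborel. norm (norm (f x - s i x)) \<le> 3 * norm (f x)" for i
    proof (rule AE_I2)
      fix x show "norm (norm (f x - s i x)) \<le> 3 * norm (f x)"
        using norm_triangle_ineq4[of "f x" "s i x"] lim.hyps(3)[of x i] by simp
    qed
  qed (use lim.hyps(4) in auto)
  show ?case
  proof (rule L1_translate_approx[OF lim.hyps(4)])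
    fix e :: real assume "e > 0"
    with L obtain i where "norm ((\<integral>x. norm (f x - s i x) \<partial>lborel) - 0) < e"
      using LIMSEQ_D[OF L, of e] by auto
    then show "\<exists>g. integrable lborel g \<and> (\<integral>x. norm (f x - g x) \<partial>lborel) < e \<and>
      (\<lambda>n. \<integral>x. norm (g (x + y n) - g x) \<partial>lborel) \<longlonglongrightarrow> 0"
      using lim.hyps(1) lim.IH by (intro exI[of _ "s i"]) auto
  qed
qed

text \<open>Truncation in value and in space reduces L^2 to L^1: a function g bounded by k satisfies
  |g(x + y) - g(x)|^2 <= 2 k |g(x + y) - g(x)|.\<close>

lemma sq_norm_translate_tendsto:
  fixes f :: "real ^ 'n::finite \<Rightarrow> complex"
  assumes f: "square_integrable f" and y: "y \<longlonglongrightarrow> 0"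
  shows "(\<lambda>n. sq_norm (\<lambda>x. f (x + y n) - f x)) \<longlonglongrightarrow> 0"
proof -
  note [measurable] = f[THEN square_integrable_measurable]
  define t where "t k x = (if cmod (f x) \<le> real k then f x else 0)" for k :: nat and x
  define g where "g k x = (if norm x \<le> real k then t k x else 0)" for k :: nat and x
  have [measurable]: "g k \<in> borel_measurable borel" for k
    unfolding g_def t_def by measurable
  have gle: "cmod (g k x) \<le> k" "cmod (g k x) \<le> cmod (f x)" "cmod (f x - g k x) \<le> cmod (f x)" for k x
    by (auto simp: g_def t_def)
  have gi: "integrable lborel (g k)" for k
  proof (rule Bochner_Integration.integrable_bound)
    show "integrable lborel (\<lambda>x::real^'n. real k * indicat_real (cball 0 (real k)) x)"
      by (intro integrable_mult_right integrable_real_indicator emeasure_bounded_finite) auto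
    show "AE x in lborel. norm (g k x) \<le> norm (real k * indicat_real (cball 0 (real k)) x)"
      by (rule AE_I2) (auto simp: g_def t_def)
  qed measurable
  have gg: "(\<lambda>k. g k x) \<longlonglongrightarrow> f x" for x
  proof (rule tendsto_eventually)
    obtain k0 :: nat where "max (cmod (f x)) (norm x) \<le> k0" using real_arch_simple by blast
    then have "g k x = f x" if "k \<ge> k0" for k
      using that by (simp add: g_def t_def)
    then show "\<forall>\<^sub>F k in sequentially. g k x = f x"
      using eventually_at_top_linorder by blast
  qed
  have A: "(\<lambda>k. sq_norm (\<lambda>x. f x - g k x)) \<longlonglongrightarrow> (\<integral>\<^sup>+x. 0 \<partial>(lborel :: (real^'n) measure))"
    unfolding sq_norm_def
  proof (rule nn_integral_dominated_convergence[where w="\<lambda>x. ennreal ((cmod (f x))\<^sup>2)"])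
    show "AE x in lborel. ennreal ((cmod (f x - g k x))\<^sup>2) \<le> ennreal ((cmod (f x))\<^sup>2)" for k
      using gle(3)[of _ k] by (intro AE_I2 ennreal_leI power_mono) auto
    show "(\<integral>\<^sup>+x. ennreal ((cmod (f x))\<^sup>2) \<partial>lborel) < \<infinity>"
      using sq_norm_finite[OF f] by (simp add: sq_norm_def)
    show "AE x in lborel. (\<lambda>k. ennreal ((cmod (f x - g k x))\<^sup>2)) \<longlonglongrightarrow> 0"
    proof (rule AE_I2)
      fix x
      have "(\<lambda>k. ennreal ((cmod (f x - g k x))\<^sup>2)) \<longlonglongrightarrow> ennreal ((cmod (f x - f x))\<^sup>2)"
        by (intro tendsto_intros tendsto_ennrealI gg)
      then show "(\<lambda>k. ennreal ((cmod (f x - g k x))\<^sup>2)) \<longlonglongrightarrow> 0" by simp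
    qed
  qed auto
  have B: "(\<lambda>n. sq_norm (\<lambda>x. g k (x + y n) - g k x)) \<longlonglongrightarrow> 0" for k
  proof (rule tendsto_sandwich[OF _ _ tendsto_const])
    let ?I = "\<lambda>n. \<integral>x. norm (g k (x + y n) - g k x) \<partial>lborel"
    have "(\<lambda>n. ennreal (2 * real k * ?I n)) \<longlonglongrightarrow> ennreal (2 * real k * 0)"
      by (intro tendsto_intros tendsto_ennrealI L1_translate_tendsto gi y)
    then show "(\<lambda>n. ennreal (2 * real k * ?I n)) \<longlonglongrightarrow> 0" by simp
    show "\<forall>\<^sub>F n in sequentially. sq_norm (\<lambda>x. g k (x + y n) - g k x) \<le> ennreal (2 * real k * ?I n)"
    proof (rule always_eventually, rule allI)
      fix n
      have "sq_norm (\<lambda>x. g k (x + y n) - g k x) \<le> (\<integral>\<^sup>+x. ennreal (2 * real k * norm (g k (x + y n) - g k x)) \<partial>lborel)"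
        unfolding sq_norm_def
      proof (rule nn_integral_mono, rule ennreal_leI)
        fix x
        have "cmod (g k (x + y n) - g k x) \<le> 2 * real k"
          using norm_triangle_ineq4[of "g k (x + y n)" "g k x"] gle(1)[of k] by (smt (verit))
        then show "(cmod (g k (x + y n) - g k x))\<^sup>2 \<le> 2 * real k * norm (g k (x + y n) - g k x)"
          by (simp add: power2_eq_square mult_right_mono)
      qed
      also have "\<dots> = ennreal (2 * real k * ?I n)"
        using integrable_translate[OF gi] gi by (subst nn_integral_eq_integral) auto
      finally show "sq_norm (\<lambda>x. g k (x + y n) - g k x) \<le> ennreal (2 * real k * ?I n)" .
    qed
  qed auto
  show ?thesis
  proof (rule tendsto_zero_ennreal)
    fix e :: real assume e: "e > 0"
    \<comment> \<open>The truncation error enters with total factor 8 and the translation error of g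
      with factor 2, so e/16 and e/4 add up to e.\<close>
    have "eventually (\<lambda>k. sq_norm (\<lambda>x. f x - g k x) < ennreal (e / 16)) sequentially"
      using A e by (intro order_tendstoD(2)) auto
    then obtain k where k: "sq_norm (\<lambda>x. f x - g k x) < ennreal (e / 16)"
      by (auto simp: eventually_sequentially)
    have "eventually (\<lambda>n. sq_norm (\<lambda>x. g k (x + y n) - g k x) < ennreal (e / 4)) sequentially"
      using B[of k] e by (intro order_tendstoD(2)) auto
    then show "\<forall>\<^sub>F n in sequentially. sq_norm (\<lambda>x. f (x + y n) - f x) < ennreal e"
    proof eventually_elim
      case (elim n)
      have T: "sq_norm (\<lambda>x. f (x + y n) - g k (x + y n)) = sq_norm (\<lambda>x. f x - g k x)"
        by (rule sq_norm_translate[of "\<lambda>x. f x - g k x"]) measurable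
      have "sq_norm (\<lambda>x. f (x + y n) - f x)
          = sq_norm (\<lambda>x. ((f (x + y n) - g k (x + y n)) - (f x - g k x)) + (g k (x + y n) - g k x))"
        by (rule arg_cong[where f=sq_norm]) auto
      also have "\<dots> \<le> 2 * sq_norm (\<lambda>x. (f (x + y n) - g k (x + y n)) - (f x - g k x)) + 2 * sq_norm (\<lambda>x. g k (x + y n) - g k x)"
        by (rule sq_norm_add_le) measurable
      also have "\<dots> \<le> 2 * (2 * sq_norm (\<lambda>x. f (x + y n) - g k (x + y n)) + 2 * sq_norm (\<lambda>x. f x - g k x)) + 2 * sq_norm (\<lambda>x. g k (x + y n) - g k x)"
        by (intro add_right_mono mult_left_mono sq_norm_diff_le) auto
      also have "\<dots> < ennreal e"
      proof -
        obtain a b where ab: "sq_norm (\<lambda>x. f x - g k x) = ennreal a" "0 \<le> a"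
           "sq_norm (\<lambda>x. g k (x + y n) - g k x) = ennreal b" "0 \<le> b"
        proof -
          obtain a where "0 \<le> a" "sq_norm (\<lambda>x. f x - g k x) = ennreal a"
            using k by (cases "sq_norm (\<lambda>x. f x - g k x)") auto
          moreover obtain b where "0 \<le> b" "sq_norm (\<lambda>x. g k (x + y n) - g k x) = ennreal b"
            using elim by (cases "sq_norm (\<lambda>x. g k (x + y n) - g k x)") auto
          ultimately show ?thesis using that by blast
        qed
        have "a < e / 16" "b < e / 4" using k elim ab by (simp_all add: ennreal_less_iff)
        then have "2 * (2 * a + 2 * a) + 2 * b < e" by simp
        moreover have "2 * (2 * ennreal a + 2 * ennreal a) + 2 * ennreal b = ennreal (2 * (2 * a + 2 * a) + 2 * b)"
          by (simp only: ennreal_mult' ennreal_plus ennreal_numeral mult_nonneg_nonneg add_nonneg_nonneg zero_le_numeral ab(2,4))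
        ultimately show ?thesis unfolding T ab
          using e by (simp only: ennreal_less_iff ab(2,4) mult_nonneg_nonneg add_nonneg_nonneg zero_le_numeral)
      qed
      finally show ?case .
    qed
  qed
qed

subsection \<open>Difference quotients and weak derivatives\<close>

text \<open>Segment averages are taken as expectations, so that the estimates for probability spaces
  apply to them.\<close>

abbreviation unif01 :: "real measure" where
  "unif01 \<equiv> uniform_measure lborel {0..1}"

lemma prob_space_unif01: "prob_space unif01"
  by (rule prob_space_uniform_measure) auto

interpretation unif01: prob_space unif01
  by (rule prob_space_unif01)

lemma integral_unif01:
  fixes f :: "real \<Rightarrow> 'b::{banach, second_countable_topology}"
  assumes [measurable]: "f \<in> borel_measurable borel"
  shows "(\<integral>s. f s \<partial>unif01) = (\<integral>s. indicator {0..1} s *\<^sub>R f s \<partial>lborel)"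
proof -
  have "unif01 = density lborel (\<lambda>s. ennreal (indicator {0..1} s))"
    unfolding uniform_measure_def by (rule density_cong) (auto simp: indicator_def divide_ennreal_def)
  then show ?thesis by (simp add: integral_density)
qed

definition segment_average :: "real \<Rightarrow> 'n::finite \<Rightarrow> (real ^ 'n \<Rightarrow> complex) \<Rightarrow> real ^ 'n \<Rightarrow> complex" where
  "segment_average h i f x = (\<integral>s. f (x + (s * h) *\<^sub>R axis i 1) \<partial>unif01)"

definition diff_quot :: "real \<Rightarrow> 'n::finite \<Rightarrow> (real ^ 'n \<Rightarrow> complex) \<Rightarrow> real ^ 'n \<Rightarrow> complex" where
  "diff_quot h i f x = (f (x + h *\<^sub>R axis i 1) - f x) / of_real h"

lemma segment_translate_measurable [measurable]:
  assumes [measurable]: "f \<in> borel_measurable borel"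
  shows "(\<lambda>(s, x). f (x + (s * h) *\<^sub>R axis i 1)) \<in> borel_measurable (unif01 \<Otimes>\<^sub>M lborel)"
  by measurable

lemma segment_average_measurable [measurable]:
  assumes [measurable]: "f \<in> borel_measurable borel"
  shows "segment_average h i f \<in> borel_measurable borel"
  unfolding segment_average_def by measurable

text \<open>Since the measure has mass 1, g may be moved under the average for almost every x; then
  \<open>sq_norm_average_le\<close> applies.\<close>

lemma sq_norm_segment_average_diff_le:
  assumes f: "square_integrable f" and [measurable]: "g \<in> borel_measurable borel"
  shows "sq_norm (\<lambda>x. segment_average h i f x - g x)
    \<le> (\<integral>\<^sup>+s. sq_norm (\<lambda>x. f (x + (s * h) *\<^sub>R axis i 1) - g x) \<partial>unif01)"
proof -
  note [measurable] = f[THEN square_integrable_measurable]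
  have "(\<integral>\<^sup>+s. sq_norm (\<lambda>x. f (x + (s * h) *\<^sub>R axis i 1)) \<partial>unif01) = sq_norm f"
    using unif01.emeasure_space_1 by (simp add: sq_norm_translate)
  then have "AE x in lborel. integrable unif01 (\<lambda>s. f (x + (s * h) *\<^sub>R axis i 1))"
    using sq_norm_finite[OF f] by (intro AE_integrable_average prob_space_unif01) auto
  then have "AE x in lborel. segment_average h i f x - g x = (\<integral>s. f (x + (s * h) *\<^sub>R axis i 1) - g x \<partial>unif01)"
    by eventually_elim (simp add: segment_average_def)
  then have "sq_norm (\<lambda>x. segment_average h i f x - g x)
      = sq_norm (\<lambda>x. \<integral>s. f (x + (s * h) *\<^sub>R axis i 1) - g x \<partial>unif01)"
    by (rule sq_norm_cong_AE)
  also have "\<dots> \<le> (\<integral>\<^sup>+s. sq_norm (\<lambda>x. f (x + (s * h) *\<^sub>R axis i 1) - g x) \<partial>unif01)"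
    by (rule sq_norm_average_le[OF prob_space_unif01]) measurable
  finally show ?thesis .
qed

lemma sq_norm_segment_average_le:
  assumes f: "square_integrable f"
  shows "sq_norm (segment_average h i f) \<le> sq_norm f"
proof -
  note [measurable] = f[THEN square_integrable_measurable]
  have "sq_norm (segment_average h i f) \<le> (\<integral>\<^sup>+s. sq_norm f \<partial>unif01)"
    using sq_norm_segment_average_diff_le[OF f, of "\<lambda>x. 0" h i] by (simp add: sq_norm_translate)
  then show ?thesis using unif01.emeasure_space_1 by simp
qed

lemma square_integrable_segment_average:
  assumes f: "square_integrable f"
  shows "square_integrable (segment_average h i f)"
proof -
  note [measurable] = f[THEN square_integrable_measurable]
  show ?thesis
    using order.strict_trans1[OF sq_norm_segment_average_le[OF f] sq_norm_finite[OF f]]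
    by (subst square_integrable_iff) auto
qed

lemma square_integrable_diff_quot:
  assumes "square_integrable f"
  shows "square_integrable (diff_quot h i f)"
  using square_integrable_cmult[OF square_integrable_diff[OF square_integrable_translate[OF assms] assms],
      of "inverse (of_real h)" "h *\<^sub>R axis i 1"]
  unfolding diff_quot_def[abs_def] by (simp add: divide_inverse mult.commute)

lemma square_integrable_imp_locally_integrable:
  fixes f :: "real ^ 'n::finite \<Rightarrow> complex"
  assumes f: "square_integrable f"
  shows "locally_integrable f"
  unfolding locally_integrable_def
proof (intro conjI allI impI)
  show [measurable]: "f \<in> borel_measurable borel" by (rule square_integrable_measurable[OF f])
  fix K :: "(real^'n) set" assume K: "compact K"
  then have [measurable]: "K \<in> sets borel" by (simp add: borel_compact)
  have "square_integrable (\<lambda>x :: real^'n. complex_of_real (indicator K x))"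
    unfolding square_integrable_def
  proof
    have "(\<lambda>x. (cmod (complex_of_real (indicator K x)))\<^sup>2) = indicat_real K"
      by (auto simp: indicator_def)
    then show "integrable lborel (\<lambda>x. (cmod (complex_of_real (indicator K x)))\<^sup>2)"
      using K by (simp only:) (intro integrable_real_indicator emeasure_bounded_finite compact_imp_bounded, auto)
  qed measurable
  from integrable_mult_square_integrable[OF this f]
  show "set_integrable lborel K f"
    by (simp add: set_integrable_def scaleR_conv_of_real)
qed

lemma square_integrable_continuous_compact:
  assumes c: "continuous_on UNIV f" and K: "compact K" and 0: "\<And>x. x \<notin> K \<Longrightarrow> f x = 0"
  shows "square_integrable f"
  unfolding square_integrable_def
proof
  show [measurable]: "f \<in> borel_measurable borel" using c by (rule borel_measurable_continuous_onI)
  have "integrable lborel (\<lambda>x. indicator K x *\<^sub>R (cmod (f x))\<^sup>2)"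
    by (rule borel_integrable_compact[OF K]) (auto intro!: continuous_intros continuous_on_subset[OF c])
  also have "(\<lambda>x. indicator K x *\<^sub>R (cmod (f x))\<^sup>2) = (\<lambda>x. (cmod (f x))\<^sup>2)"
    using 0 by (force simp: fun_eq_iff indicator_def)
  finally show "integrable lborel (\<lambda>x. (cmod (f x))\<^sup>2)" .
qed

lemma partial_derivative_support:
  assumes "x \<notin> closure {x. \<phi> x \<noteq> 0}"
  shows "partial_derivative i \<phi> x = 0"
proof -
  have "eventually (\<lambda>y. y \<in> - closure {x. \<phi> x \<noteq> 0}) (nhds x)"
    using assms by (intro eventually_nhds_in_open) auto
  then have "eventually (\<lambda>y. 0 = \<phi> y) (nhds x)"
    by eventually_elim (use closure_subset[of "{x. \<phi> x \<noteq> 0}"] in auto)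
  then have "(\<phi> has_derivative (\<lambda>h. 0)) (at x)"
    using has_derivative_transform_eventually[OF has_derivative_const, of 0 \<phi> x UNIV]
    by (auto simp: eventually_nhds_conv_at)
  from partial_derivative_eq[OF this] show ?thesis .
qed

lemma test_function_square_integrable:
  assumes "test_function \<phi>"
  shows "square_integrable \<phi>" "square_integrable (partial_derivative i \<phi>)"
proof -
  note * = square_integrable_continuous_compact[where K="closure {x. \<phi> x \<noteq> 0}"]
  show "square_integrable \<phi>"
    using assms closure_subset[of "{x. \<phi> x \<noteq> 0}"]
    by (intro *) (auto simp: test_function_def[of \<phi>] intro: test_functionD(2))
  show "square_integrable (partial_derivative i \<phi>)"
    using assms
    by (intro *) (auto simp: test_function_def[of \<phi>] intro: test_functionD(3) partial_derivative_support)
qed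

lemma segment_FTC:
  fixes f :: "real ^ 'n::finite \<Rightarrow> complex"
  assumes d: "\<And>x. f differentiable at x" and c: "continuous_on UNIV (partial_derivative i f)"
  shows "f (x + h *\<^sub>R axis i 1) - f x = of_real h * segment_average h i (partial_derivative i f) x"
proof -
  let ?g = "\<lambda>s. partial_derivative i f (x + (s * h) *\<^sub>R axis i 1)"
  have cg: "continuous_on A ?g" for A
    by (intro continuous_on_compose2[OF c]) (auto intro!: continuous_intros)
  have D: "((\<lambda>s. f (x + (s * h) *\<^sub>R axis i 1)) has_vector_derivative of_real h * ?g s) (at s within {0..1})" for s
  proof -
    let ?D = "frechet_derivative f (at (x + (s * h) *\<^sub>R axis i 1))"
    have f: "(f has_derivative ?D) (at (x + (s * h) *\<^sub>R axis i 1))"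
      by (rule has_derivative_frechet[OF d])
    have "((\<lambda>s. x + (s * h) *\<^sub>R axis i 1) has_derivative (\<lambda>t. (t * h) *\<^sub>R axis i 1)) (at s)"
      by (auto intro!: derivative_eq_intros)
    from diff_chain_at[OF this f]
    have "((\<lambda>s. f (x + (s * h) *\<^sub>R axis i 1)) has_derivative (\<lambda>t. ?D ((t * h) *\<^sub>R axis i 1))) (at s)"
      by (simp add: o_def)
    also have "(\<lambda>t. ?D ((t * h) *\<^sub>R axis i 1)) = (\<lambda>t. t *\<^sub>R (of_real h * ?g s))"
      unfolding linear_cmul[OF has_derivative_linear[OF f]]
      by (auto simp: partial_derivative_def scaleR_conv_of_real[where 'a=complex])
    finally show ?thesis
      by (auto simp: has_vector_derivative_def intro: has_derivative_at_withinI)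
  qed
  have "f (x + h *\<^sub>R axis i 1) - f x = (\<integral>s. indicator {0..1} s *\<^sub>R (of_real h * ?g s) \<partial>lborel)"
    by (subst integral_FTC_atLeastAtMost[OF _ D]) (auto intro!: continuous_intros cg)
  also have "\<dots> = (\<integral>s. of_real h * ?g s \<partial>unif01)"
    using borel_measurable_continuous_onI[OF cg] by (intro integral_unif01[symmetric] borel_measurable_times) auto
  finally show ?thesis by (simp add: segment_average_def)
qed

text \<open>Fubini for two factors that are square integrable over the product space; the sum of
  their squares dominates the product.\<close>

lemma average_swap:
  assumes F[measurable]: "(\<lambda>(s, x). F s x) \<in> borel_measurable (unif01 \<Otimes>\<^sub>M lborel)"
    and G[measurable]: "(\<lambda>(s, x). G s x) \<in> borel_measurable (unif01 \<Otimes>\<^sub>M lborel)"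
    and f: "(\<integral>\<^sup>+s. sq_norm (F s) \<partial>unif01) < \<infinity>" and g: "(\<integral>\<^sup>+s. sq_norm (G s) \<partial>unif01) < \<infinity>"
  shows "(\<integral>x. (\<integral>s. F s x * G s x \<partial>unif01) \<partial>lborel) = (\<integral>s. (\<integral>x. F s x * G s x \<partial>lborel) \<partial>unif01)"
proof -
  interpret pair_sigma_finite unif01 lborel ..
  have i: "integrable (unif01 \<Otimes>\<^sub>M lborel) (\<lambda>(s, x). (cmod (H s x))\<^sup>2)"
    if [measurable]: "(\<lambda>(s, x). H s x) \<in> borel_measurable (unif01 \<Otimes>\<^sub>M lborel)"
      and h: "(\<integral>\<^sup>+s. sq_norm (H s) \<partial>unif01) < \<infinity>" for H
  proof (rule integrableI_bounded)
    have "(\<integral>\<^sup>+p. ennreal (norm (case p of (s, x) \<Rightarrow> (cmod (H s x))\<^sup>2)) \<partial>(unif01 \<Otimes>\<^sub>M lborel)) = (\<integral>\<^sup>+s. sq_norm (H s) \<partial>unif01)"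
      unfolding sq_norm_def by (subst lborel.nn_integral_fst[symmetric]) (auto simp: case_prod_beta')
    with h show "(\<integral>\<^sup>+p. ennreal (norm (case p of (s, x) \<Rightarrow> (cmod (H s x))\<^sup>2)) \<partial>(unif01 \<Otimes>\<^sub>M lborel)) < \<infinity>"
      by simp
  qed measurable
  have "integrable (unif01 \<Otimes>\<^sub>M lborel) (\<lambda>(s, x). F s x * G s x)"
  proof (rule Bochner_Integration.integrable_bound)
    show "integrable (unif01 \<Otimes>\<^sub>M lborel) (\<lambda>p. (case p of (s, x) \<Rightarrow> (cmod (F s x))\<^sup>2) + (case p of (s, x) \<Rightarrow> (cmod (G s x))\<^sup>2))"
      by (intro Bochner_Integration.integrable_add i F G f g)
    show "AE p in unif01 \<Otimes>\<^sub>M lborel. norm (case p of (s, x) \<Rightarrow> F s x * G s x) \<le>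
      norm ((case p of (s, x) \<Rightarrow> (cmod (F s x))\<^sup>2) + (case p of (s, x) \<Rightarrow> (cmod (G s x))\<^sup>2))"
      unfolding case_prod_beta' by (rule AE_I2) (rule norm_mult_le_sum_squares)
  qed measurable
  from Fubini_integral[OF this] show ?thesis .
qed

text \<open>Both sides are tested against phi. Translations of g move to phi, the weak derivative is
  applied to each translated test function, and averaging over s yields the segment average, with
  step -h, of the classical derivative of phi. By \<open>segment_FTC\<close> this is a difference of
  values of phi, and its translation moves back to u.\<close>

lemma weak_segment_FTC:
  fixes u g :: "real ^ 'n::finite \<Rightarrow> complex"
  assumes w: "has_weak_derivative i u g" and u: "square_integrable u" and g: "square_integrable g"
  shows "AE x in lborel. u (x + h *\<^sub>R axis i 1) - u x = of_real h * segment_average h i g x"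
proof (rule AE_eq_if_equal_on_test_functions)
  note [measurable] = u[THEN square_integrable_measurable] g[THEN square_integrable_measurable]
  let ?e = "axis i 1 :: real ^ 'n"
  show "locally_integrable (\<lambda>x. u (x + h *\<^sub>R ?e) - u x)"
    by (intro square_integrable_imp_locally_integrable square_integrable_diff square_integrable_translate u)
  show "locally_integrable (\<lambda>x. of_real h * segment_average h i g x)"
    by (intro square_integrable_imp_locally_integrable square_integrable_cmult square_integrable_segment_average g)
  fix \<phi> :: "real ^ 'n \<Rightarrow> complex" assume \<phi>: "test_function \<phi>"
  let ?d = "partial_derivative i \<phi>"
  note si = test_function_square_integrable[OF \<phi>]
  note [measurable] = si(1)[THEN square_integrable_measurable] si(2)[of i, THEN square_integrable_measurable]
  note fin = unif01.emeasure_space_1 sq_norm_finite[OF u, simplified] sq_norm_finite[OF g, simplified]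
    sq_norm_finite[OF si(1), simplified] sq_norm_finite[OF si(2), simplified]
  have shift: "(\<integral>x. f (x + a) * k x \<partial>lborel) = (\<integral>x. f x * k (x + - a) \<partial>lborel)"
    if [measurable]: "f \<in> borel_measurable borel" "k \<in> borel_measurable borel" for f k :: "real^'n \<Rightarrow> complex" and a
    using integral_translate[of "\<lambda>x. f x * k (x + - a)" a] by simp
  have "(\<integral>x. segment_average h i g x * \<phi> x \<partial>lborel)
      = (\<integral>x. (\<integral>s. g (x + (s * h) *\<^sub>R ?e) * \<phi> x \<partial>unif01) \<partial>lborel)"
    by (simp add: segment_average_def)
  also have "\<dots> = (\<integral>s. (\<integral>x. g (x + (s * h) *\<^sub>R ?e) * \<phi> x \<partial>lborel) \<partial>unif01)"
    by (rule average_swap) (auto simp: sq_norm_translate fin)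
  also have "\<dots> = (\<integral>s. - (\<integral>x. u x * ?d (x + (s * - h) *\<^sub>R ?e) \<partial>lborel) \<partial>unif01)"
  proof (rule Bochner_Integration.integral_cong[OF refl])
    fix s
    have W: "(\<integral>x. u x * partial_derivative i \<psi> x \<partial>lborel) = - (\<integral>x. g x * \<psi> x \<partial>lborel)"
      if "test_function \<psi>" for \<psi>
      using w that unfolding has_weak_derivative_def by blast
    have d\<psi>: "partial_derivative i (\<lambda>x. \<phi> (x + - ((s * h) *\<^sub>R ?e))) = (\<lambda>x. ?d (x + - ((s * h) *\<^sub>R ?e)))"
      by (rule partial_derivative_translate) (rule test_functionD[OF \<phi>])
    have "(\<integral>x. g (x + (s * h) *\<^sub>R ?e) * \<phi> x \<partial>lborel) = (\<integral>x. g x * \<phi> (x + - ((s * h) *\<^sub>R ?e)) \<partial>lborel)"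
      by (rule shift) auto
    also have "\<dots> = - (\<integral>x. u x * ?d (x + - ((s * h) *\<^sub>R ?e)) \<partial>lborel)"
      using W[OF test_function_translate[OF \<phi>, of "- ((s * h) *\<^sub>R ?e)"]] unfolding d\<psi> by simp
    finally show "(\<integral>x. g (x + (s * h) *\<^sub>R ?e) * \<phi> x \<partial>lborel) = - (\<integral>x. u x * ?d (x + (s * - h) *\<^sub>R ?e) \<partial>lborel)"
      by simp
  qed
  also have "\<dots> = - (\<integral>s. (\<integral>x. u x * ?d (x + (s * - h) *\<^sub>R ?e) \<partial>lborel) \<partial>unif01)"
    by simp
  also have "(\<integral>s. (\<integral>x. u x * ?d (x + (s * - h) *\<^sub>R ?e) \<partial>lborel) \<partial>unif01)
     = (\<integral>x. (\<integral>s. u x * ?d (x + (s * - h) *\<^sub>R ?e) \<partial>unif01) \<partial>lborel)"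
    using sq_norm_translate[of ?d "- _"]
    by (intro average_swap[symmetric]) (auto simp: fin)
  also have "\<dots> = (\<integral>x. u x * segment_average (- h) i ?d x \<partial>lborel)"
    by (simp add: segment_average_def)
  finally have 1: "(\<integral>x. segment_average h i g x * \<phi> x \<partial>lborel) = - (\<integral>x. u x * segment_average (- h) i ?d x \<partial>lborel)" .
  have "(\<integral>x. (u (x + h *\<^sub>R ?e) - u x) * \<phi> x \<partial>lborel)
      = (\<integral>x. u (x + h *\<^sub>R ?e) * \<phi> x \<partial>lborel) - (\<integral>x. u x * \<phi> x \<partial>lborel)"
    unfolding left_diff_distrib
    by (intro Bochner_Integration.integral_diff integrable_mult_square_integrable square_integrable_translate u si)
  also have "(\<integral>x. u (x + h *\<^sub>R ?e) * \<phi> x \<partial>lborel) = (\<integral>x. u x * \<phi> (x + - (h *\<^sub>R ?e)) \<partial>lborel)"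
    by (rule shift) auto
  also have "\<dots> - (\<integral>x. u x * \<phi> x \<partial>lborel) = (\<integral>x. u x * \<phi> (x + - (h *\<^sub>R ?e)) - u x * \<phi> x \<partial>lborel)"
    by (intro Bochner_Integration.integral_diff[symmetric] integrable_mult_square_integrable square_integrable_translate u si)
  also have "\<dots> = (\<integral>x. - of_real h * (u x * segment_average (- h) i ?d x) \<partial>lborel)"
  proof (rule Bochner_Integration.integral_cong[OF refl])
    fix x
    have "\<phi> (x + - (h *\<^sub>R ?e)) - \<phi> x = - of_real h * segment_average (- h) i ?d x"
      using segment_FTC[OF test_functionD(1)[OF \<phi>] test_functionD(3)[OF \<phi>], where h="- h"] by simp
    then show "u x * \<phi> (x + - (h *\<^sub>R ?e)) - u x * \<phi> x = - of_real h * (u x * segment_average (- h) i ?d x)"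
      unfolding right_diff_distrib[symmetric] by simp
  qed
  also have "\<dots> = of_real h * (\<integral>x. segment_average h i g x * \<phi> x \<partial>lborel)"
    unfolding 1 by simp
  also have "\<dots> = (\<integral>x. of_real h * segment_average h i g x * \<phi> x \<partial>lborel)"
    by (simp add: mult.assoc)
  finally show "(\<integral>x. (u (x + h *\<^sub>R ?e) - u x) * \<phi> x \<partial>lborel) = (\<integral>x. of_real h * segment_average h i g x * \<phi> x \<partial>lborel)" .
qed

lemma diff_quot_eq_segment_average:
  assumes "has_weak_derivative i u g" "square_integrable u" "square_integrable g" "h \<noteq> 0"
  shows "AE x in lborel. diff_quot h i u x = segment_average h i g x"
  using weak_segment_FTC[OF assms(1-3), of h]
  by eventually_elim (use assms(4) in \<open>simp add: diff_quot_def\<close>)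

lemma sq_norm_diff_quot_le:
  assumes "has_weak_derivative i u g" "square_integrable u" "square_integrable g" "h \<noteq> 0"
  shows "sq_norm (diff_quot h i u) \<le> sq_norm g"
  using sq_norm_cong_AE[OF diff_quot_eq_segment_average[OF assms]] sq_norm_segment_average_le[OF assms(3), of h i]
  by simp

lemma nn_integral_segment_translate_tendsto:
  fixes f :: "real ^ 'n::finite \<Rightarrow> complex"
  assumes f: "square_integrable f" and y: "y \<longlonglongrightarrow> 0"
  shows "(\<lambda>n. \<integral>\<^sup>+s. sq_norm (\<lambda>x. f (x + (s * y n) *\<^sub>R axis i 1) - f x) \<partial>unif01) \<longlonglongrightarrow> 0"
proof -
  note [measurable] = f[THEN square_integrable_measurable]
  have "(\<lambda>n. \<integral>\<^sup>+s. sq_norm (\<lambda>x. f (x + (s * y n) *\<^sub>R axis i 1) - f x) \<partial>unif01) \<longlonglongrightarrow> (\<integral>\<^sup>+s. 0 \<partial>unif01)"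
  proof (rule nn_integral_dominated_convergence[where w="\<lambda>_. 4 * sq_norm f"])
    show "AE s in unif01. sq_norm (\<lambda>x. f (x + (s * y n) *\<^sub>R axis i 1) - f x) \<le> 4 * sq_norm f" for n
    proof (rule AE_I2)
      fix s
      have "sq_norm (\<lambda>x. f (x + (s * y n) *\<^sub>R axis i 1) - f x) \<le> 2 * sq_norm f + 2 * sq_norm f"
        using sq_norm_diff_le[of "\<lambda>x. f (x + (s * y n) *\<^sub>R axis i 1)" f] by (simp add: sq_norm_translate)
      also have "\<dots> = 4 * sq_norm f" by (simp flip: distrib_right)
      finally show "sq_norm (\<lambda>x. f (x + (s * y n) *\<^sub>R axis i 1) - f x) \<le> 4 * sq_norm f" .
    qed
    show "(\<integral>\<^sup>+s. 4 * sq_norm f \<partial>unif01) < \<infinity>"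
      using sq_norm_finite[OF f] unif01.emeasure_space_1 by (simp add: ennreal_mult_less_top)
    show "AE s in unif01. (\<lambda>n. sq_norm (\<lambda>x. f (x + (s * y n) *\<^sub>R axis i 1) - f x)) \<longlonglongrightarrow> 0"
    proof (rule AE_I2)
      fix s
      have "(\<lambda>n. (s * y n) *\<^sub>R axis i 1 :: real^'n) \<longlonglongrightarrow> (s * 0) *\<^sub>R axis i 1"
        by (intro tendsto_intros y)
      then show "(\<lambda>n. sq_norm (\<lambda>x. f (x + (s * y n) *\<^sub>R axis i 1) - f x)) \<longlonglongrightarrow> 0"
        by (intro sq_norm_translate_tendsto f) simp
    qed
    show "(\<lambda>s. sq_norm (\<lambda>x. f (x + (s * y n) *\<^sub>R axis i 1) - f x)) \<in> borel_measurable unif01" for n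
      unfolding sq_norm_def by measurable
  qed auto
  then show ?thesis by simp
qed

text \<open>The quotient is an average of g over short segments, and translations of g are
  continuous in L^2.\<close>

lemma diff_quot_tendsto:
  assumes w: "has_weak_derivative i u g" and u: "square_integrable u" and g: "square_integrable g"
    and y: "y \<longlonglongrightarrow> 0" "\<And>n. y n \<noteq> 0"
  shows "(\<lambda>n. sq_norm (\<lambda>x. diff_quot (y n) i u x - g x)) \<longlonglongrightarrow> 0"
proof (rule tendsto_sandwich[OF _ _ tendsto_const nn_integral_segment_translate_tendsto[OF g y(1)]])
  have "sq_norm (\<lambda>x. diff_quot (y n) i u x - g x) = sq_norm (\<lambda>x. segment_average (y n) i g x - g x)" for n
    using diff_quot_eq_segment_average[OF w u g y(2)[of n]]
    by (intro sq_norm_cong_AE) (auto elim!: eventually_mono)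
  then show "\<forall>\<^sub>F n in sequentially. sq_norm (\<lambda>x. diff_quot (y n) i u x - g x)
      \<le> (\<integral>\<^sup>+s. sq_norm (\<lambda>x. g (x + (s * y n) *\<^sub>R axis i 1) - g x) \<partial>unif01)"
    using sq_norm_segment_average_diff_le[OF g square_integrable_measurable[OF g]] by simp
qed auto

section \<open>Difference quotients of weakly differentiable functions and second quotients\<close>

lemma integral_diff_quot_mult:
  fixes f k :: "real ^ 'n::finite \<Rightarrow> complex"
  assumes f: "square_integrable f" and k: "square_integrable k"
  shows "(\<integral>x. diff_quot h j f x * k x \<partial>lborel)
     = ((\<integral>x. f x * k (x + - (h *\<^sub>R axis j 1)) \<partial>lborel) - (\<integral>x. f x * k x \<partial>lborel)) / of_real h"
proof -
  let ?e = "axis j 1 :: real ^ 'n"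
  note [measurable] = f[THEN square_integrable_measurable] k[THEN square_integrable_measurable]
  have "(\<integral>x. diff_quot h j f x * k x \<partial>lborel) = (\<integral>x. (f (x + h *\<^sub>R ?e) * k x - f x * k x) / of_real h \<partial>lborel)"
    by (intro Bochner_Integration.integral_cong) (auto simp: diff_quot_def algebra_simps diff_divide_distrib)
  also have "\<dots> = (\<integral>x. f (x + h *\<^sub>R ?e) * k x - f x * k x \<partial>lborel) / of_real h"
    by simp
  also have "(\<integral>x. f (x + h *\<^sub>R ?e) * k x - f x * k x \<partial>lborel) = (\<integral>x. f (x + h *\<^sub>R ?e) * k x \<partial>lborel) - (\<integral>x. f x * k x \<partial>lborel)"
    by (intro Bochner_Integration.integral_diff integrable_mult_square_integrable square_integrable_translate f k)
  also have "(\<integral>x. f (x + h *\<^sub>R ?e) * k x \<partial>lborel) = (\<integral>x. f x * k (x + - (h *\<^sub>R ?e)) \<partial>lborel)"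
    using integral_translate[of "\<lambda>x. f x * k (x + - (h *\<^sub>R ?e))" "h *\<^sub>R ?e"] by simp
  finally show ?thesis .
qed

text \<open>Translates of test functions are test functions. This lets the first-order results be
  applied to a difference quotient in place of u.\<close>

lemma has_weak_derivative_diff_quot:
  assumes w: "has_weak_derivative i u g" and u: "square_integrable u" and g: "square_integrable g"
  shows "has_weak_derivative i (diff_quot h j u) (diff_quot h j g)"
  unfolding has_weak_derivative_def
proof (intro conjI allI impI)
  note [measurable] = u[THEN square_integrable_measurable] g[THEN square_integrable_measurable]
  show "locally_integrable (diff_quot h j u)" "locally_integrable (diff_quot h j g)"
    using u g square_integrable_diff_quot square_integrable_imp_locally_integrable by blast+
  fix \<phi> :: "real ^ 'a \<Rightarrow> complex" assume \<phi>: "test_function \<phi>"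
  let ?e = "axis j 1 :: real ^ 'a"
  let ?\<psi> = "\<lambda>x. \<phi> (x + - (h *\<^sub>R ?e))" and ?d = "partial_derivative i \<phi>"
  have \<psi>: "test_function ?\<psi>" by (rule test_function_translate[OF \<phi>])
  have d\<psi>: "partial_derivative i ?\<psi> = (\<lambda>x. ?d (x + - (h *\<^sub>R ?e)))"
    by (rule partial_derivative_translate) (rule test_functionD[OF \<phi>])
  note si = test_function_square_integrable[OF \<phi>]
  have W: "(\<integral>x. u x * partial_derivative i \<psi> x \<partial>lborel) = - (\<integral>x. g x * \<psi> x \<partial>lborel)"
    if "test_function \<psi>" for \<psi>
    using w that unfolding has_weak_derivative_def by blast
  have "(\<integral>x. u x * ?d (x + - (h *\<^sub>R ?e)) \<partial>lborel) = - (\<integral>x. g x * ?\<psi> x \<partial>lborel)"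
    using W[OF \<psi>] unfolding d\<psi> .
  moreover have "(\<integral>x. u x * ?d x \<partial>lborel) = - (\<integral>x. g x * \<phi> x \<partial>lborel)"
    by (rule W[OF \<phi>])
  ultimately show "(\<integral>x. diff_quot h j u x * ?d x \<partial>lborel) = - (\<integral>x. diff_quot h j g x * \<phi> x \<partial>lborel)"
    unfolding integral_diff_quot_mult[OF u si(2)] integral_diff_quot_mult[OF g si(1)] by (simp add: diff_divide_distrib)
qed

lemma diff_quot_commute: "diff_quot a i (diff_quot b j u) = diff_quot b j (diff_quot a i u)"
  by (rule ext) (simp add: diff_quot_def diff_divide_distrib add_ac mult_ac)

text \<open>After commuting, the outer quotient acts on \<open>diff_quot (- h) i u\<close>, whose
  weak derivative is \<open>diff_quot (- h) i g\<close>, so the first-order bound applies twice. The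
  steps h and -h together give the symmetric second difference divided by h^2.\<close>

lemma sq_norm_diff_quot2_le:
  assumes w: "has_weak_derivative i u g" "has_weak_derivative i g k"
    and si: "square_integrable u" "square_integrable g" "square_integrable k" and h: "h \<noteq> 0"
  shows "sq_norm (diff_quot (- h) i (diff_quot h i u)) \<le> sq_norm k"
proof -
  have "sq_norm (diff_quot (- h) i (diff_quot h i u)) = sq_norm (diff_quot h i (diff_quot (- h) i u))"
    by (subst diff_quot_commute) simp
  also have "\<dots> \<le> sq_norm (diff_quot (- h) i g)"
    by (rule sq_norm_diff_quot_le[OF has_weak_derivative_diff_quot[OF w(1) si(1,2)]])
       (auto intro: square_integrable_diff_quot si simp: h)
  also have "\<dots> \<le> sq_norm k"
    using h by (intro sq_norm_diff_quot_le[OF w(2) si(2,3)]) auto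
  finally show ?thesis .
qed

text \<open>The double quotient is a segment average of \<open>diff_quot (- y n) i g\<close>. Its
  distance to k splits into the first-order error of that quotient and the continuity of
  translations of k.\<close>

lemma diff_quot2_tendsto:
  assumes w: "has_weak_derivative i u g" "has_weak_derivative i g k"
    and si: "square_integrable u" "square_integrable g" "square_integrable k"
    and y: "y \<longlonglongrightarrow> 0" "\<And>n. y n \<noteq> 0"
  shows "(\<lambda>n. sq_norm (\<lambda>x. diff_quot (- y n) i (diff_quot (y n) i u) x - k x)) \<longlonglongrightarrow> 0"
proof -
  note [measurable] = si[THEN square_integrable_measurable]
  let ?A = "\<lambda>n. sq_norm (\<lambda>x. diff_quot (- y n) i g x - k x)"
  let ?B = "\<lambda>n. \<integral>\<^sup>+s. sq_norm (\<lambda>x. k (x + (s * y n) *\<^sub>R axis i 1) - k x) \<partial>unif01"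
  have "(\<lambda>n. 2 * ?A n + 2 * ?B n) \<longlonglongrightarrow> 2 * 0 + 2 * 0"
    using y tendsto_minus[OF y(1)]
    by (intro tendsto_add ennreal_tendsto_cmult diff_quot_tendsto[OF w(2) si(2,3)] nn_integral_segment_translate_tendsto si) auto
  then have L: "(\<lambda>n. 2 * ?A n + 2 * ?B n) \<longlonglongrightarrow> 0" by simp
  show ?thesis
  proof (rule tendsto_sandwich[OF _ _ tendsto_const L])
    have "sq_norm (\<lambda>x. diff_quot (- y n) i (diff_quot (y n) i u) x - k x) \<le> 2 * ?A n + 2 * ?B n" for n
    proof -
      let ?g = "diff_quot (- y n) i g"
      have sg: "square_integrable ?g" by (rule square_integrable_diff_quot[OF si(2)])
      note [measurable] = sg[THEN square_integrable_measurable]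
      have "AE x in lborel. diff_quot (y n) i (diff_quot (- y n) i u) x = segment_average (y n) i ?g x"
        by (rule diff_quot_eq_segment_average[OF has_weak_derivative_diff_quot[OF w(1) si(1,2)] _ sg y(2)])
           (rule square_integrable_diff_quot[OF si(1)])
      then have "sq_norm (\<lambda>x. diff_quot (- y n) i (diff_quot (y n) i u) x - k x)
          = sq_norm (\<lambda>x. segment_average (y n) i ?g x - k x)"
        unfolding diff_quot_commute[of "- y n"]
        by (intro sq_norm_cong_AE) (auto elim!: eventually_mono)
      also have "\<dots> \<le> (\<integral>\<^sup>+s. sq_norm (\<lambda>x. ?g (x + (s * y n) *\<^sub>R axis i 1) - k x) \<partial>unif01)"
        by (rule sq_norm_segment_average_diff_le[OF sg]) measurable
      also have "\<dots> \<le> (\<integral>\<^sup>+s. 2 * ?A n + 2 * sq_norm (\<lambda>x. k (x + (s * y n) *\<^sub>R axis i 1) - k x) \<partial>unif01)"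
      proof (rule nn_integral_mono)
        fix s
        let ?a = "(s * y n) *\<^sub>R axis i 1 :: real ^ 'a"
        have "sq_norm (\<lambda>x. ?g (x + ?a) - k x) = sq_norm (\<lambda>x. (?g (x + ?a) - k (x + ?a)) + (k (x + ?a) - k x))"
          by (rule arg_cong[where f=sq_norm]) auto
        also have "\<dots> \<le> 2 * sq_norm (\<lambda>x. ?g (x + ?a) - k (x + ?a)) + 2 * sq_norm (\<lambda>x. k (x + ?a) - k x)"
          by (rule sq_norm_add_le) measurable
        also have "sq_norm (\<lambda>x. ?g (x + ?a) - k (x + ?a)) = ?A n"
          by (rule sq_norm_translate[of "\<lambda>x. ?g x - k x"]) measurable
        finally show "sq_norm (\<lambda>x. ?g (x + ?a) - k x) \<le> 2 * ?A n + 2 * sq_norm (\<lambda>x. k (x + ?a) - k x)" .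
      qed
      also have "\<dots> = 2 * ?A n + 2 * ?B n"
      proof -
        have [measurable]: "(\<lambda>s. sq_norm (\<lambda>x. k (x + (s * y n) *\<^sub>R axis i 1) - k x)) \<in> borel_measurable unif01"
          unfolding sq_norm_def by measurable
        show ?thesis
          using unif01.emeasure_space_1 by (simp add: nn_integral_add nn_integral_cmult)
      qed
      finally show ?thesis .
    qed
    then show "\<forall>\<^sub>F n in sequentially. sq_norm (\<lambda>x. diff_quot (- y n) i (diff_quot (y n) i u) x - k x) \<le> 2 * ?A n + 2 * ?B n"
      by simp
  qed auto
qed

subsection \<open>Energy identities in \<open>H\<^sup>2\<close>\<close>

lemma Cauchy_Schwarz_square_integrable:
  assumes f: "square_integrable f" and g: "square_integrable g"
  shows "cmod (\<integral>x. f x * g x \<partial>lborel)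
    \<le> sqrt ((\<integral>x. (cmod (f x))\<^sup>2 \<partial>lborel) * (\<integral>x. (cmod (g x))\<^sup>2 \<partial>lborel))"
  using Cauchy_Schwarz_sq_norm[OF f g]
  by (intro real_le_rsqrt)
     (simp add: sq_norm_eq_integral f g ennreal_power ennreal_mult[symmetric] Bochner_Integration.integral_nonneg)

lemma sq_norm_tendsto_0_iff:
  assumes "\<And>n. square_integrable (F n)"
  shows "(\<lambda>n. sq_norm (F n)) \<longlonglongrightarrow> 0 \<longleftrightarrow> (\<lambda>n. \<integral>x. (cmod (F n x))\<^sup>2 \<partial>lborel) \<longlonglongrightarrow> 0"
  by (simp add: sq_norm_eq_integral assms ennreal_tendsto_0_iff Bochner_Integration.integral_nonneg)

text \<open>F G - f g = (F - f) (G - g) + (F - f) g + f (G - g), and Cauchy-Schwarz bounds each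
  term.\<close>

lemma integral_mult_tendsto:
  assumes F: "\<And>n. square_integrable (F n)" "square_integrable f" "(\<lambda>n. sq_norm (\<lambda>x. F n x - f x)) \<longlonglongrightarrow> 0"
    and G: "\<And>n. square_integrable (G n)" "square_integrable g" "(\<lambda>n. sq_norm (\<lambda>x. G n x - g x)) \<longlonglongrightarrow> 0"
  shows "(\<lambda>n. \<integral>x. F n x * G n x \<partial>lborel) \<longlonglongrightarrow> (\<integral>x. f x * g x \<partial>lborel)"
proof -
  let ?r = "\<lambda>f. \<integral>x. (cmod (f x))\<^sup>2 \<partial>lborel"
  have dF: "square_integrable (\<lambda>x. F n x - f x)" and dG: "square_integrable (\<lambda>x. G n x - g x)" for n
    using F G by (auto intro: square_integrable_diff)
  have 1: "(\<lambda>n. ?r (\<lambda>x. F n x - f x)) \<longlonglongrightarrow> 0" "(\<lambda>n. ?r (\<lambda>x. G n x - g x)) \<longlonglongrightarrow> 0"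
    using F(3) G(3) sq_norm_tendsto_0_iff[OF dF] sq_norm_tendsto_0_iff[OF dG] by auto
  let ?b = "\<lambda>n. sqrt (?r (\<lambda>x. F n x - f x) * ?r (\<lambda>x. G n x - g x)) + sqrt (?r (\<lambda>x. F n x - f x) * ?r g)
      + sqrt (?r f * ?r (\<lambda>x. G n x - g x))"
  have "?b \<longlonglongrightarrow> sqrt (0 * 0) + sqrt (0 * ?r g) + sqrt (?r f * 0)"
    by (intro tendsto_intros 1)
  then have b: "?b \<longlonglongrightarrow> 0" by simp
  have "(\<lambda>n. (\<integral>x. F n x * G n x \<partial>lborel) - (\<integral>x. f x * g x \<partial>lborel)) \<longlonglongrightarrow> 0"
  proof (rule Lim_null_comparison[OF _ b], rule always_eventually, rule allI)
    fix n
    note int = integrable_mult_square_integrable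
    have "(\<integral>x. F n x * G n x \<partial>lborel) - (\<integral>x. f x * g x \<partial>lborel) = (\<integral>x. F n x * G n x - f x * g x \<partial>lborel)"
      by (intro Bochner_Integration.integral_diff[symmetric] int F G)
    also have "\<dots> = (\<integral>x. (F n x - f x) * (G n x - g x) + (F n x - f x) * g x + f x * (G n x - g x) \<partial>lborel)"
      by (intro Bochner_Integration.integral_cong) (auto simp: algebra_simps)
    also have "\<dots> = (\<integral>x. (F n x - f x) * (G n x - g x) \<partial>lborel) + (\<integral>x. (F n x - f x) * g x \<partial>lborel) + (\<integral>x. f x * (G n x - g x) \<partial>lborel)"
      by (subst Bochner_Integration.integral_add; (subst Bochner_Integration.integral_add)?)
         (intro Bochner_Integration.integrable_add int F G dF dG refl)+
    finally have "norm ((\<integral>x. F n x * G n x \<partial>lborel) - (\<integral>x. f x * g x \<partial>lborel))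
        \<le> norm (\<integral>x. (F n x - f x) * (G n x - g x) \<partial>lborel) + norm (\<integral>x. (F n x - f x) * g x \<partial>lborel) + norm (\<integral>x. f x * (G n x - g x) \<partial>lborel)"
      by (simp only:) (intro order_trans[OF norm_triangle_ineq] add_right_mono norm_triangle_ineq)
    also have "\<dots> \<le> ?b n"
      by (intro add_mono Cauchy_Schwarz_square_integrable F G dF dG)
    finally show "norm ((\<integral>x. F n x * G n x \<partial>lborel) - (\<integral>x. f x * g x \<partial>lborel)) \<le> ?b n" .
  qed
  then show ?thesis by (simp add: LIM_zero_iff)
qed

text \<open>Discrete integration by parts: translation invariance moves the shift to the other
  factor with the opposite sign.\<close>

lemma integral_diff_quot_adjoint:
  assumes f: "square_integrable f" and g: "square_integrable g"
  shows "(\<integral>x. diff_quot h i f x * g x \<partial>lborel) = - (\<integral>x. f x * diff_quot (- h) i g x \<partial>lborel)"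
proof -
  let ?e = "axis i 1 :: real ^ 'a"
  have "(\<integral>x. f x * diff_quot (- h) i g x \<partial>lborel) = (\<integral>x. - ((f x * g (x + - (h *\<^sub>R ?e)) - f x * g x) / of_real h) \<partial>lborel)"
    by (intro Bochner_Integration.integral_cong) (auto simp: diff_quot_def algebra_simps diff_divide_distrib)
  also have "\<dots> = - ((\<integral>x. f x * g (x + - (h *\<^sub>R ?e)) - f x * g x \<partial>lborel) / of_real h)"
    by simp
  also have "(\<integral>x. f x * g (x + - (h *\<^sub>R ?e)) - f x * g x \<partial>lborel)
      = (\<integral>x. f x * g (x + - (h *\<^sub>R ?e)) \<partial>lborel) - (\<integral>x. f x * g x \<partial>lborel)"
    by (intro Bochner_Integration.integral_diff integrable_mult_square_integrable square_integrable_translate f g)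
  finally show ?thesis by (simp add: integral_diff_quot_mult[OF f g])
qed

lemma diff_quot_cnj: "diff_quot h i (\<lambda>x. cnj (f x)) = (\<lambda>x. cnj (diff_quot h i f x))"
  by (simp add: diff_quot_def fun_eq_iff)

lemma sq_norm_cnj_diff: "sq_norm (\<lambda>x. cnj (f x) - cnj (g x)) = sq_norm (\<lambda>x. f x - g x)"
  unfolding sq_norm_def complex_cnj_diff[symmetric] complex_mod_cnj ..

text \<open>The function u is no test function, so the definition of a weak derivative cannot be
  paired with it. The discrete identity holds for u itself and passes to the limit.\<close>

lemma integral_norm_first_derivative:
  assumes w: "has_weak_derivative i u g" "has_weak_derivative i g k"
    and si: "square_integrable u" "square_integrable g" "square_integrable k"
  shows "(\<integral>x. g x * cnj (g x) \<partial>lborel) = - (\<integral>x. k x * cnj (u x) \<partial>lborel)"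
proof -
  let ?y = "\<lambda>n. inverse (real (Suc n))"
  have y: "?y \<longlonglongrightarrow> 0" "\<And>n. ?y n \<noteq> 0" using LIMSEQ_inverse_real_of_nat by auto
  note sdq = square_integrable_diff_quot square_integrable_cnj si
  note lim1 = diff_quot_tendsto[OF w(1) si(1,2) y]
  have "(\<lambda>n. \<integral>x. diff_quot (?y n) i u x * cnj (diff_quot (?y n) i u x) \<partial>lborel) \<longlonglongrightarrow> (\<integral>x. g x * cnj (g x) \<partial>lborel)"
    by (intro integral_mult_tendsto sdq) (simp_all only: sq_norm_cnj_diff lim1)
  moreover have "(\<lambda>n. \<integral>x. diff_quot (- ?y n) i (diff_quot (?y n) i u) x * cnj (u x) \<partial>lborel) \<longlonglongrightarrow> (\<integral>x. k x * cnj (u x) \<partial>lborel)"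
    by (intro integral_mult_tendsto sdq diff_quot2_tendsto[OF w si y]) (simp add: sq_norm_def)
  then have "(\<lambda>n. - (\<integral>x. diff_quot (- ?y n) i (diff_quot (?y n) i u) x * cnj (u x) \<partial>lborel)) \<longlonglongrightarrow> - (\<integral>x. k x * cnj (u x) \<partial>lborel)"
    by (rule tendsto_minus)
  moreover have "- (\<integral>x. diff_quot (- h) i (diff_quot h i u) x * cnj (u x) \<partial>lborel)
      = (\<integral>x. diff_quot h i u x * cnj (diff_quot h i u x) \<partial>lborel)" for h
    by (subst integral_diff_quot_adjoint) (auto intro: sdq simp: diff_quot_cnj)
  ultimately show ?thesis
    using LIMSEQ_unique by simp
qed

text \<open>The discrete counterpart is the integral of \<open>\<bar>D\<^sub>i D\<^sub>j u\<bar>\<^sup>2\<close>.\<close>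
lemma integral_second_derivatives_nonneg:
  assumes wi: "has_weak_derivative i u gi" "has_weak_derivative i gi ki"
    and wj: "has_weak_derivative j u gj" "has_weak_derivative j gj kj"
    and u: "square_integrable u" and si: "square_integrable gi" "square_integrable ki"
    and sj: "square_integrable gj" "square_integrable kj"
  shows "0 \<le> Re (\<integral>x. ki x * cnj (kj x) \<partial>lborel)"
proof -
  let ?y = "\<lambda>n. inverse (real (Suc n))"
  have y: "?y \<longlonglongrightarrow> 0" "\<And>n. ?y n \<noteq> 0" using LIMSEQ_inverse_real_of_nat by auto
  note sdq = square_integrable_diff_quot square_integrable_cnj u si sj
  let ?D = "\<lambda>h i. diff_quot (- h) i (diff_quot h i u)"
  have "(\<lambda>n. \<integral>x. ?D (?y n) i x * cnj (?D (?y n) j x) \<partial>lborel) \<longlonglongrightarrow> (\<integral>x. ki x * cnj (kj x) \<partial>lborel)"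
    using diff_quot2_tendsto[OF wj u sj y]
    by (intro integral_mult_tendsto sdq diff_quot2_tendsto[OF wi u si y]) (simp only: sq_norm_cnj_diff)
  then have "(\<lambda>n. Re (\<integral>x. ?D (?y n) i x * cnj (?D (?y n) j x) \<partial>lborel)) \<longlonglongrightarrow> Re (\<integral>x. ki x * cnj (kj x) \<partial>lborel)"
    by (rule tendsto_Re)
  moreover have "0 \<le> Re (\<integral>x. ?D h i x * cnj (?D h j x) \<partial>lborel)" for h
  proof -
    let ?v = "\<lambda>x. cnj (u x)"
    have "(\<integral>x. ?D h i x * cnj (?D h j x) \<partial>lborel)
        = (\<integral>x. ?D h i x * diff_quot (- h) j (diff_quot h j ?v) x \<partial>lborel)"
      by (simp add: diff_quot_cnj)
    also have "\<dots> = - (\<integral>x. diff_quot h i u x * diff_quot h i (diff_quot (- h) j (diff_quot h j ?v)) x \<partial>lborel)"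
      by (subst integral_diff_quot_adjoint) (auto intro: sdq)
    also have "diff_quot h i (diff_quot (- h) j (diff_quot h j ?v)) = diff_quot (- h) j (diff_quot h i (diff_quot h j ?v))"
      by (rule diff_quot_commute)
    also have "- (\<integral>x. diff_quot h i u x * diff_quot (- h) j (diff_quot h i (diff_quot h j ?v)) x \<partial>lborel)
        = (\<integral>x. diff_quot h j (diff_quot h i u) x * diff_quot h i (diff_quot h j ?v) x \<partial>lborel)"
      by (subst integral_diff_quot_adjoint) (auto intro: sdq)
    also have "diff_quot h j (diff_quot h i u) = diff_quot h i (diff_quot h j u)"
      by (rule diff_quot_commute)
    also have "(\<integral>x. diff_quot h i (diff_quot h j u) x * diff_quot h i (diff_quot h j ?v) x \<partial>lborel)
        = (\<integral>x. complex_of_real ((cmod (diff_quot h i (diff_quot h j u) x))\<^sup>2) \<partial>lborel)"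
      by (simp only: diff_quot_cnj complex_norm_square)
    finally show ?thesis
      by (simp only: integral_complex_of_real Re_complex_of_real) simp
  qed
  ultimately show ?thesis
    by (intro LIMSEQ_le_const) auto
qed

text \<open>Mixed derivatives are left out: the averages act in one coordinate at a time, and the
  Laplacian is the sum of the k i. Explicit witnesses keep the estimates free of the choice in
  \<open>weak_derivative\<close>.\<close>

definition has_pure_derivatives2 ::
    "(real ^ 'n::finite \<Rightarrow> complex) \<Rightarrow> ('n \<Rightarrow> real ^ 'n \<Rightarrow> complex) \<Rightarrow> ('n \<Rightarrow> real ^ 'n \<Rightarrow> complex) \<Rightarrow> bool" where
  "has_pure_derivatives2 u w k \<longleftrightarrow> square_integrable u \<and>
     (\<forall>i. square_integrable (w i) \<and> square_integrable (k i) \<and>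
        has_weak_derivative i u (w i) \<and> has_weak_derivative i (w i) (k i))"

lemma integral_norm_sum:
  fixes k :: "'n::finite \<Rightarrow> real ^ 'n \<Rightarrow> complex"
  assumes "\<And>i. square_integrable (k i)"
  shows "complex_of_real (\<integral>x. (cmod (\<Sum>i\<in>UNIV. k i x))\<^sup>2 \<partial>lborel)
    = (\<Sum>i\<in>UNIV. \<Sum>j\<in>UNIV. \<integral>x. k i x * cnj (k j x) \<partial>lborel)"
proof -
  note int = integrable_mult_square_integrable square_integrable_cnj assms
  have "complex_of_real (\<integral>x. (cmod (\<Sum>i\<in>UNIV. k i x))\<^sup>2 \<partial>lborel) = (\<integral>x. complex_of_real ((cmod (\<Sum>i\<in>UNIV. k i x))\<^sup>2) \<partial>lborel)"
    by (rule integral_complex_of_real[symmetric])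
  also have "\<dots> = (\<integral>x. (\<Sum>i\<in>UNIV. \<Sum>j\<in>UNIV. k i x * cnj (k j x)) \<partial>lborel)"
    by (simp only: complex_norm_square cnj_sum sum_product)
  also have "\<dots> = (\<Sum>i\<in>UNIV. \<Sum>j\<in>UNIV. \<integral>x. k i x * cnj (k j x) \<partial>lborel)"
    by (subst Bochner_Integration.integral_sum, intro Bochner_Integration.integrable_sum int)
       (subst Bochner_Integration.integral_sum, auto intro!: int)
  finally show ?thesis .
qed

text \<open>In the expanded square of the sum all integrals of products have nonnegative real part,
  so the diagonal is at most the whole. Thus the Laplacian controls each pure second
  derivative.\<close>

lemma sum_pure_second_derivatives_le:
  fixes u :: "real ^ 'n::finite \<Rightarrow> complex"
  assumes "has_pure_derivatives2 u w k"
  shows "(\<Sum>i\<in>UNIV. sq_norm (k i)) \<le> sq_norm (\<lambda>x. \<Sum>i\<in>UNIV. k i x)"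
proof -
  have k: "square_integrable (k i)" for i using assms by (simp add: has_pure_derivatives2_def)
  have r: "Re (\<integral>x. k i x * cnj (k i x) \<partial>lborel) = (\<integral>x. (cmod (k i x))\<^sup>2 \<partial>lborel)" for i
    by (simp only: complex_norm_square[symmetric] integral_complex_of_real Re_complex_of_real)
  have nn: "0 \<le> Re (\<integral>x. k i x * cnj (k j x) \<partial>lborel)" for i j
    using assms unfolding has_pure_derivatives2_def
    by (intro integral_second_derivatives_nonneg[of i u "w i" "k i" j "w j" "k j"]) auto
  have "(\<Sum>i\<in>UNIV. \<integral>x. (cmod (k i x))\<^sup>2 \<partial>lborel) \<le> (\<Sum>i\<in>UNIV. \<Sum>j\<in>UNIV. Re (\<integral>x. k i x * cnj (k j x) \<partial>lborel))"
    by (intro sum_mono) (simp add: r[symmetric] member_le_sum[where f="\<lambda>j. Re (\<integral>x. k _ x * cnj (k j x) \<partial>lborel)"] nn)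
  also have "\<dots> = Re (complex_of_real (\<integral>x. (cmod (\<Sum>i\<in>UNIV. k i x))\<^sup>2 \<partial>lborel))"
    by (subst integral_norm_sum[OF k]) simp
  finally show ?thesis
    using k by (simp add: sq_norm_eq_integral square_integrable_sum sum_ennreal Bochner_Integration.integral_nonneg ennreal_leI)
qed

section \<open>Independence of the chosen representatives of weak derivatives\<close>

lemma has_weak_derivative_unique:
  assumes "has_weak_derivative i u g" "has_weak_derivative i u g'"
  shows "AE x in lborel. g x = g' x"
proof (rule AE_eq_if_equal_on_test_functions)
  fix \<phi> :: "real ^ 'a \<Rightarrow> complex" assume "test_function \<phi>"
  then have "(\<integral>x. u x * partial_derivative i \<phi> x \<partial>lborel) = - (\<integral>x. g x * \<phi> x \<partial>lborel)"
    "(\<integral>x. u x * partial_derivative i \<phi> x \<partial>lborel) = - (\<integral>x. g' x * \<phi> x \<partial>lborel)"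
    using assms unfolding has_weak_derivative_def by blast+
  then show "(\<integral>x. g x * \<phi> x \<partial>lborel) = (\<integral>x. g' x * \<phi> x \<partial>lborel)" by simp
qed (use assms in \<open>auto simp: has_weak_derivative_def\<close>)

lemma has_weak_derivative_cong_AE:
  assumes w: "has_weak_derivative i u g" and v: "locally_integrable v" and eq: "AE x in lborel. u x = v x"
  shows "has_weak_derivative i v g"
  unfolding has_weak_derivative_def
proof (intro conjI allI impI v)
  show "locally_integrable g" using w by (simp add: has_weak_derivative_def)
  fix \<phi> :: "real ^ 'a \<Rightarrow> complex" assume \<phi>: "test_function \<phi>"
  have [measurable]: "u \<in> borel_measurable borel" "v \<in> borel_measurable borel"
    using w v by (auto simp: has_weak_derivative_def locally_integrable_def)
  note [measurable] = test_function_square_integrable(2)[OF \<phi>, of i, THEN square_integrable_measurable]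
  have "(\<integral>x. v x * partial_derivative i \<phi> x \<partial>lborel) = (\<integral>x. u x * partial_derivative i \<phi> x \<partial>lborel)"
    using eq by (intro integral_cong_AE) auto
  also have "\<dots> = - (\<integral>x. g x * \<phi> x \<partial>lborel)"
    using w \<phi> unfolding has_weak_derivative_def by blast
  finally show "(\<integral>x. v x * partial_derivative i \<phi> x \<partial>lborel) = - (\<integral>x. g x * \<phi> x \<partial>lborel)" .
qed

lemma weak_derivative_props:
  assumes "has_weak_derivative i u g" "square_integrable g"
  shows "has_weak_derivative i u (weak_derivative i u)" "AE x in lborel. weak_derivative i u x = g x"
    "square_integrable (weak_derivative i u)"
proof -
  show w: "has_weak_derivative i u (weak_derivative i u)"
    unfolding weak_derivative_def using assms(1) by (metis someI)
  show eq: "AE x in lborel. weak_derivative i u x = g x"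
    by (rule has_weak_derivative_unique[OF w assms(1)])
  have "weak_derivative i u \<in> borel_measurable borel"
    using w by (auto simp: has_weak_derivative_def locally_integrable_def)
  moreover have "AE x in lborel. g x = weak_derivative i u x"
    using eq by eventually_elim simp
  ultimately show "square_integrable (weak_derivative i u)"
    using square_integrable_cong_AE[OF assms(2)] by blast
qed

text \<open>The second derivative is taken of the chosen representative of the first, so its witness
  has to be carried across an almost everywhere equality.\<close>

lemma weak_derivative2_props:
  assumes "has_pure_derivatives2 u w k"
  shows "AE x in lborel. weak_derivative i u x = w i x"
    "AE x in lborel. weak_derivative i (weak_derivative i u) x = k i x"
    "has_pure_derivatives2 u (\<lambda>i. weak_derivative i u) (\<lambda>i. weak_derivative i (weak_derivative i u))"
proof -
  have P: "has_weak_derivative i u (weak_derivative i u) \<and> (AE x in lborel. weak_derivative i u x = w i x) \<and>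
    square_integrable (weak_derivative i u) \<and>
    has_weak_derivative i (weak_derivative i u) (weak_derivative i (weak_derivative i u)) \<and>
    (AE x in lborel. weak_derivative i (weak_derivative i u) x = k i x) \<and>
    square_integrable (weak_derivative i (weak_derivative i u))" for i
  proof -
    from assms have a: "has_weak_derivative i u (w i)" "square_integrable (w i)"
        "has_weak_derivative i (w i) (k i)" "square_integrable (k i)"
      by (auto simp: has_pure_derivatives2_def)
    note 1 = weak_derivative_props[OF a(1,2)]
    have "AE x in lborel. w i x = weak_derivative i u x" using 1(2) by eventually_elim simp
    from has_weak_derivative_cong_AE[OF a(3) square_integrable_imp_locally_integrable[OF 1(3)] this]
    have "has_weak_derivative i (weak_derivative i u) (k i)" .
    from 1 weak_derivative_props[OF this a(4)] show ?thesis by blast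
  qed
  show "AE x in lborel. weak_derivative i u x = w i x"
    "AE x in lborel. weak_derivative i (weak_derivative i u) x = k i x"
    "has_pure_derivatives2 u (\<lambda>i. weak_derivative i u) (\<lambda>i. weak_derivative i (weak_derivative i u))"
    using P assms by (auto simp: has_pure_derivatives2_def)
qed

lemma sobolev_H2_pure_derivatives:
  assumes "u \<in> sobolev_H 2"
  shows "has_pure_derivatives2 u (\<lambda>i. weak_derivative i u) (\<lambda>i. weak_derivative i (weak_derivative i u))"
proof -
  have "square_integrable u" "\<forall>i. \<exists>g. has_weak_derivative i u g \<and> g \<in> sobolev_H (Suc 0)"
    using assms by (simp_all add: numeral_2_eq_2)
  moreover then obtain w where w: "\<And>i. has_weak_derivative i u (w i)" "\<And>i. w i \<in> sobolev_H (Suc 0)"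
    by metis
  moreover from w(2) have "\<exists>k. square_integrable (w i) \<and> square_integrable k \<and> has_weak_derivative i (w i) k" for i
    by auto
  then obtain k where "\<And>i. square_integrable (w i) \<and> square_integrable (k i) \<and> has_weak_derivative i (w i) (k i)"
    by metis
  ultimately have "has_pure_derivatives2 u w k" by (simp add: has_pure_derivatives2_def)
  then show ?thesis by (rule weak_derivative2_props)
qed

text \<open>Integration by parts completes the square in \<open>T\<^sub>c\<close>.\<close>
lemma T_functional_eq:
  fixes u :: "real ^ 'n::finite \<Rightarrow> complex"
  assumes u2: "u \<in> sobolev_H 2"
  shows "T_functional c u = (\<integral>x. (cmod (weak_laplacian u x + u x))\<^sup>2 \<partial>lborel) + c * (\<integral>x. (cmod (u x))\<^sup>2 \<partial>lborel)"
    and "square_integrable u" and "square_integrable (weak_laplacian u)"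
proof -
  let ?w = "\<lambda>i. weak_derivative i u" and ?k = "\<lambda>i. weak_derivative i (weak_derivative i u)"
  let ?L = "weak_laplacian u"
  note H = sobolev_H2_pure_derivatives[OF u2]
  then show u: "square_integrable u"
    by (simp add: has_pure_derivatives2_def)
  have w: "square_integrable (?w i)" "square_integrable (?k i)"
      "has_weak_derivative i u (?w i)" "has_weak_derivative i (?w i) (?k i)" for i
    using H by (auto simp: has_pure_derivatives2_def)
  show L: "square_integrable ?L"
    unfolding weak_laplacian_def[abs_def] by (intro square_integrable_sum w)
  note int = integrable_mult_square_integrable square_integrable_cnj u L w
  have g1: "(\<integral>x. (cmod (?w i x))\<^sup>2 \<partial>lborel) = - Re (\<integral>x. ?k i x * cnj (u x) \<partial>lborel)" for i
  proof -
    have "complex_of_real (\<integral>x. (cmod (?w i x))\<^sup>2 \<partial>lborel) = (\<integral>x. ?w i x * cnj (?w i x) \<partial>lborel)"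
      by (simp only: complex_norm_square integral_complex_of_real[symmetric])
    also have "\<dots> = - (\<integral>x. ?k i x * cnj (u x) \<partial>lborel)"
      by (rule integral_norm_first_derivative[OF w(3,4) u w(1,2)])
    finally show ?thesis by (metis Re_complex_of_real uminus_complex.sel(1))
  qed
  have "(\<integral>x. (norm (weak_gradient u x))\<^sup>2 \<partial>lborel) = (\<integral>x. (\<Sum>i\<in>UNIV. (cmod (?w i x))\<^sup>2) \<partial>lborel)"
    by (simp add: weak_gradient_def norm_vec_def L2_set_def sum_nonneg)
  also have "\<dots> = (\<Sum>i\<in>UNIV. \<integral>x. (cmod (?w i x))\<^sup>2 \<partial>lborel)"
    using w(1) by (intro Bochner_Integration.integral_sum) (auto simp: square_integrable_def)
  also have "\<dots> = - Re (\<Sum>i\<in>UNIV. \<integral>x. ?k i x * cnj (u x) \<partial>lborel)"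
    by (simp add: g1 sum_negf)
  finally have g0: "(\<integral>x. (norm (weak_gradient u x))\<^sup>2 \<partial>lborel) = - Re (\<Sum>i\<in>UNIV. \<integral>x. ?k i x * cnj (u x) \<partial>lborel)" .
  have g2: "(\<Sum>i\<in>UNIV. \<integral>x. ?k i x * cnj (u x) \<partial>lborel) = (\<integral>x. ?L x * cnj (u x) \<partial>lborel)"
    unfolding weak_laplacian_def sum_distrib_right
    by (intro Bochner_Integration.integral_sum[symmetric] int)
  have g: "(\<integral>x. (norm (weak_gradient u x))\<^sup>2 \<partial>lborel) = - Re (\<integral>x. ?L x * cnj (u x) \<partial>lborel)"
    unfolding g0 g2 ..
  have pt: "(cmod (a + b))\<^sup>2 = (cmod a)\<^sup>2 + (cmod b)\<^sup>2 + 2 * Re (a * cnj b)" for a b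
    by (simp add: cmod_power2) (simp add: power2_eq_square algebra_simps)
  \<comment> \<open>By \<open>g\<close>, the cross term of this square integrates to -2 times the
    integral of the squared gradient.\<close>
  have "(\<integral>x. (cmod (?L x + u x))\<^sup>2 \<partial>lborel)
      = (\<integral>x. (cmod (?L x))\<^sup>2 + (cmod (u x))\<^sup>2 + 2 * Re (?L x * cnj (u x)) \<partial>lborel)"
    by (simp only: pt)
  also have "\<dots> = (\<integral>x. (cmod (?L x))\<^sup>2 \<partial>lborel) + (\<integral>x. (cmod (u x))\<^sup>2 \<partial>lborel) + (\<integral>x. 2 * Re (?L x * cnj (u x)) \<partial>lborel)"
  proof -
    have "integrable lborel (\<lambda>x. (cmod (?L x))\<^sup>2)" "integrable lborel (\<lambda>x. (cmod (u x))\<^sup>2)"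
      using L u by (auto simp: square_integrable_def)
    moreover have "integrable lborel (\<lambda>x. 2 * Re (?L x * cnj (u x)))"
      by (intro integrable_mult_right integrable_Re int)
    ultimately show ?thesis by simp
  qed
  also have "(\<integral>x. 2 * Re (?L x * cnj (u x)) \<partial>lborel) = 2 * Re (\<integral>x. ?L x * cnj (u x) \<partial>lborel)"
    by (subst integral_mult_right_zero, subst integral_Re) (auto intro!: int simp del: times_complex.sel)
  finally show "T_functional c u = (\<integral>x. (cmod (?L x + u x))\<^sup>2 \<partial>lborel) + c * (\<integral>x. (cmod (u x))\<^sup>2 \<partial>lborel)"
    unfolding T_functional_def g by (simp add: algebra_simps)
qed

subsection \<open>Averages over boxes and a Sobolev bound\<close>

definition unit_box :: "(real ^ 'n::finite) set" where
  "unit_box = cbox (\<chi> i. -1) (\<chi> i. 1)"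

lemma mem_unit_box: "y \<in> unit_box \<longleftrightarrow> (\<forall>i. \<bar>y $ i\<bar> \<le> 1)"
  by (auto simp: unit_box_def mem_box_cart abs_le_iff minus_le_iff)

lemma unit_box_measurable [measurable, simp]: "unit_box \<in> sets borel"
  by (simp add: unit_box_def)

lemma emeasure_unit_box:
  "emeasure lborel (unit_box :: (real ^ 'n::finite) set) = ennreal (2 ^ CARD('n))"
proof -
  have b: "((\<chi> i. 1) - (\<chi> i. -1)) \<bullet> b = (2 :: real)" "(\<chi> i. -1) \<bullet> b \<le> (\<chi> i. 1) \<bullet> b" if "b \<in> Basis" for b :: "real ^ 'n"
    using that by (auto simp: Basis_vec_def inner_axis)
  have "emeasure lborel (unit_box :: (real ^ 'n) set) = ennreal (\<Prod>b\<in>(Basis :: (real^'n) set). ((\<chi> i. 1) - (\<chi> i. -1)) \<bullet> b)"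
    unfolding unit_box_def by (rule emeasure_lborel_cbox) (rule b)
  also have "(\<Prod>b\<in>(Basis :: (real^'n) set). ((\<chi> i. 1) - (\<chi> i. -1)) \<bullet> b) = (\<Prod>b\<in>(Basis :: (real^'n) set). 2)"
    by (intro prod.cong refl b)
  finally show ?thesis by simp
qed

definition unif_box :: "(real ^ 'n::finite) measure" where
  "unif_box = uniform_measure lborel unit_box"

lemma sets_unif_box [simp, measurable_cong]: "sets unif_box = sets borel"
  by (simp add: unif_box_def)

lemma space_unif_box [simp]: "space unif_box = UNIV"
  by (simp add: unif_box_def)

interpretation unif_box: prob_space "unif_box :: (real ^ 'n::finite) measure"
  unfolding unif_box_def by (rule prob_space_uniform_measure) (auto simp: emeasure_unit_box)

lemma emeasure_unif_box_UNIV [simp]: "emeasure unif_box UNIV = 1"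
  using unif_box.emeasure_space_1 by simp

lemma measure_unif_box_UNIV [simp]: "measure unif_box UNIV = 1"
  using unif_box.prob_space by simp

definition coord_restrict :: "'n::finite set \<Rightarrow> real ^ 'n \<Rightarrow> real ^ 'n" where
  "coord_restrict S y = (\<chi> i. if i \<in> S then y $ i else 0)"

text \<open>Averaging only in the coordinates of S interpolates between u, for S empty, and the full
  cube average. One measure serves every S because the other coordinates are set to 0.\<close>

definition box_average :: "'n::finite set \<Rightarrow> real \<Rightarrow> (real ^ 'n \<Rightarrow> complex) \<Rightarrow> real ^ 'n \<Rightarrow> complex" where
  "box_average S h f x = (\<integral>y. f (x + h *\<^sub>R coord_restrict S y) \<partial>unif_box)"

lemma coord_restrict_measurable [measurable]: "coord_restrict S \<in> borel_measurable borel"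
  unfolding coord_restrict_def[abs_def]
proof (intro borel_measurable_continuous_onI continuous_on_vec_lambda)
  fix i show "continuous_on UNIV (\<lambda>y :: real ^ 'a. if i \<in> S then y $ i else 0)"
    by (cases "i \<in> S") (auto intro!: linear_continuous_on bounded_linear_vec_nth)
qed

lemma coord_restrict_insert:
  "j \<notin> S \<Longrightarrow> coord_restrict (insert j S) y = coord_restrict S y + (y $ j) *\<^sub>R axis j 1"
  by (auto simp: coord_restrict_def vec_eq_iff axis_def)

lemma coord_restrict_UNIV [simp]: "coord_restrict UNIV y = y"
  by (simp add: coord_restrict_def)

lemma coord_restrict_empty [simp]: "coord_restrict {} y = 0"
  by (simp add: coord_restrict_def vec_eq_iff)

lemma box_translate_measurable [measurable]:
  assumes [measurable]: "f \<in> borel_measurable borel"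
  shows "(\<lambda>(y, x). f (x + h *\<^sub>R coord_restrict S y)) \<in> borel_measurable (unif_box \<Otimes>\<^sub>M lborel)"
  by measurable

lemma box_average_measurable [measurable]:
  assumes [measurable]: "f \<in> borel_measurable borel"
  shows "box_average S h f \<in> borel_measurable borel"
  unfolding box_average_def by measurable

lemma square_integrable_box_average:
  assumes f: "square_integrable f"
  shows "square_integrable (box_average S h f)"
proof -
  note [measurable] = f[THEN square_integrable_measurable]
  have "sq_norm (box_average S h f) \<le> (\<integral>\<^sup>+y. sq_norm (\<lambda>x. f (x + h *\<^sub>R coord_restrict S y)) \<partial>unif_box)"
    unfolding box_average_def[abs_def] by (rule sq_norm_average_le[OF unif_box.prob_space_axioms]) measurable
  also have "\<dots> = sq_norm f"
    by (simp add: sq_norm_translate)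
  also have "\<dots> < \<infinity>" by (rule sq_norm_finite[OF f])
  finally show ?thesis by (subst square_integrable_iff) auto
qed

definition flip :: "'n::finite \<Rightarrow> real ^ 'n \<Rightarrow> real ^ 'n" where
  "flip j y = (\<chi> i. if i = j then - y $ i else y $ i)"

lemma flip_measurable [measurable]: "flip j \<in> borel_measurable borel"
  unfolding flip_def[abs_def]
proof (intro borel_measurable_continuous_onI continuous_on_vec_lambda)
  fix i show "continuous_on UNIV (\<lambda>y :: real ^ 'a. if i = j then - y $ i else y $ i)"
    by (cases "i = j") (auto intro!: linear_continuous_on bounded_linear_minus bounded_linear_vec_nth)
qed

text \<open>A reflection is diagonal with entries 1 and -1, so its determinant has modulus
  1.\<close>

lemma lborel_distr_flip: "distr lborel borel (flip j) = lborel"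
proof -
  define c where "c b = (if b = axis j 1 then -1 else 1 :: real)" for b :: "real ^ 'a"
  have T: "0 + (\<Sum>b\<in>Basis. (c b * (x \<bullet> b)) *\<^sub>R b) = flip j x" for x
  proof -
    have "(\<Sum>b\<in>Basis. (c b * (x \<bullet> b)) *\<^sub>R b) \<bullet> b = flip j x \<bullet> b" if "b \<in> Basis" for b
    proof -
      from that obtain i where b: "b = axis i 1" by (auto simp: Basis_vec_def)
      have "(\<Sum>b\<in>Basis. (c b * (x \<bullet> b)) *\<^sub>R b) \<bullet> b = c b * (x \<bullet> b)"
        by (rule inner_sum_left_Basis[OF that])
      then show ?thesis
        by (auto simp: b c_def flip_def inner_axis axis_eq_axis)
    qed
    then show ?thesis by (simp add: euclidean_eq_iff[where 'a="real ^ 'a"])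
  qed
  have "lborel = density (distr lborel borel (\<lambda>x. 0 + (\<Sum>b\<in>Basis. (c b * (x \<bullet> b)) *\<^sub>R b)))
      (\<lambda>_. (\<Prod>b\<in>(Basis :: (real^'a) set). \<bar>c b\<bar>))"
    by (rule lborel_affine_euclidean) (simp add: c_def)
  also have "(\<Prod>b\<in>(Basis :: (real^'a) set). \<bar>c b\<bar>) = 1"
    by (rule prod.neutral) (simp add: c_def)
  finally show ?thesis by (simp only: T) (simp add: density_1)
qed

lemma flip_unit_box: "flip j -` unit_box = unit_box"
proof -
  have "flip j y \<in> unit_box \<longleftrightarrow> y \<in> unit_box" for y :: "real ^ 'a"
  proof -
    have "\<bar>flip j y $ i\<bar> = \<bar>y $ i\<bar>" for i by (simp add: flip_def)
    then show ?thesis by (simp add: mem_unit_box)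
  qed
  then show ?thesis by auto
qed

lemma distr_unif_box_flip: "distr unif_box unif_box (flip j) = unif_box"
proof (rule measure_eqI)
  fix A assume "A \<in> sets (distr unif_box unif_box (flip j))"
  then have [measurable]: "A \<in> sets borel" by simp
  let ?B = "unit_box :: (real ^ 'a) set"
  have "?B \<inter> flip j -` A = flip j -` (?B \<inter> A)"
    using flip_unit_box[of j] by auto
  then have "emeasure lborel (?B \<inter> flip j -` A) = emeasure (distr lborel borel (flip j)) (?B \<inter> A)"
    by (simp add: emeasure_distr)
  then show "emeasure (distr unif_box unif_box (flip j)) A = emeasure unif_box A"
    using measurable_sets_borel[of "flip j" borel A]
    by (simp add: emeasure_distr lborel_distr_flip unif_box_def)
qed simp

lemma integral_unif_box_flip:
  fixes f :: "real ^ 'n::finite \<Rightarrow> complex"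
  assumes [measurable]: "f \<in> borel_measurable borel"
  shows "(\<integral>y. f (flip j y) \<partial>unif_box) = (\<integral>y. f y \<partial>unif_box)"
proof -
  have "(\<integral>y. f y \<partial>unif_box) = (\<integral>y. f y \<partial>distr unif_box unif_box (flip j))"
    by (simp only: distr_unif_box_flip)
  also have "\<dots> = (\<integral>y. f (flip j y) \<partial>unif_box)"
    by (rule integral_distr) measurable
  finally show ?thesis ..
qed

lemma AE_unif_box: "AE y in unif_box. \<bar>y $ i\<bar> \<le> 1"
  unfolding unif_box_def by (rule AE_uniform_measureI) (auto simp: mem_unit_box)

text \<open>The symmetric second difference is t^2 times
  \<open>diff_quot (- t) i (diff_quot t i u)\<close>, and squaring gives t^4. The quotient
  degenerates at t = 0, hence the case split.\<close>

lemma sq_norm_second_difference_le: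
  assumes w: "has_weak_derivative i u g" "has_weak_derivative i g k"
    and si: "square_integrable u" "square_integrable g" "square_integrable k"
  shows "sq_norm (\<lambda>x. u (x + t *\<^sub>R axis i 1) + u (x - t *\<^sub>R axis i 1) - 2 * u x) \<le> ennreal (t ^ 4) * sq_norm k"
proof (cases "t = 0")
  case True
  then show ?thesis by (simp add: sq_norm_def)
next
  case False
  note [measurable] = square_integrable_diff_quot[OF square_integrable_diff_quot[OF si(1)], THEN square_integrable_measurable]
  have "sq_norm (\<lambda>x. u (x + t *\<^sub>R axis i 1) + u (x - t *\<^sub>R axis i 1) - 2 * u x)
      = sq_norm (\<lambda>x. of_real (t\<^sup>2) * diff_quot (- t) i (diff_quot t i u) x)"
  proof (rule arg_cong[where f=sq_norm], rule ext)
    fix x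
    show "u (x + t *\<^sub>R axis i 1) + u (x - t *\<^sub>R axis i 1) - 2 * u x = of_real (t\<^sup>2) * diff_quot (- t) i (diff_quot t i u) x"
      using False by (simp add: diff_quot_def field_simps power2_eq_square)
  qed
  also have "\<dots> = ennreal (t ^ 4) * sq_norm (diff_quot (- t) i (diff_quot t i u))"
    by (subst sq_norm_cmult) (auto simp: norm_power norm_mult power_mult_distrib simp flip: power_mult)
  also have "\<dots> \<le> ennreal (t ^ 4) * sq_norm k"
    using False by (intro mult_left_mono sq_norm_diff_quot2_le[OF w si]) auto
  finally show ?thesis .
qed

text \<open>The symmetry of the box in the coordinate \<open>j\<close> turns the first difference into a second one.\<close>
lemma sq_norm_box_average_insert_le:
  fixes u :: "real ^ 'n::finite \<Rightarrow> complex"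
  assumes w: "has_weak_derivative j u g" "has_weak_derivative j g k"
    and si: "square_integrable u" "square_integrable g" "square_integrable k" and j: "j \<notin> S"
  shows "sq_norm (\<lambda>x. box_average (insert j S) h u x - box_average S h u x) \<le> ennreal (h ^ 4) * sq_norm k"
proof -
  note [measurable] = si[THEN square_integrable_measurable]
  let ?e = "axis j 1 :: real ^ 'n"
  let ?z = "\<lambda>x y. x + h *\<^sub>R coord_restrict S y"
  let ?F = "\<lambda>y x. u (?z x y + (h * y $ j) *\<^sub>R ?e)" and ?G = "\<lambda>y x. u (?z x y - (h * y $ j) *\<^sub>R ?e)" and ?H = "\<lambda>y x. u (?z x y)"
  have fin: "AE x in lborel. integrable unif_box (\<lambda>y. u (x + c y))"
    if [measurable]: "c \<in> borel_measurable borel" for c :: "real ^ 'n \<Rightarrow> real ^ 'n"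
  proof (rule AE_integrable_average[OF unif_box.prob_space_axioms])
    show "(\<integral>\<^sup>+y. sq_norm (\<lambda>x. u (x + c y)) \<partial>unif_box) < \<infinity>"
      using sq_norm_finite[OF si(1)] by (simp add: sq_norm_translate)
  qed measurable
  have [measurable]: "(\<lambda>y. y $ j) \<in> borel_measurable (borel :: (real ^ 'n) measure)"
    by (intro borel_measurable_continuous_onI continuous_intros)
  have iF: "AE x in lborel. integrable unif_box (\<lambda>y. ?F y x)"
    using fin[of "\<lambda>y. h *\<^sub>R coord_restrict S y + (h * y $ j) *\<^sub>R ?e"] by (simp add: add.assoc)
  have iG: "AE x in lborel. integrable unif_box (\<lambda>y. ?G y x)"
    using fin[of "\<lambda>y. h *\<^sub>R coord_restrict S y - (h * y $ j) *\<^sub>R ?e"] by (simp add: add_diff_eq)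
  have iH: "AE x in lborel. integrable unif_box (\<lambda>y. ?H y x)"
    by (rule fin) measurable
  have eqF: "box_average (insert j S) h u x = (\<integral>y. ?F y x \<partial>unif_box)" for x
    by (simp add: box_average_def coord_restrict_insert[OF j] scaleR_add_right add.assoc)
  have "coord_restrict S (flip j y) = coord_restrict S y" "flip j y $ j = - y $ j" for y
    using j by (auto simp: coord_restrict_def flip_def vec_eq_iff)
  then have eqG: "box_average (insert j S) h u x = (\<integral>y. ?G y x \<partial>unif_box)" for x
    unfolding eqF using integral_unif_box_flip[of "\<lambda>y. ?F y x" j] by simp
  \<comment> \<open>The mean of the two representations \<open>eqF\<close> and \<open>eqG\<close>
    produces the symmetric second difference around \<open>?z x y\<close>.\<close>
  have "AE x in lborel. box_average (insert j S) h u x - box_average S h u x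
      = (\<integral>y. (1/2) * (?F y x + ?G y x - 2 * ?H y x) \<partial>unif_box)"
    using iF iG iH
  proof eventually_elim
    case (elim x)
    then have "(\<integral>y. (1/2) * (?F y x + ?G y x - 2 * ?H y x) \<partial>unif_box)
        = (1/2) * ((\<integral>y. ?F y x \<partial>unif_box) + (\<integral>y. ?G y x \<partial>unif_box) - 2 * (\<integral>y. ?H y x \<partial>unif_box))"
      by simp
    then show ?case unfolding eqF[symmetric] eqG[symmetric]
      by (simp add: box_average_def)
  qed
  then have "sq_norm (\<lambda>x. box_average (insert j S) h u x - box_average S h u x)
      = sq_norm (\<lambda>x. \<integral>y. (1/2) * (?F y x + ?G y x - 2 * ?H y x) \<partial>unif_box)"
    by (rule sq_norm_cong_AE)
  also have "\<dots> \<le> (\<integral>\<^sup>+y. sq_norm (\<lambda>x. (1/2) * (?F y x + ?G y x - 2 * ?H y x)) \<partial>unif_box)"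
    by (rule sq_norm_average_le[OF unif_box.prob_space_axioms]) measurable
  also have "\<dots> \<le> (\<integral>\<^sup>+y. ennreal (h ^ 4) * sq_norm k \<partial>(unif_box :: (real ^ 'n) measure))"
  proof (rule nn_integral_mono_AE)
    show "AE y in unif_box. sq_norm (\<lambda>x. (1/2) * (?F y x + ?G y x - 2 * ?H y x)) \<le> ennreal (h ^ 4) * sq_norm k"
      using AE_unif_box[of j]
    proof eventually_elim
      case (elim y)
      let ?t = "h * y $ j"
      let ?s = "\<lambda>x. u (x + ?t *\<^sub>R ?e) + u (x - ?t *\<^sub>R ?e) - 2 * u x"
      have "sq_norm (\<lambda>x. (1/2) * (?F y x + ?G y x - 2 * ?H y x)) = ennreal (1/4) * sq_norm (\<lambda>x. ?s (x + h *\<^sub>R coord_restrict S y))"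
        by (subst sq_norm_cmult) (auto simp: power2_eq_square)
      also have "sq_norm (\<lambda>x. ?s (x + h *\<^sub>R coord_restrict S y)) = sq_norm ?s"
        by (rule sq_norm_translate) measurable
      also have "ennreal (1/4) * sq_norm ?s \<le> 1 * sq_norm ?s"
        by (intro mult_right_mono) (auto simp: ennreal_le_1)
      also have "\<dots> \<le> ennreal (?t ^ 4) * sq_norm k"
        using sq_norm_second_difference_le[OF w si] by simp
      also have "\<dots> \<le> ennreal (h ^ 4) * sq_norm k"
      proof (intro mult_right_mono ennreal_leI)
        have "\<bar>y $ j\<bar> ^ 4 \<le> 1" using elim by (intro power_le_one) auto
        then have "(y $ j) ^ 4 \<le> 1" by simp
        then show "?t ^ 4 \<le> h ^ 4" by (simp add: power_mult_distrib mult_left_le)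
      qed auto
      finally show ?case .
    qed
  qed
  also have "\<dots> = ennreal (h ^ 4) * sq_norm k"
    by (simp add:)
  finally show ?thesis .
qed

text \<open>The coordinates are added one by one. Each addition doubles the bound so far through
  \<open>sq_norm_add_le\<close>; a factor 4 per coordinate generously covers this and the new
  term.\<close>

lemma sq_norm_box_average_diff_le:
  fixes u :: "real ^ 'n::finite \<Rightarrow> complex"
  assumes H: "has_pure_derivatives2 u w k"
  shows "sq_norm (\<lambda>x. box_average S h u x - u x) \<le> ennreal (4 ^ card S) * (ennreal (h ^ 4) * (\<Sum>i\<in>S. sq_norm (k i)))"
proof -
  have "finite S" by simp
  then show ?thesis
  proof (induction S)
    case empty
    have "box_average {} h u x = u x" for x
      by (simp add: box_average_def)
    then show ?case by (simp add: sq_norm_def)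
  next
    case (insert j S)
    have u: "square_integrable u" and si: "square_integrable (w j)" "square_integrable (k j)"
      and wd: "has_weak_derivative j u (w j)" "has_weak_derivative j (w j) (k j)"
      using H by (auto simp: has_pure_derivatives2_def)
    note [measurable] = u[THEN square_integrable_measurable]
    let ?s = "\<Sum>i\<in>S. sq_norm (k i)"
    have "sq_norm (\<lambda>x. box_average (insert j S) h u x - u x)
        = sq_norm (\<lambda>x. (box_average (insert j S) h u x - box_average S h u x) + (box_average S h u x - u x))"
      by (rule arg_cong[where f=sq_norm]) auto
    also have "\<dots> \<le> 2 * sq_norm (\<lambda>x. box_average (insert j S) h u x - box_average S h u x) + 2 * sq_norm (\<lambda>x. box_average S h u x - u x)"
      by (rule sq_norm_add_le) measurable
    also have "\<dots> \<le> 2 * (ennreal (h ^ 4) * sq_norm (k j)) + 2 * (ennreal (4 ^ card S) * (ennreal (h ^ 4) * ?s))"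
      by (intro add_mono mult_left_mono sq_norm_box_average_insert_le[OF wd u si insert(2)] insert.IH) auto
    also have "\<dots> \<le> ennreal (4 ^ card (insert j S)) * (ennreal (h ^ 4) * sq_norm (k j)) + ennreal (4 ^ card (insert j S)) * (ennreal (h ^ 4) * ?s)"
    proof (rule add_mono)
      have "(2::ennreal) \<le> ennreal (4 ^ card (insert j S))"
      proof -
        have "(4::real) ^ card (insert j S) = 4 * 4 ^ card S" "(1::real) \<le> 4 ^ card S"
          using insert(1,2) by simp_all
        then have "(2::real) \<le> 4 ^ card (insert j S)" by linarith
        then show ?thesis by (metis ennreal_leI ennreal_numeral zero_le_numeral)
      qed
      then show "2 * (ennreal (h ^ 4) * sq_norm (k j)) \<le> ennreal (4 ^ card (insert j S)) * (ennreal (h ^ 4) * sq_norm (k j))"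
        by (rule mult_right_mono) simp
      have "2 * ennreal (4 ^ card S) \<le> ennreal (4 ^ card (insert j S))"
      proof -
        have "2 * ennreal (4 ^ card S) = ennreal (2 * 4 ^ card S)"
          by (simp add: ennreal_mult')
        also have "\<dots> \<le> ennreal (4 ^ card (insert j S))"
          using insert(1,2) by (intro ennreal_leI) simp
        finally show ?thesis .
      qed
      then have "(2 * ennreal (4 ^ card S)) * (ennreal (h ^ 4) * ?s) \<le> ennreal (4 ^ card (insert j S)) * (ennreal (h ^ 4) * ?s)"
        by (rule mult_right_mono) simp
      then show "2 * (ennreal (4 ^ card S) * (ennreal (h ^ 4) * ?s)) \<le> ennreal (4 ^ card (insert j S)) * (ennreal (h ^ 4) * ?s)"
        by (simp only: mult.assoc)
    qed
    also have "\<dots> = ennreal (4 ^ card (insert j S)) * (ennreal (h ^ 4) * (\<Sum>i\<in>insert j S. sq_norm (k i)))"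
      using insert(1,2) by (simp add: distrib_left)
    finally show ?case .
  qed
qed

section \<open>Dyadic averages and level sets\<close>

abbreviation full_box_average :: "real \<Rightarrow> (real ^ 'n::finite \<Rightarrow> complex) \<Rightarrow> real ^ 'n \<Rightarrow> complex" where
  "full_box_average \<equiv> box_average UNIV"

text \<open>Substituting z = x + h y gives the mean over a cube of volume (2 h)^N, and the integral
  is then enlarged to the whole space.\<close>

lemma nn_integral_unif_box_le:
  fixes f :: "real ^ 'n::finite \<Rightarrow> complex"
  assumes [measurable]: "f \<in> borel_measurable borel" and h: "h > 0"
  shows "(\<integral>\<^sup>+y. ennreal ((cmod (f (x + h *\<^sub>R y)))\<^sup>2) \<partial>unif_box) \<le> ennreal (inverse ((2 * h) ^ CARD('n))) * sq_norm f"
proof -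
  let ?g = "\<lambda>x. ennreal ((cmod (f x))\<^sup>2)" and ?N = "CARD('n)"
  have "(\<integral>\<^sup>+y. ?g (x + h *\<^sub>R y) \<partial>unif_box)
      = (\<integral>\<^sup>+y. ?g (x + h *\<^sub>R y) * indicator (unit_box) y \<partial>lborel) / ennreal (2 ^ ?N)"
    unfolding unif_box_def by (subst nn_integral_uniform_measure) (auto simp: emeasure_unit_box)
  also have "\<dots> \<le> (\<integral>\<^sup>+y. ?g (x + h *\<^sub>R y) \<partial>lborel) / ennreal (2 ^ ?N)"
    by (intro divide_right_mono_ennreal nn_integral_mono) (auto simp: indicator_def)
  also have "\<dots> = ennreal (inverse (2 ^ ?N)) * (\<integral>\<^sup>+y. ?g (x + h *\<^sub>R y) \<partial>lborel)"
    by (simp add: divide_ennreal_def inverse_ennreal mult.commute)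
  also have "(\<integral>\<^sup>+y. ?g (x + h *\<^sub>R y) \<partial>lborel) = ennreal (inverse (h ^ ?N)) * sq_norm f"
  proof -
    have "sq_norm f = (\<integral>\<^sup>+z. ?g z \<partial>density (distr lborel borel (\<lambda>y. x + h *\<^sub>R y)) (\<lambda>_. ennreal (\<bar>h\<bar> ^ DIM(real ^ 'n))))"
      unfolding sq_norm_def using lborel_affine[of h x] h by simp
    also have "\<dots> = ennreal (h ^ ?N) * (\<integral>\<^sup>+y. ?g (x + h *\<^sub>R y) \<partial>lborel)"
      using h by (simp add: nn_integral_density nn_integral_distr nn_integral_cmult)
    finally have "ennreal (inverse (h ^ ?N)) * sq_norm f = (ennreal (inverse (h ^ ?N)) * ennreal (h ^ ?N)) * (\<integral>\<^sup>+y. ?g (x + h *\<^sub>R y) \<partial>lborel)"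
      by (simp add: mult.assoc)
    also have "ennreal (inverse (h ^ ?N)) * ennreal (h ^ ?N) = 1"
      using h by (subst ennreal_mult[symmetric]) auto
    finally show ?thesis by simp
  qed
  also have "ennreal (inverse (2 ^ ?N)) * (ennreal (inverse (h ^ ?N)) * sq_norm f) = ennreal (inverse ((2 * h) ^ ?N)) * sq_norm f"
    using h by (simp add: mult.assoc[symmetric] ennreal_mult[symmetric] power_mult_distrib)
  finally show ?thesis .
qed

lemma full_box_average_sq_le:
  fixes f :: "real ^ 'n::finite \<Rightarrow> complex"
  assumes [measurable]: "f \<in> borel_measurable borel" and h: "h > 0"
  shows "ennreal ((cmod (full_box_average h f x))\<^sup>2) \<le> ennreal (inverse ((2 * h) ^ CARD('n))) * sq_norm f"
proof -
  have "ennreal ((cmod (full_box_average h f x))\<^sup>2) \<le> (\<integral>\<^sup>+y. ennreal ((cmod (f (x + h *\<^sub>R y)))\<^sup>2) \<partial>unif_box)"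
    unfolding box_average_def coord_restrict_UNIV by (rule unif_box.cmod_integral_sq_le) measurable
  also note nn_integral_unif_box_le[OF assms]
  finally show ?thesis .
qed

lemma integrable_unif_box:
  fixes f :: "real ^ 'n::finite \<Rightarrow> complex"
  assumes f: "square_integrable f" and h: "h > 0"
  shows "integrable unif_box (\<lambda>y. f (x + h *\<^sub>R y))"
proof -
  note [measurable] = f[THEN square_integrable_measurable]
  have "(\<integral>\<^sup>+y. ennreal ((cmod (f (x + h *\<^sub>R y)))\<^sup>2) \<partial>unif_box) < \<infinity>"
    using order.strict_trans1[OF nn_integral_unif_box_le[OF square_integrable_measurable[OF f] h]]
      sq_norm_finite[OF f] by (simp add: ennreal_mult_less_top)
  then have "integrable unif_box (\<lambda>y. (cmod (f (x + h *\<^sub>R y)))\<^sup>2)"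
    by (simp add: integrable_iff_bounded)
  then show ?thesis
    by (rule unif_box.integrable_if_cmod_sq[rotated]) measurable
qed

text \<open>In the dyadic induction this is applied to the average of an average, which thereby
  inherits the bound of the coarser scale.\<close>

lemma full_box_average_bounded:
  assumes [measurable]: "f \<in> borel_measurable borel" and b: "\<And>x. cmod (f x) \<le> M"
  shows "cmod (full_box_average h f x) \<le> M"
proof -
  have "integrable unif_box (\<lambda>y. f (x + h *\<^sub>R y))"
    by (rule unif_box.integrable_const_bound[of _ M]) (auto simp: b)
  then have "cmod (full_box_average h f x) \<le> (\<integral>y. cmod (f (x + h *\<^sub>R y)) \<partial>unif_box)"
    unfolding box_average_def coord_restrict_UNIV by (intro integral_norm_bound)
  also have "\<dots> \<le> (\<integral>y. M \<partial>(unif_box :: (real ^ 'a) measure))"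
    using \<open>integrable unif_box (\<lambda>y. f (x + h *\<^sub>R y))\<close> b by (intro integral_mono) auto
  also have "\<dots> = M" by (simp add:)
  finally show ?thesis .
qed

lemma sq_norm_dyadic_average_le:
  fixes u :: "real ^ 'n::finite \<Rightarrow> complex"
  assumes H: "has_pure_derivatives2 u w d" and B: "B \<ge> 0" "sq_norm (\<lambda>x. \<Sum>i\<in>UNIV. d i x) \<le> ennreal B"
  shows "sq_norm (\<lambda>x. u x - full_box_average ((1/2) ^ k) u x) \<le> ennreal (4 ^ CARD('n) * (1/2) ^ (4 * k) * B)"
proof -
  let ?h = "(1/2::real) ^ k"
  have "sq_norm (\<lambda>x. u x - full_box_average ?h u x) = sq_norm (\<lambda>x. - (full_box_average ?h u x - u x))"
    by simp
  also have "\<dots> = sq_norm (\<lambda>x. full_box_average ?h u x - u x)"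
    by (rule sq_norm_minus)
  also have "\<dots> \<le> ennreal (4 ^ CARD('n)) * (ennreal (?h ^ 4) * (\<Sum>i\<in>UNIV. sq_norm (d i)))"
    by (rule sq_norm_box_average_diff_le[OF H])
  also have "\<dots> \<le> ennreal (4 ^ CARD('n)) * (ennreal (?h ^ 4) * ennreal B)"
    by (intro mult_left_mono order_trans[OF sum_pure_second_derivatives_le[OF H] B(2)]) auto
  also have "\<dots> = ennreal (4 ^ CARD('n) * (1/2) ^ (4 * k) * B)"
    using B(1) by (simp add: ennreal_mult[symmetric] power_mult[symmetric] mult.commute mult.assoc)
  finally show ?thesis .
qed

text \<open>Passing from scale \<open>2\<^sup>-\<^sup>k\<close> to \<open>2\<^sup>-\<^sup>k\<^sup>-\<^sup>1\<close>, the supremum of the average grows by at most a multiple of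
  \<open>2\<close> to the power \<open>k (N / 2 - 2)\<close>.\<close>
lemma dyadic_average_bound:
  fixes u :: "real ^ 'n::finite \<Rightarrow> complex"
  assumes H: "has_pure_derivatives2 u w d" and B: "B \<ge> 0"
    and u: "sq_norm u \<le> ennreal B" and L: "sq_norm (\<lambda>x. \<Sum>i\<in>UNIV. d i x) \<le> ennreal B"
    and \<beta>: "\<beta> \<ge> CARD('n) / 2 - 2" "\<beta> > 0"
    and A: "A \<ge> sqrt B" "A * (2 powr \<beta> - 1) \<ge> 2 ^ CARD('n) * sqrt B"
  shows "cmod (full_box_average ((1/2) ^ k) u x) \<le> A * 2 powr (\<beta> * k)"
proof (induction k arbitrary: x)
  case 0
  have su: "square_integrable u" using H by (simp add: has_pure_derivatives2_def)
  have "ennreal ((cmod (full_box_average 1 u x))\<^sup>2) \<le> ennreal (inverse ((2 * 1) ^ CARD('n))) * sq_norm u"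
    by (rule full_box_average_sq_le[OF square_integrable_measurable[OF su]]) simp
  also have "\<dots> \<le> 1 * ennreal B"
    using u by (intro mult_mono) (auto simp: ennreal_le_1 inverse_le_1_iff one_le_power)
  finally have "(cmod (full_box_average 1 u x))\<^sup>2 \<le> B" using B by (simp add: ennreal_le_iff)
  then have "cmod (full_box_average 1 u x) \<le> sqrt B" by (rule real_le_rsqrt)
  then show ?case using A(1) by simp
next
  case (Suc k)
  let ?N = "CARD('n)"
  let ?h = "(1/2::real) ^ k" and ?h' = "(1/2::real) ^ Suc k"
  have su: "square_integrable u" using H by (simp add: has_pure_derivatives2_def)
  have sP: "square_integrable (full_box_average ?h u)" by (rule square_integrable_box_average[OF su])
  let ?v = "\<lambda>x. u x - full_box_average ?h u x"
  have sv: "square_integrable ?v" by (rule square_integrable_diff[OF su sP])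
  have h': "?h' > 0" by simp
  \<comment> \<open>The average of the coarser average keeps the earlier sup bound; the remainder
    involves only u minus its coarse average, which is small in L^2.\<close>
  have split: "full_box_average ?h' u x = full_box_average ?h' ?v x + full_box_average ?h' (full_box_average ?h u) x"
    using integrable_unif_box[OF sv h', of x] integrable_unif_box[OF sP h', of x]
    unfolding box_average_def[of UNIV ?h'] coord_restrict_UNIV
    by (subst Bochner_Integration.integral_add[symmetric]) auto
  have 1: "cmod (full_box_average ?h' (full_box_average ?h u) x) \<le> A * 2 powr (\<beta> * k)"
    by (rule full_box_average_bounded[OF square_integrable_measurable[OF sP] Suc.IH])
  have "ennreal ((cmod (full_box_average ?h' ?v x))\<^sup>2) \<le> ennreal (inverse ((2 * ?h') ^ ?N)) * sq_norm ?v"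
    by (rule full_box_average_sq_le[OF square_integrable_measurable[OF sv] h'])
  also have "\<dots> \<le> ennreal (inverse ((2 * ?h') ^ ?N)) * ennreal (4 ^ ?N * (1/2) ^ (4 * k) * B)"
    by (intro mult_left_mono sq_norm_dyadic_average_le[OF H B L]) auto
  also have "\<dots> = ennreal (inverse ((2 * ?h') ^ ?N) * (4 ^ ?N * (1/2) ^ (4 * k) * B))"
    using B by (intro ennreal_mult[symmetric]) auto
  \<comment> \<open>The volume of the small cube contributes 2^(N k) and the second derivatives
    2^(-4 k); half the sum of the exponents is k (N/2 - 2).\<close>
  also have "\<dots> = ennreal ((2 ^ ?N * sqrt B * 2 powr ((?N / 2 - 2) * k))\<^sup>2)"
  proof -
    have e1: "inverse ((2 * ?h') ^ ?N) = 2 powr (?N * k)"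
      by (simp add: power_divide powr_realpow[symmetric] powr_powr power_inverse[symmetric] inverse_eq_divide powr_minus_divide mult.commute flip: powr_realpow power_mult)
    have e2: "(1/2::real) ^ (4 * k) = 2 powr (- 4 * k)"
      by (simp add: power_divide powr_minus_divide flip: powr_realpow)
    have e3: "(2 powr ((?N / 2 - 2) * k))\<^sup>2 = 2 powr (?N * k) * 2 powr (- 4 * k)"
      by (simp add: power2_eq_square powr_add[symmetric] algebra_simps)
    have e4: "(2 ^ ?N * sqrt B)\<^sup>2 = 4 ^ ?N * B"
    proof -
      have "((2::real) ^ ?N)\<^sup>2 = (2\<^sup>2) ^ ?N" by (simp only: power_even_eq[symmetric] power_mult)
      then show ?thesis using B by (simp add: power_mult_distrib)
    qed
    show ?thesis
      unfolding power_mult_distrib[of "2 ^ ?N * sqrt B"] e1 e2 e3 e4 by (simp only: mult_ac)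
  qed
  finally have "(cmod (full_box_average ?h' ?v x))\<^sup>2 \<le> (2 ^ ?N * sqrt B * 2 powr ((?N / 2 - 2) * k))\<^sup>2"
    by (simp add: ennreal_le_iff)
  then have "cmod (full_box_average ?h' ?v x) \<le> 2 ^ ?N * sqrt B * 2 powr ((?N / 2 - 2) * k)"
    by (rule power2_le_imp_le) (use B in auto)
  also have "\<dots> \<le> 2 ^ ?N * sqrt B * 2 powr (\<beta> * k)"
    using \<beta>(1) B by (intro mult_left_mono powr_mono mult_right_mono) auto
  \<comment> \<open>The condition on A bounds the increment by the difference of consecutive terms
    of A 2^(beta k), so the bound reproduces itself.\<close>
  also have "\<dots> \<le> A * (2 powr \<beta> - 1) * 2 powr (\<beta> * k)"
    using A(2) by (intro mult_right_mono) auto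
  finally have "cmod (full_box_average ?h' u x) \<le> A * (2 powr \<beta> - 1) * 2 powr (\<beta> * k) + A * 2 powr (\<beta> * k)"
    using 1 norm_triangle_ineq[of "full_box_average ?h' ?v x"] unfolding split by (meson add_mono order_trans)
  also have "\<dots> = A * (2 powr \<beta> * 2 powr (\<beta> * k))" by (simp add: algebra_simps)
  also have "2 powr \<beta> * 2 powr (\<beta> * k) = 2 powr (\<beta> * Suc k)"
    by (simp add: powr_add[symmetric] algebra_simps)
  finally show ?case .
qed

text \<open>Put l_k = 2 A 2^(beta k). If l_k < |a| <= l_(k+1), then |b_k| is at most half of l_k, so
  |a - b_k| is at least A 2^(beta k) and the k-th term absorbs |a|^p. Summing over all k removes the
  index, which depends on a, before any integration.\<close>

lemma powr_le_dyadic_sum: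
  fixes a :: complex and b :: "nat \<Rightarrow> complex" and \<beta> :: real
  assumes A: "A > 0" and \<beta>: "\<beta> > 0" and p: "p > 2" and b: "\<And>k. cmod (b k) \<le> A * 2 powr (\<beta> * k)"
  shows "ennreal (cmod a powr p) \<le> ennreal ((2 * A) powr (p - 2)) * ennreal ((cmod a)\<^sup>2)
    + (\<Sum>k. ennreal ((2 * A * 2 powr (\<beta> * Suc k)) powr p / (A * 2 powr (\<beta> * k))\<^sup>2) * ennreal ((cmod (a - b k))\<^sup>2))"
    (is "_ \<le> ?X + (\<Sum>k. ?c k * ?d k)")
proof (cases "cmod a \<le> 2 * A")
  case True
  have "cmod a powr p = cmod a powr (p - 2) * (cmod a)\<^sup>2"
  proof (cases "a = 0")
    case False
    then show ?thesis by (simp add: powr_numeral[symmetric] powr_add[symmetric] del: powr_numeral)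
  qed simp
  also have "\<dots> \<le> (2 * A) powr (p - 2) * (cmod a)\<^sup>2"
    using True p by (intro mult_right_mono powr_mono2) auto
  finally have "ennreal (cmod a powr p) \<le> ?X"
    by (subst ennreal_mult[symmetric]) (auto intro: ennreal_leI)
  also have "\<dots> \<le> ?X + (\<Sum>k. ?c k * ?d k)" by simp
  finally show ?thesis .
next
  case False
  define l where "l k = 2 * A * 2 powr (\<beta> * real k)" for k :: nat
  have "\<exists>k. cmod a \<le> l k"
  proof -
    obtain k :: nat where k: "log 2 (cmod a / (2 * A)) / \<beta> \<le> k" using real_arch_simple by blast
    have "cmod a / (2 * A) > 0" using False A by (smt (verit) divide_pos_pos)
    moreover have "log 2 (cmod a / (2 * A)) \<le> \<beta> * k" using k \<beta> by (simp add: field_simps)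
    ultimately have "cmod a / (2 * A) \<le> 2 powr (\<beta> * k)" by (simp add: log_le_iff)
    then show ?thesis using A by (auto simp: l_def field_simps intro!: exI[of _ k])
  qed
  then obtain n where n: "cmod a \<le> l n" "\<And>m. m < n \<Longrightarrow> \<not> cmod a \<le> l m"
    using exists_least_iff[of "\<lambda>k. cmod a \<le> l k"] by auto
  \<comment> \<open>\<open>l 0\<close> is \<open>2 * A\<close>, which |a| exceeds in this case, so
    there is a preceding level.\<close>
  have "n \<noteq> 0" using n(1) False by (auto simp: l_def intro: ccontr)
  then obtain k where k: "n = Suc k" by (cases n) auto
  have lk: "l k < cmod a" using n(2)[of k] k by auto
  let ?t = "A * 2 powr (\<beta> * k)"
  have t: "?t > 0" using A by simp
  have "cmod (a - b k) \<ge> cmod a - cmod (b k)" by (rule norm_triangle_ineq2)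
  also have "cmod a - cmod (b k) \<ge> l k - ?t" using lk b[of k] by linarith
  then have "cmod a - cmod (b k) \<ge> ?t" by (simp add: l_def)
  finally have ab: "?t\<^sup>2 \<le> (cmod (a - b k))\<^sup>2" using t by (intro power_mono) auto
  have "cmod a powr p \<le> l (Suc k) powr p" using n(1) k p by (intro powr_mono2) auto
  also have "\<dots> = l (Suc k) powr p / ?t\<^sup>2 * ?t\<^sup>2"
    using t by (simp only: times_divide_eq_left nonzero_mult_div_cancel_right[OF less_imp_neq[OF zero_less_power, symmetric]])
  also have "\<dots> \<le> l (Suc k) powr p / ?t\<^sup>2 * (cmod (a - b k))\<^sup>2"
    using ab by (intro mult_left_mono) auto
  finally have "ennreal (cmod a powr p) \<le> ?c k * ?d k"
    unfolding l_def by (subst ennreal_mult[symmetric]) (auto intro: ennreal_leI)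
  also have "\<dots> \<le> (\<Sum>k. ?c k * ?d k)"
    using sum_le_suminf[of "\<lambda>k. ?c k * ?d k" "{k}"] by auto
  also have "\<dots> \<le> ?X + \<dots>" by simp
  finally show ?thesis .
qed

text \<open>In the integrated form of \<open>powr_le_dyadic_sum\<close>, the coefficient at scale
  2^(-k) grows like 2^((p - 2) beta k) while the squared L^2 error of the average decays like 2^(-4
  k); (p - 2) beta < 4 makes the series converge.\<close>

lemma sobolev_bound:
  assumes p: "p > 2" and \<beta>: "\<beta> \<ge> CARD('n::finite) / 2 - 2" "\<beta> > 0" "(p - 2) * \<beta> < 4" and B: "B > 0"
  shows "\<exists>C>0. \<forall>(u :: real ^ 'n \<Rightarrow> complex) w d. has_pure_derivatives2 u w d \<longrightarrow> sq_norm u \<le> ennreal B \<longrightarrow>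
    sq_norm (\<lambda>x. \<Sum>i\<in>UNIV. d i x) \<le> ennreal B \<longrightarrow>
    (\<integral>\<^sup>+x. ennreal (cmod (u x) powr p) \<partial>lborel) \<le> ennreal C"
proof -
  let ?N = "CARD('n)"
  have \<beta>1: "2 powr \<beta> - 1 > 0" using \<beta>(2) by simp
  \<comment> \<open>The sum of the two lower bounds that \<open>dyadic_average_bound\<close> asks of
    A.\<close>
  define A where "A = sqrt B + 2 ^ ?N * sqrt B / (2 powr \<beta> - 1)"
  have A: "A > 0" "A \<ge> sqrt B" "A * (2 powr \<beta> - 1) \<ge> 2 ^ ?N * sqrt B"
  proof -
    let ?K = "2 ^ ?N * sqrt B"
    have "A * (2 powr \<beta> - 1) = sqrt B * (2 powr \<beta> - 1) + ?K"
      unfolding A_def distrib_right times_divide_eq_left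
        nonzero_mult_div_cancel_right[OF less_imp_neq[OF \<beta>1, symmetric]] ..
    moreover have "0 \<le> sqrt B * (2 powr \<beta> - 1)" using B \<beta>1 by simp
    ultimately show "A * (2 powr \<beta> - 1) \<ge> ?K" by linarith
    have "0 \<le> ?K / (2 powr \<beta> - 1)" using B \<beta>1 by simp
    then show "A \<ge> sqrt B" unfolding A_def by linarith
    then show "A > 0" using B real_sqrt_gt_zero[OF B] by linarith
  qed
  let ?c = "\<lambda>k::nat. (2 * A * 2 powr (\<beta> * Suc k)) powr p / (A * 2 powr (\<beta> * k))\<^sup>2"
  let ?e = "\<lambda>k::nat. ?c k * (4 ^ ?N * (1/2) ^ (4 * k) * B)"
  have "?e k = ((2 * A * 2 powr \<beta>) powr p / A\<^sup>2 * 4 ^ ?N * B) * (2 powr ((p - 2) * \<beta> - 4)) ^ k" for k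
  proof -
    have 1: "(1/2::real) ^ (4 * k) = 2 powr (- 4 * k)"
      by (simp add: power_divide powr_minus_divide flip: powr_realpow)
    have 2: "(2 * A * 2 powr (\<beta> * Suc k)) powr p = (2 * A * 2 powr \<beta>) powr p * 2 powr (p * \<beta> * k)"
    proof -
      have "2 * A * 2 powr (\<beta> * Suc k) = (2 * A * 2 powr \<beta>) * 2 powr (\<beta> * k)"
        by (simp add: powr_add[symmetric] algebra_simps)
      then show ?thesis using A(1) by (simp add: powr_mult powr_powr mult_ac)
    qed
    have 3: "(2 powr (\<beta> * k))\<^sup>2 = 2 powr (2 * \<beta> * k)"
      by (simp add: power2_eq_square powr_add[symmetric] mult.assoc)
    have 4: "(2 powr ((p - 2) * \<beta> - 4)) ^ k = 2 powr (p * \<beta> * k) / 2 powr (2 * \<beta> * k) * 2 powr (- 4 * k)"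
      by (simp add: powr_realpow[symmetric] powr_powr powr_diff[symmetric] powr_add[symmetric] algebra_simps)
    show ?thesis unfolding 1 2 4 power_mult_distrib 3 using A(1) by (simp add: field_simps)
  qed
  moreover have "summable (\<lambda>k. ((2 * A * 2 powr \<beta>) powr p / A\<^sup>2 * 4 ^ ?N * B) * (2 powr ((p - 2) * \<beta> - 4)) ^ k)"
    using powr_less_mono[of "(p - 2) * \<beta> - 4" 0 2] \<beta>(3) by (intro summable_mult summable_geometric) simp
  ultimately have sm: "summable ?e" by (simp only:)
  let ?C = "(2 * A) powr (p - 2) * B + (\<Sum>k. ?e k) + 1"
  have nn: "0 \<le> (\<Sum>k. ?e k)" using sm B by (intro suminf_nonneg) auto
  show ?thesis
  proof (intro exI[of _ ?C] conjI allI impI)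
    have "0 \<le> (2 * A) powr (p - 2) * B" using B by simp
    then show "?C > 0" using nn by linarith
    fix u :: "real ^ 'n \<Rightarrow> complex" and w d
    assume H: "has_pure_derivatives2 u w d" and u: "sq_norm u \<le> ennreal B"
      and L: "sq_norm (\<lambda>x. \<Sum>i\<in>UNIV. d i x) \<le> ennreal B"
    have su: "square_integrable u" using H by (simp add: has_pure_derivatives2_def)
    note [measurable] = su[THEN square_integrable_measurable]
    let ?b = "\<lambda>k x. full_box_average ((1/2) ^ k) u x"
    have b: "cmod (?b k x) \<le> A * 2 powr (\<beta> * k)" for k x
      using dyadic_average_bound[OF H less_imp_le[OF B] u L \<beta>(1,2) A(2,3)] .
    have "(\<integral>\<^sup>+x. ennreal (cmod (u x) powr p) \<partial>lborel)
        \<le> (\<integral>\<^sup>+x. ennreal ((2 * A) powr (p - 2)) * ennreal ((cmod (u x))\<^sup>2)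
          + (\<Sum>k. ennreal (?c k) * ennreal ((cmod (u x - ?b k x))\<^sup>2)) \<partial>lborel)"
      by (intro nn_integral_mono powr_le_dyadic_sum[OF A(1) \<beta>(2) p] b)
    also have "\<dots> = ennreal ((2 * A) powr (p - 2)) * sq_norm u + (\<Sum>k. ennreal (?c k) * sq_norm (\<lambda>x. u x - ?b k x))"
      unfolding sq_norm_def by (simp add: nn_integral_add nn_integral_suminf nn_integral_cmult)
    also have "\<dots> \<le> ennreal ((2 * A) powr (p - 2)) * ennreal B + (\<Sum>k. ennreal (?e k))"
    proof (intro add_mono mult_left_mono u suminf_le)
      fix k
      have "ennreal (?c k) * sq_norm (\<lambda>x. u x - ?b k x) \<le> ennreal (?c k) * ennreal (4 ^ ?N * (1/2) ^ (4 * k) * B)"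
        by (intro mult_left_mono sq_norm_dyadic_average_le[OF H less_imp_le[OF B] L]) auto
      also have "\<dots> = ennreal (?e k)" using B by (intro ennreal_mult[symmetric]) auto
      finally show "ennreal (?c k) * sq_norm (\<lambda>x. u x - ?b k x) \<le> ennreal (?e k)" .
    qed auto
    also have "(\<Sum>k. ennreal (?e k)) = ennreal (\<Sum>k. ?e k)"
      using sm B by (intro suminf_ennreal2) auto
    also have "ennreal ((2 * A) powr (p - 2)) * ennreal B + ennreal (\<Sum>k. ?e k) = ennreal ((2 * A) powr (p - 2) * B + (\<Sum>k. ?e k))"
      using nn B by (simp only: ennreal_plus ennreal_mult powr_ge_zero less_imp_le mult_nonneg_nonneg)
    also have "\<dots> \<le> ennreal ?C" by (intro ennreal_leI) simp
    finally show "(\<integral>\<^sup>+x. ennreal (cmod (u x) powr p) \<partial>lborel) \<le> ennreal ?C" .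
  qed
qed

subsection \<open>Strict monotonicity\<close>

definition admissible :: "real \<Rightarrow> (real ^ 'n::finite \<Rightarrow> complex) \<Rightarrow> bool" where
  "admissible \<sigma> u \<longleftrightarrow> u \<in> sobolev_H 2 \<and> (\<integral>x. cmod (u x) powr (2 * \<sigma> + 2) \<partial>lborel) = 1"

lemma t_inf_eq: "t_inf TYPE('n::finite) \<sigma> c = Inf {T_functional c u | u :: real ^ 'n \<Rightarrow> complex. admissible \<sigma> u}"
  by (simp add: t_inf_def admissible_def)

lemma T_functional_nonneg:
  assumes "u \<in> sobolev_H 2" "c \<ge> 0"
  shows "0 \<le> T_functional c u"
  using assms by (simp add: T_functional_eq Bochner_Integration.integral_nonneg)

lemma t_inf_le:
  assumes "admissible \<sigma> (u :: real ^ 'n::finite \<Rightarrow> complex)" "c \<ge> 0"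
  shows "t_inf TYPE('n) \<sigma> c \<le> T_functional c u"
  unfolding t_inf_eq
  using assms by (intro cInf_lower bdd_belowI[of _ 0]) (auto simp: admissible_def intro: T_functional_nonneg)

lemma t_inf_nonneg:
  assumes "\<exists>u :: real ^ 'n::finite \<Rightarrow> complex. admissible \<sigma> u" "c \<ge> 0"
  shows "0 \<le> t_inf TYPE('n) \<sigma> c"
  unfolding t_inf_eq
  using assms by (intro cInf_greatest) (auto simp: admissible_def intro: T_functional_nonneg)

text \<open>For N >= 5 the growth exponent of the averages is beta = N/2 - 2, and the hypothesis
  reads 2 sigma beta < 4. For N <= 4 any positive beta with 2 sigma beta < 4 serves, here 1 / sigma.
  Half of the remaining slack goes to p.\<close>

lemma subcritical_exponent:
  assumes "0 < \<sigma>" and "CARD('n::finite) \<ge> 5 \<Longrightarrow> \<sigma> < 4 / (real CARD('n) - 4)"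
  obtains \<beta> p where "\<beta> \<ge> CARD('n) / 2 - 2" "\<beta> > 0" "p > 2 * \<sigma> + 2" "(p - 2) * \<beta> < 4"
proof -
  obtain \<beta> where \<beta>: "\<beta> \<ge> CARD('n) / 2 - 2" "\<beta> > 0" "2 * \<sigma> * \<beta> < 4"
  proof (cases "CARD('n) \<ge> 5")
    case True
    show ?thesis
    proof (rule that[of "CARD('n) / 2 - 2"])
      show "2 * \<sigma> * (CARD('n) / 2 - 2) < 4"
        using assms(2)[OF True] True by (simp add: field_simps)
    qed (use True in auto)
  next
    case False
    have "CARD('n) / 2 - 2 \<le> 0" using False by simp
    also have "0 \<le> 1 / \<sigma>" using assms(1) by simp
    finally show ?thesis using that[of "1 / \<sigma>"] assms(1) by simp
  qed
  define \<eta> where "\<eta> = (4 - 2 * \<sigma> * \<beta>) / (2 * \<beta>)"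
  have "\<eta> > 0" using \<beta> by (simp add: \<eta>_def)
  moreover have "\<eta> * \<beta> = (4 - 2 * \<sigma> * \<beta>) / 2" using \<beta> by (simp add: \<eta>_def)
  then have "(2 * \<sigma> + 2 + \<eta> - 2) * \<beta> < 4" using \<beta>(3) by (simp add: algebra_simps)
  ultimately show thesis using that[of \<beta> "2 * \<sigma> + 2 + \<eta>"] \<beta> by simp
qed

text \<open>The energy bounds u and its Laplacian in L^2, hence u in L^p for some p above q = 2
  sigma + 2. Values of |u| above a threshold R then carry at most half of the unit integral of
  |u|^q, and the rest is controlled by the L^2 norm.\<close>

lemma L2_norm_lower_bound:
  assumes \<sigma>: "0 < \<sigma>" "CARD('n::finite) \<ge> 5 \<Longrightarrow> \<sigma> < 4 / (real CARD('n) - 4)" and c: "c > 0" and M: "M > 0"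
  shows "\<exists>m>0. \<forall>u :: real ^ 'n \<Rightarrow> complex. admissible \<sigma> u \<longrightarrow> T_functional c u \<le> M \<longrightarrow> m \<le> (\<integral>x. (cmod (u x))\<^sup>2 \<partial>lborel)"
proof -
  obtain \<beta> p where p: "\<beta> \<ge> CARD('n) / 2 - 2" "\<beta> > 0" "p > 2 * \<sigma> + 2" "(p - 2) * \<beta> < 4"
    using subcritical_exponent[OF \<sigma>] by blast
  \<comment> \<open>One bound for two quantities: M / c for the squared norm of u, and 2 M + 2 M / c
    for that of the Laplacian, written as (Laplacian + u) - u.\<close>
  define B where "B = 2 * M + 2 * (M / c) + M / c"
  have B: "B > 0" "M / c \<le> B" "2 * M + 2 * (M / c) \<le> B" 
    using M divide_pos_pos[OF M c] by (simp_all add: B_def)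
  have "p > 2" using p(3) \<sigma>(1) by simp
  from sobolev_bound[OF this p(1,2,4) B(1)]
  obtain C where C: "C > 0" "\<And>(u :: real ^ 'n \<Rightarrow> complex) w d. has_pure_derivatives2 u w d \<Longrightarrow> sq_norm u \<le> ennreal B \<Longrightarrow>
    sq_norm (\<lambda>x. \<Sum>i\<in>UNIV. d i x) \<le> ennreal B \<Longrightarrow> (\<integral>\<^sup>+x. ennreal (cmod (u x) powr p) \<partial>lborel) \<le> ennreal C"
    by blast
  let ?q = "2 * \<sigma> + 2"
  \<comment> \<open>Solves R^(q - p) C = 1/2, so that the part above R contributes at most one
    half.\<close>
  define R where "R = (2 * C) powr (1 / (p - ?q))"
  have R: "R > 0" "R powr (?q - p) * C = 1/2"
  proof -
    show "R > 0" using C(1) by (simp add: R_def)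
    have "R powr (?q - p) = (2 * C) powr (-1)"
    proof -
      have "1 / (p - ?q) * (?q - p) = -1" using p(3) by (simp add: field_simps)
      then show ?thesis by (simp only: R_def powr_powr)
    qed
    then show "R powr (?q - p) * C = 1/2" using C(1) by (simp add: powr_minus_divide)
  qed
  show ?thesis
  proof (intro exI[of _ "1 / (2 * R powr (2 * \<sigma>))"] conjI allI impI)
    show "0 < 1 / (2 * R powr (2 * \<sigma>))" using R(1) by simp
    fix u :: "real ^ 'n \<Rightarrow> complex"
    assume u: "admissible \<sigma> u" and T: "T_functional c u \<le> M"
    let ?L = "weak_laplacian u" and ?m = "\<integral>x. (cmod (u x))\<^sup>2 \<partial>lborel"
    have H2: "u \<in> sobolev_H 2" and one: "(\<integral>x. cmod (u x) powr ?q \<partial>lborel) = 1"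
      using u by (auto simp: admissible_def)
    note su = T_functional_eq(2)[OF H2] and sL = T_functional_eq(3)[OF H2]
    note [measurable] = su[THEN square_integrable_measurable] sL[THEN square_integrable_measurable]
    let ?a = "\<integral>x. (cmod (?L x + u x))\<^sup>2 \<partial>lborel"
    have T': "?a + c * ?m \<le> M" using T by (simp add: T_functional_eq(1)[OF H2])
    have nn: "0 \<le> ?a" "0 \<le> ?m" by (auto intro: Bochner_Integration.integral_nonneg)
    have "c * ?m \<le> M" using T' nn(1) by linarith
    then have m: "?m \<le> M / c" using c by (simp add: pos_le_divide_eq mult.commute)
    have a: "?a \<le> M" using T' nn c by (smt (verit) mult_nonneg_nonneg)
    have "sq_norm ?L = sq_norm (\<lambda>x. (?L x + u x) - u x)" by simp
    also have "\<dots> \<le> 2 * sq_norm (\<lambda>x. ?L x + u x) + 2 * sq_norm u"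
      by (rule sq_norm_diff_le) auto
    also have "\<dots> = 2 * ennreal ?a + 2 * ennreal ?m"
      by (simp add: sq_norm_eq_integral su square_integrable_add sL)
    also have "\<dots> = ennreal (2 * ?a + 2 * ?m)"
      using nn by (simp only: ennreal_mult' ennreal_plus ennreal_numeral mult_nonneg_nonneg zero_le_numeral)
    also have "\<dots> \<le> ennreal B"
      using a m B(3) by (intro ennreal_leI) linarith
    finally have LB: "sq_norm (\<lambda>x. \<Sum>i\<in>UNIV. weak_derivative i (weak_derivative i u) x) \<le> ennreal B"
      by (simp only: weak_laplacian_def[abs_def])
    have uB: "sq_norm u \<le> ennreal B"
      unfolding sq_norm_eq_integral[OF su] using m B(2) by (intro ennreal_leI) linarith
    note Lp = C(2)[OF sobolev_H2_pure_derivatives[OF H2] uB LB]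
    have pt: "cmod z powr ?q \<le> R powr (2 * \<sigma>) * (cmod z)\<^sup>2 + R powr (?q - p) * cmod z powr p" for z
    proof (cases "cmod z \<le> R")
      case True
      have "cmod z powr ?q = cmod z powr (2 * \<sigma>) * (cmod z)\<^sup>2"
      proof (cases "z = 0")
        case False
        then show ?thesis by (simp add: powr_numeral[symmetric] powr_add[symmetric] del: powr_numeral)
      qed simp
      also have "\<dots> \<le> R powr (2 * \<sigma>) * (cmod z)\<^sup>2"
        using True \<sigma> by (intro mult_right_mono powr_mono2) auto
      finally show ?thesis by (smt (verit) mult_nonneg_nonneg powr_ge_zero)
    next
      case False
      then have "cmod z > 0" using R(1) by linarith
      then have "cmod z powr ?q = cmod z powr (?q - p) * cmod z powr p"
        by (simp add: powr_add[symmetric])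
      also have "\<dots> \<le> R powr (?q - p) * cmod z powr p"
        using False p(3) R(1) by (intro mult_right_mono powr_mono2') auto
      finally show ?thesis by (smt (verit) mult_nonneg_nonneg powr_ge_zero zero_le_power2)
    qed
    \<comment> \<open>A non-integrable function would have integral 0, not 1.\<close>
    have "integrable lborel (\<lambda>x. cmod (u x) powr ?q)"
      using one not_integrable_integral_eq by fastforce
    then have "1 = (\<integral>\<^sup>+x. ennreal (cmod (u x) powr ?q) \<partial>lborel)"
      using one by (subst nn_integral_eq_integral) auto
    also have "\<dots> \<le> (\<integral>\<^sup>+x. ennreal (R powr (2 * \<sigma>)) * ennreal ((cmod (u x))\<^sup>2) + ennreal (R powr (?q - p)) * ennreal (cmod (u x) powr p) \<partial>lborel)"
      using pt by (intro nn_integral_mono) (simp add: ennreal_mult[symmetric] ennreal_plus[symmetric] del: ennreal_plus)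
    also have "\<dots> = ennreal (R powr (2 * \<sigma>)) * sq_norm u + ennreal (R powr (?q - p)) * (\<integral>\<^sup>+x. ennreal (cmod (u x) powr p) \<partial>lborel)"
      unfolding sq_norm_def by (simp add: nn_integral_add nn_integral_cmult)
    also have "\<dots> \<le> ennreal (R powr (2 * \<sigma>)) * ennreal ?m + ennreal (R powr (?q - p)) * ennreal C"
      by (intro add_mono mult_left_mono Lp) (auto simp: sq_norm_eq_integral[OF su])
    also have "\<dots> = ennreal (R powr (2 * \<sigma>) * ?m + 1/2)"
      using nn C(1) R by (simp add: ennreal_mult[symmetric] ennreal_plus[symmetric] del: ennreal_plus)
    finally have "1 \<le> R powr (2 * \<sigma>) * ?m + 1/2"
      using nn by (simp only: ennreal_1[symmetric] ennreal_le_iff mult_nonneg_nonneg powr_ge_zero add_nonneg_nonneg)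
    then show "1 / (2 * R powr (2 * \<sigma>)) \<le> ?m" using R(1) by (simp add: field_simps)
  qed
qed

lemma t_inf_strict_mono:
  assumes \<sigma>: "0 < \<sigma>" "CARD('n::finite) \<ge> 5 \<Longrightarrow> \<sigma> < 4 / (real CARD('n) - 4)"
    and ne: "\<exists>u :: real ^ 'n \<Rightarrow> complex. admissible \<sigma> u"
  shows "strict_mono_on {0<..} (t_inf TYPE('n) \<sigma>)"
proof (rule strict_mono_onI)
  fix c c' :: real assume c: "c \<in> {0<..}" "c' \<in> {0<..}" "c < c'"
  let ?t = "t_inf TYPE('n) \<sigma>"
  have "?t c' + 1 > 0" using t_inf_nonneg[OF ne, of c'] c by simp
  from L2_norm_lower_bound[OF \<sigma> _ this, of c'] c obtain m where m: "m > 0"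
    "\<And>u :: real ^ 'n \<Rightarrow> complex. admissible \<sigma> u \<Longrightarrow> T_functional c' u \<le> ?t c' + 1 \<Longrightarrow> m \<le> (\<integral>x. (cmod (u x))\<^sup>2 \<partial>lborel)"
    by auto
  have "min (?t c + (c' - c) * m) (?t c' + 1) \<le> ?t c'"
    unfolding t_inf_eq[of \<sigma> c']
  proof (rule cInf_greatest)
    show "{T_functional c' u |u :: real ^ 'n \<Rightarrow> complex. admissible \<sigma> u} \<noteq> {}" using ne by auto
    fix y assume "y \<in> {T_functional c' u |u :: real ^ 'n \<Rightarrow> complex. admissible \<sigma> u}"
    then obtain u :: "real ^ 'n \<Rightarrow> complex" where u: "admissible \<sigma> u" and y: "y = T_functional c' u" by auto
    show "min (?t c + (c' - c) * m) (Inf {T_functional c' u |u :: real ^ 'n \<Rightarrow> complex. admissible \<sigma> u} + 1) \<le> y"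
    proof (cases "T_functional c' u \<le> ?t c' + 1")
      case True
      have "T_functional c' u = T_functional c u + (c' - c) * (\<integral>x. (cmod (u x))\<^sup>2 \<partial>lborel)"
        by (simp add: T_functional_def algebra_simps)
      also have "\<dots> \<ge> ?t c + (c' - c) * m"
        using t_inf_le[OF u, of c] m(2)[OF u True] c by (intro add_mono mult_left_mono) auto
      finally show ?thesis by (simp add: y)
    next
      case False
      then show ?thesis unfolding y t_inf_eq by simp
    qed
  qed
  \<comment> \<open>The minimum cannot be t(c') + 1, so it is the first entry.\<close>
  moreover have "(c' - c) * m > 0" using c m(1) by simp
  ultimately show "?t c < ?t c'" by (simp add: min_def split: if_splits)
qed

subsection \<open>A radial solution of the Helmholtz equation\<close>

text \<open>Coefficients in powers of r^2 of the radial solution with value 1 at the origin: a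
  constant multiple of r^(1 - N/2) J_(N/2 - 1)(r), with J the Bessel function, and cos r for N =
  1.\<close>

primrec helmholtz_coeff :: "nat \<Rightarrow> nat \<Rightarrow> real" where
  "helmholtz_coeff N 0 = 1"
| "helmholtz_coeff N (Suc k) = - helmholtz_coeff N k / (real (Suc k) * (4 * real k + 2 * real N))"

text \<open>As a function of \<open>s = \<bar>x\<bar>\<^sup>2\<close>, the Helmholtz equation reads \<open>4 s f'' + 2 N f' + f = 0\<close>.\<close>
definition helmholtz :: "nat \<Rightarrow> real \<Rightarrow> real" where
  "helmholtz N s = (\<Sum>k. helmholtz_coeff N k * s ^ k)"

definition helmholtz' :: "nat \<Rightarrow> real \<Rightarrow> real" where
  "helmholtz' N s = (\<Sum>k. diffs (helmholtz_coeff N) k * s ^ k)"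

definition helmholtz'' :: "nat \<Rightarrow> real \<Rightarrow> real" where
  "helmholtz'' N s = (\<Sum>k. diffs (diffs (helmholtz_coeff N)) k * s ^ k)"

text \<open>The k-th denominator is at least k + 1, so the exponential series dominates and the
  solution may be differentiated term by term everywhere.\<close>

lemma helmholtz_coeff_bound:
  assumes "N \<ge> 1"
  shows "\<bar>helmholtz_coeff N k\<bar> \<le> inverse (fact k)"
proof (induction k)
  case (Suc k)
  have "1 \<le> 4 * real k + 2 * real N" using assms by simp
  then have "real (Suc k) \<le> real (Suc k) * (4 * real k + 2 * real N)"
    by (simp add: mult_le_cancel_left1)
  then have "\<bar>helmholtz_coeff N k\<bar> / (real (Suc k) * (4 * real k + 2 * real N)) \<le> inverse (fact k) / real (Suc k)"
    using Suc.IH by (intro frac_le) auto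
  then show ?case
    by (simp add: abs_mult field_simps)
qed simp

lemma summable_helmholtz:
  assumes "N \<ge> 1"
  shows "summable (\<lambda>k. helmholtz_coeff N k * s ^ k)"
    and "summable (\<lambda>k. diffs (helmholtz_coeff N) k * s ^ k)"
    and "summable (\<lambda>k. diffs (diffs (helmholtz_coeff N)) k * s ^ k)"
proof -
  have 0: "summable (\<lambda>k. helmholtz_coeff N k * s ^ k)" for s :: real
  proof (rule summable_comparison_test'[OF summable_exp[of "\<bar>s\<bar>"]])
    fix k show "norm (helmholtz_coeff N k * s ^ k) \<le> inverse (fact k) * \<bar>s\<bar> ^ k"
      using helmholtz_coeff_bound[OF assms, of k] by (simp add: abs_mult power_abs mult_right_mono)
  qed
  show "summable (\<lambda>k. helmholtz_coeff N k * s ^ k)" by (rule 0)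
  have 1: "summable (\<lambda>k. diffs (helmholtz_coeff N) k * s ^ k)" for s :: real
    by (rule termdiff_converges_all[OF 0])
  show "summable (\<lambda>k. diffs (helmholtz_coeff N) k * s ^ k)" by (rule 1)
  show "summable (\<lambda>k. diffs (diffs (helmholtz_coeff N)) k * s ^ k)"
    by (rule termdiff_converges_all[OF 1])
qed

lemma helmholtz_deriv:
  assumes "N \<ge> 1"
  shows "(helmholtz N has_real_derivative helmholtz' N s) (at s)"
    and "(helmholtz' N has_real_derivative helmholtz'' N s) (at s)"
    and "isCont (helmholtz'' N) s"
proof -
  show "(helmholtz N has_real_derivative helmholtz' N s) (at s)"
    unfolding helmholtz_def[abs_def] helmholtz'_def
    by (rule termdiffs_strong_converges_everywhere) (rule summable_helmholtz[OF assms])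
  show "(helmholtz' N has_real_derivative helmholtz'' N s) (at s)"
    unfolding helmholtz'_def[abs_def] helmholtz''_def
    by (rule termdiffs_strong_converges_everywhere) (rule summable_helmholtz[OF assms])
  have "(helmholtz'' N has_real_derivative (\<Sum>k. diffs (diffs (diffs (helmholtz_coeff N))) k * s ^ k)) (at s)"
    unfolding helmholtz''_def[abs_def]
    by (rule termdiffs_strong_converges_everywhere) (rule summable_helmholtz[OF assms])
  then show "isCont (helmholtz'' N) s" by (rule DERIV_isCont)
qed

lemma helmholtz_0: "helmholtz N 0 = 1"
proof -
  have "helmholtz N 0 = (\<Sum>k\<in>{0}. helmholtz_coeff N k * 0 ^ k)"
    unfolding helmholtz_def by (rule suminf_finite) auto
  then show ?thesis by simp
qed

text \<open>Comparison of coefficients: the recurrence is (k + 1) (4 k + 2 N) c_(k+1) + c_k =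
  0.\<close>

lemma helmholtz_ode:
  assumes N: "N \<ge> 1"
  shows "4 * s * helmholtz'' N s + 2 * real N * helmholtz' N s + helmholtz N s = 0"
proof -
  let ?c = "helmholtz_coeff N"
  have d: "diffs (diffs ?c) k = real (Suc k) * diffs ?c (Suc k)" for k by (simp add: diffs_def)
  let ?g = "\<lambda>k. real k * diffs ?c k * s ^ k"
  have gS: "?g (Suc k) = s * (diffs (diffs ?c) k * s ^ k)" for k
    unfolding d by simp
  have "summable (\<lambda>k. ?g (Suc k))"
    unfolding gS by (intro summable_mult summable_helmholtz N)
  then have sg: "summable ?g" by (rule summable_Suc_iff[of ?g, THEN iffD1])
  have "s * helmholtz'' N s = (\<Sum>k. ?g (Suc k))"
    unfolding gS helmholtz''_def by (rule suminf_mult[symmetric]) (rule summable_helmholtz[OF N])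
  \<comment> \<open>The term of index 0 vanishes, so the shift of the index costs nothing.\<close>
  also have "\<dots> = (\<Sum>k. ?g k)"
    using suminf_split_head[OF sg] by simp
  finally have "4 * s * helmholtz'' N s = (\<Sum>k. 4 * ?g k)"
    using suminf_mult[OF sg, of 4] by simp
  moreover have "2 * real N * helmholtz' N s = (\<Sum>k. 2 * real N * (diffs ?c k * s ^ k))"
    unfolding helmholtz'_def by (rule suminf_mult[symmetric]) (rule summable_helmholtz[OF N])
  ultimately have "4 * s * helmholtz'' N s + 2 * real N * helmholtz' N s + helmholtz N s
      = (\<Sum>k. 4 * ?g k + 2 * real N * (diffs ?c k * s ^ k) + ?c k * s ^ k)"
    unfolding helmholtz_def
    by (simp only:) (subst suminf_add[symmetric], (intro summable_add summable_mult sg summable_helmholtz N)+,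
      subst suminf_add[symmetric], (intro summable_add summable_mult sg summable_helmholtz N refl)+)
  also have "(\<lambda>k. 4 * ?g k + 2 * real N * (diffs ?c k * s ^ k) + ?c k * s ^ k) = (\<lambda>k. 0)"
  proof
    fix k
    have "4 * real k + 2 * real N \<noteq> 0" using N by linarith
    then have "(4 * real k + 2 * real N) * diffs ?c k = - ?c k"
      by (simp add: diffs_def)
    then have "((4 * real k + 2 * real N) * diffs ?c k + ?c k) * s ^ k = 0" by simp
    then show "4 * ?g k + 2 * real N * (diffs ?c k * s ^ k) + ?c k * s ^ k = 0"
      by (simp add: algebra_simps)
  qed
  finally show ?thesis by simp
qed

text \<open>With \<open>g(r) = f(r\<^sup>2)\<close> and \<open>m = (N - 1) / 2\<close>, the function \<open>w = r\<^sup>m g\<close> solves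
  \<open>w'' + (1 - m (m - 1) / r\<^sup>2) w = 0\<close>; the energy \<open>w'\<^sup>2 + w\<^sup>2\<close> is therefore bounded by Gronwall's argument.\<close>
lemma helmholtz_decay_at_infinity:
  assumes N: "N \<ge> 1"
  obtains C where "\<And>r. r \<ge> 1 \<Longrightarrow> r ^ (N - 1) * (helmholtz N (r\<^sup>2))\<^sup>2 \<le> C"
    "\<And>r. r \<ge> 1 \<Longrightarrow> r ^ (N - 1) * (2 * r * helmholtz' N (r\<^sup>2))\<^sup>2 \<le> C"
proof -
  define m where "m = (real N - 1) / 2"
  define K where "K = \<bar>m * (m - 1)\<bar>"
  define g where "g r = helmholtz N (r\<^sup>2)" for r
  define g1 where "g1 r = 2 * r * helmholtz' N (r\<^sup>2)" for r
  have sq: "((\<lambda>r. r\<^sup>2) has_real_derivative 2 * r) (at r)" for r :: real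
    by (auto intro!: derivative_eq_intros)
  have g: "(g has_real_derivative g1 r) (at r)" for r
    unfolding g_def g1_def
    using DERIV_chain2[OF helmholtz_deriv(1)[OF N] sq] by (simp add: mult.commute)
  have g1: "(g1 has_real_derivative - (2 * m / r) * g1 r - g r) (at r)" if "r > 0" for r
  proof -
    have "((\<lambda>r. helmholtz' N (r\<^sup>2)) has_real_derivative helmholtz'' N (r\<^sup>2) * (2 * r)) (at r)"
      by (rule DERIV_chain2[OF helmholtz_deriv(2)[OF N] sq])
    then have D: "(g1 has_real_derivative 2 * helmholtz' N (r\<^sup>2) + 2 * r * (helmholtz'' N (r\<^sup>2) * (2 * r))) (at r)"
      unfolding g1_def by (auto intro!: derivative_eq_intros)
    have "2 * helmholtz' N (r\<^sup>2) + 2 * r * (helmholtz'' N (r\<^sup>2) * (2 * r)) = - (2 * m / r) * g1 r - g r"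
    proof -
      have "(2 * m / r) * g1 r = (real N - 1) * (2 * helmholtz' N (r\<^sup>2))"
        using that by (simp add: m_def g1_def)
      then show ?thesis
        using helmholtz_ode[OF N, of "r\<^sup>2"] by (simp add: g_def power2_eq_square algebra_simps)
    qed
    with D show ?thesis by simp
  qed
  \<comment> \<open>Here w' = r^m (g1 + m g / r), so \<open>E\<close> below is the energy of
    w.\<close>
  define P where "P r = (g1 r + m * g r / r)\<^sup>2 + (g r)\<^sup>2" for r
  define E where "E r = r powr (2 * m) * P r" for r
  \<comment> \<open>An integrating factor for E' <= (K / r^2) E. As K / r^2 is integrable at
    infinity, the factor stays between 1 and exp K for r >= 1, and the energy stays bounded.\<close>
  define G where "G r = E r * exp (K / r)" for r
  have P0: "P r \<ge> 0" for r by (simp add: P_def)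
  have dE: "(E has_real_derivative r powr (2 * m) * (2 * (m * (m - 1)) / r\<^sup>2 * (g r * (g1 r + m * g r / r)))) (at r)"
    if r: "r > 0" for r
  proof -
    have "(P has_real_derivative 2 * (g1 r + m * g r / r) * ((- (2 * m / r) * g1 r - g r) + (m * g1 r * r - m * g r) / (r * r)) + 2 * g r * g1 r) (at r)"
    proof -
      have "((\<lambda>r. g1 r + m * g r / r) has_real_derivative (- (2 * m / r) * g1 r - g r) + (m * g1 r * r - m * g r) / (r * r)) (at r)"
        using DERIV_add[OF g1[OF r] DERIV_divide[OF DERIV_cmult[OF g] DERIV_ident, of r m]] r by simp
      from DERIV_add[OF DERIV_power[OF this, of 2] DERIV_power[OF g, of 2]] show ?thesis
        unfolding P_def[abs_def] by (simp add: mult_ac del: distrib_left_numeral distrib_right_numeral)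
    qed
    moreover have "((\<lambda>r. r powr (2 * m)) has_real_derivative 2 * m * (r powr (2 * m) / r)) (at r)"
      using r by (auto intro!: derivative_eq_intros simp: powr_diff)
    ultimately have "(E has_real_derivative r powr (2 * m) * (2 * (g1 r + m * g r / r) * ((- (2 * m / r) * g1 r - g r) + (m * g1 r * r - m * g r) / (r * r)) + 2 * g r * g1 r)
        + 2 * m * (r powr (2 * m) / r) * P r) (at r)"
      unfolding E_def using DERIV_mult' by blast
    moreover have "r powr (2 * m) * (2 * (g1 r + m * g r / r) * ((- (2 * m / r) * g1 r - g r) + (m * g1 r * r - m * g r) / (r * r)) + 2 * g r * g1 r)
        + 2 * m * (r powr (2 * m) / r) * P r = r powr (2 * m) * (2 * (m * (m - 1)) / r\<^sup>2 * (g r * (g1 r + m * g r / r)))"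
    proof -
      define X where "X = r powr (2 * m)"
      \<comment> \<open>Eliminating g1 in favour of w leaves a rational identity in w, g and
        r.\<close>
      define w where "w = g1 r + m * g r / r"
      have g1w: "g1 r = w - m * g r / r" by (simp add: w_def)
      show ?thesis
        unfolding P_def X_def[symmetric] w_def[symmetric] unfolding g1w
        using r by (simp add: field_simps power2_eq_square)
    qed
    ultimately show ?thesis by simp
  qed
  have G_le: "G r \<le> G 1" if "r \<ge> 1" for r
  proof (rule DERIV_nonpos_imp_nonincreasing[OF that])
    fix t assume t: "1 \<le> t" "t \<le> r"
    then have t0: "t > 0" by simp
    let ?d = "t powr (2 * m) * (2 * (m * (m - 1)) / t\<^sup>2 * (g t * (g1 t + m * g t / t)))"
    have "((\<lambda>t. exp (K / t)) has_real_derivative exp (K / t) * (- K / t\<^sup>2)) (at t)"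
      using t0 by (auto intro!: derivative_eq_intros simp: power2_eq_square)
    from DERIV_mult[OF dE[OF t0] this]
    have "(G has_real_derivative ?d * exp (K / t) + exp (K / t) * (- K / t\<^sup>2) * E t) (at t)"
      unfolding G_def .
    moreover have "?d \<le> K / t\<^sup>2 * E t"
    proof -
      let ?w = "g1 t + m * g t / t"
      have "2 * \<bar>g t * ?w\<bar> \<le> P t"
        using sum_squares_bound[of "\<bar>g t\<bar>" "\<bar>?w\<bar>"] by (simp add: P_def abs_mult)
      then have K: "K * (2 * \<bar>g t * ?w\<bar>) \<le> K * P t" by (intro mult_left_mono) (auto simp: K_def)
      have "2 * (m * (m - 1)) * (g t * ?w) \<le> \<bar>2 * (m * (m - 1)) * (g t * ?w)\<bar>" by (rule abs_ge_self)
      also have "\<dots> = K * (2 * \<bar>g t * ?w\<bar>)" by (simp add: K_def abs_mult)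
      also note K
      finally have "2 * (m * (m - 1)) * (g t * ?w) \<le> K * P t" .
      then have "2 * (m * (m - 1)) * (g t * ?w) / t\<^sup>2 \<le> K * P t / t\<^sup>2" by (rule divide_right_mono) simp
      then have "t powr (2 * m) * (2 * (m * (m - 1)) * (g t * ?w) / t\<^sup>2) \<le> t powr (2 * m) * (K * P t / t\<^sup>2)"
        by (rule mult_left_mono) simp
      then show ?thesis by (simp add: E_def mult_ac)
    qed
    then have "?d * exp (K / t) \<le> K / t\<^sup>2 * E t * exp (K / t)" by (rule mult_right_mono) simp
    then have "?d * exp (K / t) + exp (K / t) * (- K / t\<^sup>2) * E t \<le> 0" by (simp add: algebra_simps)
    ultimately show "\<exists>y. (G has_real_derivative y) (at t) \<and> y \<le> 0" by blast
  qed
  have E_le: "E r \<le> G 1" if "r \<ge> 1" for r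
  proof -
    have "K \<ge> 0" by (simp add: K_def)
    then have "1 \<le> exp (K / r)" using that by simp
    then have "E r * 1 \<le> G r" unfolding G_def by (intro mult_left_mono) (auto simp: E_def P0)
    with G_le[OF that] show ?thesis by simp
  qed
  \<comment> \<open>Recovering g1 from g1 + m g / r costs a term of size at most m |g| for r >= 1;
    this is the origin of 2 (1 + m^2).\<close>
  let ?C = "2 * (1 + m\<^sup>2) * G 1"
  have pw: "r powr (2 * m) = r ^ (N - 1)" if "r \<ge> 1" for r
  proof -
    have "2 * m = real (N - 1)" using N by (simp add: m_def of_nat_diff)
    then show ?thesis using that by (simp only: powr_realpow)
  qed
  have G1: "G 1 \<ge> 0" using E_le[of 1] by (simp add: E_def) (use P0[of 1] in linarith)
  show thesis
  proof (rule that[of ?C])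
    fix r :: real assume r: "r \<ge> 1"
    have "r powr (2 * m) * (g r)\<^sup>2 \<le> E r" by (auto simp: E_def P_def intro!: mult_left_mono)
    with E_le[OF r] have g2: "r powr (2 * m) * (g r)\<^sup>2 \<le> G 1" by simp
    also have "G 1 \<le> ?C" using mult_right_mono[of 1 "2 * (1 + m\<^sup>2)" "G 1"] G1 by simp
    finally show "r ^ (N - 1) * (helmholtz N (r\<^sup>2))\<^sup>2 \<le> ?C" by (simp add: pw[OF r] g_def)
    \<comment> \<open>The inequality a^2 <= 2 (a + b)^2 + 2 b^2 amounts to (a + 2 b)^2 >= 0.\<close>
    have "(g1 r)\<^sup>2 \<le> 2 * (g1 r + m * g r / r)\<^sup>2 + 2 * (m * g r / r)\<^sup>2"
      using zero_le_power2[of "g1 r + 2 * (m * g r / r)"] by (simp add: power2_eq_square algebra_simps)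
    also have "(m * g r / r)\<^sup>2 \<le> m\<^sup>2 * (g r)\<^sup>2"
    proof -
      have "(m * g r / r)\<^sup>2 = m\<^sup>2 * (g r)\<^sup>2 / r\<^sup>2" by (simp add: power_divide power_mult_distrib)
      also have "\<dots> \<le> m\<^sup>2 * (g r)\<^sup>2 / 1" using r by (intro divide_left_mono) (auto simp: one_le_power)
      finally show ?thesis by simp
    qed
    also have "2 * (g1 r + m * g r / r)\<^sup>2 + 2 * (m\<^sup>2 * (g r)\<^sup>2) \<le> 2 * P r + 2 * m\<^sup>2 * (g r)\<^sup>2"
      by (simp add: P_def)
    finally have "r powr (2 * m) * (g1 r)\<^sup>2 \<le> r powr (2 * m) * (2 * P r + 2 * m\<^sup>2 * (g r)\<^sup>2)"
      by (intro mult_left_mono) auto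
    also have "\<dots> = 2 * E r + 2 * m\<^sup>2 * (r powr (2 * m) * (g r)\<^sup>2)" by (simp add: E_def algebra_simps)
    also have "\<dots> \<le> 2 * G 1 + 2 * m\<^sup>2 * G 1"
      using E_le[OF r] g2 by (intro add_mono mult_left_mono) auto
    also have "2 * G 1 + 2 * m\<^sup>2 * G 1 = ?C" by (simp add: algebra_simps)
    finally show "r ^ (N - 1) * (2 * r * helmholtz' N (r\<^sup>2))\<^sup>2 \<le> ?C"
      unfolding pw[OF r] g1_def .
  qed
qed

text \<open>On [0, 1] both quantities are bounded by compactness; \<open>max 1 r\<close> makes the
  weight constant there, so that one constant covers all radii.\<close>

lemma helmholtz_decay:
  assumes N: "N \<ge> 1"
  obtains C where "C > 0" "\<And>r. r \<ge> 0 \<Longrightarrow> (max 1 r) ^ (N - 1) * (helmholtz N (r\<^sup>2))\<^sup>2 \<le> C"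
    "\<And>r. r \<ge> 0 \<Longrightarrow> (max 1 r) ^ (N - 1) * (2 * r * helmholtz' N (r\<^sup>2))\<^sup>2 \<le> C"
proof -
  obtain C1 where C1: "\<And>r. r \<ge> 1 \<Longrightarrow> r ^ (N - 1) * (helmholtz N (r\<^sup>2))\<^sup>2 \<le> C1"
    "\<And>r. r \<ge> 1 \<Longrightarrow> r ^ (N - 1) * (2 * r * helmholtz' N (r\<^sup>2))\<^sup>2 \<le> C1"
    using helmholtz_decay_at_infinity[OF N] by blast
  have c: "continuous_on UNIV (helmholtz N)" "continuous_on UNIV (helmholtz' N)"
    using helmholtz_deriv[OF N] by (meson DERIV_isCont continuous_at_imp_continuous_on)+
  have b: "\<exists>C. \<forall>r\<in>{0..1}. h r \<le> C" if "continuous_on {0..1} h" for h :: "real \<Rightarrow> real"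
    using continuous_attains_sup[of "{0..1}" h] that by auto
  have "continuous_on {0..1} (\<lambda>r::real. (helmholtz N (r\<^sup>2))\<^sup>2)"
    by (intro continuous_intros continuous_on_compose2[OF c(1)]) auto
  then obtain C2 where C2: "\<And>r. r \<in> {0..1} \<Longrightarrow> (helmholtz N (r\<^sup>2))\<^sup>2 \<le> C2" using b by meson
  have "continuous_on {0..1} (\<lambda>r::real. (2 * r * helmholtz' N (r\<^sup>2))\<^sup>2)"
    by (intro continuous_intros continuous_on_compose2[OF c(2)]) auto
  then obtain C3 where C3: "\<And>r. r \<in> {0..1} \<Longrightarrow> (2 * r * helmholtz' N (r\<^sup>2))\<^sup>2 \<le> C3" using b by meson
  let ?C = "\<bar>C1\<bar> + \<bar>C2\<bar> + \<bar>C3\<bar> + 1"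
  show thesis
  proof (rule that[of ?C])
    fix r :: real assume r: "r \<ge> 0"
    show "(max 1 r) ^ (N - 1) * (helmholtz N (r\<^sup>2))\<^sup>2 \<le> ?C"
    proof (cases "r \<ge> 1")
      case True
      then have "max 1 r = r" by simp
      then show ?thesis using C1(1)[of r] True by linarith
    next
      case False
      then have "max 1 r = 1" by simp
      then show ?thesis using C2[of r] r False by simp
    qed
    show "(max 1 r) ^ (N - 1) * (2 * r * helmholtz' N (r\<^sup>2))\<^sup>2 \<le> ?C"
    proof (cases "r \<ge> 1")
      case True
      then have "max 1 r = r" by simp
      then show ?thesis using C1(2)[of r] True by linarith
    next
      case False
      then have "max 1 r = 1" by simp
      then show ?thesis using C3[of r] r False by simp
    qed
  qed simp
qed

text \<open>For k >= 1 the two pieces meet with derivative 0. Hence the cube of a positive part is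
  twice continuously differentiable, which is all that H^2 asks of the cutoff.\<close>

lemma max_0_power_deriv:
  assumes "k \<ge> 1"
  shows "((\<lambda>t::real. (max 0 t) ^ Suc k) has_real_derivative real (Suc k) * (max 0 t) ^ k) (at t)"
proof -
  consider "t < 0" | "t > 0" | "t = 0" by linarith
  then show ?thesis
  proof cases
    case 1
    have "((\<lambda>t::real. 0) has_real_derivative 0) (at t)" by simp
    moreover have "eventually (\<lambda>y. (max 0 y) ^ Suc k = (0::real)) (nhds t)"
      using eventually_nhds_in_open[of "{..<0}" t] 1 by (auto elim!: eventually_mono)
    ultimately have "((\<lambda>t::real. (max 0 t) ^ Suc k) has_real_derivative 0) (at t)"
      using DERIV_cong_ev[of t t "\<lambda>t. (max 0 t) ^ Suc k" "\<lambda>t. 0" 0 0] by simp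
    with 1 assms show ?thesis by (simp add: max_def power_0_left)
  next
    case 2
    have "((\<lambda>t::real. t ^ Suc k) has_real_derivative real (Suc k) * t ^ k) (at t)"
      using DERIV_pow[of "Suc k" t] by simp
    moreover have "eventually (\<lambda>y. (max 0 y) ^ Suc k = y ^ Suc k) (nhds t)"
      using eventually_nhds_in_open[of "{0<..}" t] 2 by (auto elim!: eventually_mono simp: max_def)
    ultimately show ?thesis
      using 2 DERIV_cong_ev[of t t "\<lambda>t. (max 0 t) ^ Suc k" "\<lambda>t. t ^ Suc k"] by (simp add: max_def)
  next
    case 3
    have "(\<lambda>h::real. (max 0 h) ^ Suc k / h) = (\<lambda>h. (max 0 h) ^ k)"
      using assms by (auto simp: fun_eq_iff max_def power_0_left)
    moreover have "((\<lambda>h::real. (max 0 h) ^ k) \<longlongrightarrow> (max 0 0) ^ k) (at 0)"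
      by (intro tendsto_intros)
    ultimately show ?thesis using 3 assms by (simp add: DERIV_def power_0_left)
  qed
qed

subsection \<open>Classical and radial functions\<close>

text \<open>As for weak derivatives, with the segment formula now valid at every point.\<close>

lemma classical_diff_quot_tendsto:
  fixes u :: "real ^ 'n::finite \<Rightarrow> complex"
  assumes d: "\<And>x. u differentiable at x" and c: "continuous_on UNIV (partial_derivative i u)"
    and si: "square_integrable (partial_derivative i u)" and y: "y \<longlonglongrightarrow> 0" "\<And>n. y n \<noteq> 0"
  shows "(\<lambda>n. sq_norm (\<lambda>x. diff_quot (y n) i u x - partial_derivative i u x)) \<longlonglongrightarrow> 0"
proof (rule tendsto_sandwich[OF _ _ tendsto_const nn_integral_segment_translate_tendsto[OF si y(1)]])
  have "diff_quot (y n) i u = segment_average (y n) i (partial_derivative i u)" for n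
    using segment_FTC[OF d c, of _ "y n"] y(2)[of n] by (simp add: diff_quot_def fun_eq_iff)
  then show "\<forall>\<^sub>F n in sequentially. sq_norm (\<lambda>x. diff_quot (y n) i u x - partial_derivative i u x)
      \<le> (\<integral>\<^sup>+s. sq_norm (\<lambda>x. partial_derivative i u (x + (s * y n) *\<^sub>R axis i 1) - partial_derivative i u x) \<partial>unif01)"
    using sq_norm_segment_average_diff_le[OF si square_integrable_measurable[OF si]] by simp
qed auto

text \<open>The difference quotient is moved to the test function by
  \<open>integral_diff_quot_adjoint\<close>, and both sides converge.\<close>

lemma classical_has_weak_derivative:
  fixes u :: "real ^ 'n::finite \<Rightarrow> complex"
  assumes d: "\<And>x. u differentiable at x" and c: "continuous_on UNIV (partial_derivative i u)"
    and si: "square_integrable u" "square_integrable (partial_derivative i u)"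
  shows "has_weak_derivative i u (partial_derivative i u)"
  unfolding has_weak_derivative_def
proof (intro conjI allI impI)
  show "locally_integrable u" "locally_integrable (partial_derivative i u)"
    using si square_integrable_imp_locally_integrable by blast+
  fix \<phi> :: "real ^ 'n \<Rightarrow> complex" assume \<phi>: "test_function \<phi>"
  let ?du = "partial_derivative i u" and ?d\<phi> = "partial_derivative i \<phi>"
  let ?y = "\<lambda>n. inverse (real (Suc n))"
  have y: "?y \<longlonglongrightarrow> 0" "\<And>n. ?y n \<noteq> 0" using LIMSEQ_inverse_real_of_nat by auto
  have y': "(\<lambda>n. - ?y n) \<longlonglongrightarrow> 0" "\<And>n. - ?y n \<noteq> 0" using tendsto_minus[OF y(1)] by auto
  note s\<phi> = test_function_square_integrable[OF \<phi>]
  have "(\<lambda>n. \<integral>x. diff_quot (?y n) i u x * \<phi> x \<partial>lborel) \<longlonglongrightarrow> (\<integral>x. ?du x * \<phi> x \<partial>lborel)"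
    by (intro integral_mult_tendsto square_integrable_diff_quot si s\<phi> classical_diff_quot_tendsto d c y)
       (simp add: sq_norm_def)
  moreover have "(\<lambda>n. - (\<integral>x. u x * diff_quot (- ?y n) i \<phi> x \<partial>lborel)) \<longlonglongrightarrow> - (\<integral>x. u x * ?d\<phi> x \<partial>lborel)"
    by (intro tendsto_minus integral_mult_tendsto square_integrable_diff_quot si s\<phi>
          classical_diff_quot_tendsto test_functionD[OF \<phi>] y')
       (simp add: sq_norm_def)
  ultimately have "(\<integral>x. ?du x * \<phi> x \<partial>lborel) = - (\<integral>x. u x * ?d\<phi> x \<partial>lborel)"
    unfolding integral_diff_quot_adjoint[OF si(1) s\<phi>(1)] by (rule LIMSEQ_unique)
  then show "(\<integral>x. u x * ?d\<phi> x \<partial>lborel) = - (\<integral>x. ?du x * \<phi> x \<partial>lborel)" by simp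
qed

text \<open>Radial functions are written in s = |x|^2 rather than |x| to avoid a singularity at the
  origin.\<close>

lemma radial_has_derivative:
  fixes x :: "real ^ 'n::finite"
  assumes "\<And>s. (\<Phi> has_real_derivative \<Phi>' s) (at s)"
  shows "((\<lambda>x. \<Phi> (x \<bullet> x)) has_derivative (\<lambda>h. 2 * (x \<bullet> h) * \<Phi>' (x \<bullet> x))) (at x)"
proof -
  have "((\<lambda>x. x \<bullet> x) has_derivative (\<lambda>h. 2 * (x \<bullet> h))) (at x)"
    by (auto intro!: derivative_eq_intros simp: inner_commute)
  from DERIV_compose_FDERIV[OF assms this] show ?thesis .
qed

lemma radial_partial_derivative:
  fixes i :: "'n::finite"
  assumes D: "\<And>s. (\<Phi> has_real_derivative \<Phi>' s) (at s)"
  shows "(\<lambda>x. complex_of_real (\<Phi> (x \<bullet> x))) differentiable at (x :: real ^ 'n)"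
    and "partial_derivative i (\<lambda>x. complex_of_real (\<Phi> (x \<bullet> x))) = (\<lambda>x. complex_of_real (2 * x $ i * \<Phi>' (x \<bullet> x)))"
proof -
  note * = has_derivative_of_real[OF radial_has_derivative[OF D], where 'a=complex]
  show "(\<lambda>x. complex_of_real (\<Phi> (x \<bullet> x))) differentiable at (x :: real ^ 'n)"
    using * differentiableI by blast
  show "partial_derivative i (\<lambda>x. complex_of_real (\<Phi> (x \<bullet> x))) = (\<lambda>x. complex_of_real (2 * x $ i * \<Phi>' (x \<bullet> x)))"
    by (rule ext, subst partial_derivative_eq[OF *]) (simp add: inner_axis)
qed

lemma radial_partial_derivative2:
  fixes i j :: "'n::finite"
  assumes D: "\<And>s. (\<Phi>' has_real_derivative \<Phi>'' s) (at s)"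
  shows "(\<lambda>x. complex_of_real (2 * x $ i * \<Phi>' (x \<bullet> x))) differentiable at (x :: real ^ 'n)"
    and "partial_derivative j (\<lambda>x. complex_of_real (2 * x $ i * \<Phi>' (x \<bullet> x)))
      = (\<lambda>x. complex_of_real (2 * (axis j 1 $ i) * \<Phi>' (x \<bullet> x) + 4 * x $ i * x $ j * \<Phi>'' (x \<bullet> x)))"
proof -
  have "((\<lambda>x. 2 * x $ i * \<Phi>' (x \<bullet> x)) has_derivative
      (\<lambda>h. 2 * x $ i * (2 * (x \<bullet> h) * \<Phi>'' (x \<bullet> x)) + 2 * h $ i * \<Phi>' (x \<bullet> x))) (at x)" for x :: "real ^ 'n"
    by (intro has_derivative_mult radial_has_derivative[OF D] has_derivative_mult_right
        bounded_linear.has_derivative[OF bounded_linear_vec_nth] has_derivative_ident)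
  note * = has_derivative_of_real[OF this, where 'a=complex]
  show "(\<lambda>x. complex_of_real (2 * x $ i * \<Phi>' (x \<bullet> x))) differentiable at (x :: real ^ 'n)"
    using * differentiableI by blast
  show "partial_derivative j (\<lambda>x. complex_of_real (2 * x $ i * \<Phi>' (x \<bullet> x)))
      = (\<lambda>x. complex_of_real (2 * (axis j 1 $ i) * \<Phi>' (x \<bullet> x) + 4 * x $ i * x $ j * \<Phi>'' (x \<bullet> x)))"
    by (rule ext, subst partial_derivative_eq[OF *]) (simp add: inner_axis)
qed

text \<open>Continuity and compact support give square integrability. Mixed derivatives occur
  because \<open>sobolev_H\<close> asks every first derivative for all of its weak
  derivatives.\<close>

lemma radial_sobolev:
  fixes \<Phi> :: "real \<Rightarrow> real"
  assumes D: "\<And>s. (\<Phi> has_real_derivative \<Phi>' s) (at s)" "\<And>s. (\<Phi>' has_real_derivative \<Phi>'' s) (at s)"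
    and c: "continuous_on UNIV \<Phi>''"
    and 0: "\<And>s. s > R\<^sup>2 \<Longrightarrow> \<Phi> s = 0 \<and> \<Phi>' s = 0 \<and> \<Phi>'' s = 0" and R: "R \<ge> 0"
  defines "u \<equiv> \<lambda>x :: real ^ 'n::finite. complex_of_real (\<Phi> (x \<bullet> x))"
    and "d \<equiv> \<lambda>i j (x :: real ^ 'n). complex_of_real (2 * (axis j 1 $ i) * \<Phi>' (x \<bullet> x) + 4 * x $ i * x $ j * \<Phi>'' (x \<bullet> x))"
  shows "u \<in> sobolev_H 2"
    and "has_pure_derivatives2 u (\<lambda>i x. complex_of_real (2 * x $ i * \<Phi>' (x \<bullet> x))) (\<lambda>i. d i i)"
proof -
  let ?w = "\<lambda>i (x :: real ^ 'n). complex_of_real (2 * x $ i * \<Phi>' (x \<bullet> x))"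
  have c0: "continuous_on UNIV \<Phi>" "continuous_on UNIV \<Phi>'"
    using D by (meson DERIV_isCont continuous_at_imp_continuous_on)+
  have sq: "continuous_on UNIV (\<lambda>x :: real ^ 'n. f (x \<bullet> x))" if "continuous_on UNIV f" for f :: "real \<Rightarrow> real"
    by (rule continuous_on_compose2[OF that]) (auto intro!: continuous_intros)
  have nth: "continuous_on UNIV (\<lambda>x :: real ^ 'n. x $ i)" for i
    by (intro linear_continuous_on bounded_linear_vec_nth)
  have cc: "continuous_on UNIV u" "continuous_on UNIV (?w i)" "continuous_on UNIV (d i j)" for i j
    unfolding u_def d_def
    by (intro continuous_on_of_real continuous_on_add continuous_on_mult continuous_on_const nth sq[OF c0(1)] sq[OF c0(2)] sq[OF c])+
  have out: "u x = 0" "?w i x = 0" "d i j x = 0" if "x \<notin> cball 0 R" for x i j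
  proof -
    have "norm x > R" using that by simp
    then have "(norm x)\<^sup>2 > R\<^sup>2" using R by (intro power_strict_mono) auto
    then have "x \<bullet> x > R\<^sup>2" by (simp add: power2_norm_eq_inner)
    from 0[OF this] show "u x = 0" "?w i x = 0" "d i j x = 0" by (auto simp: u_def d_def)
  qed
  note sic = square_integrable_continuous_compact[OF _ compact_cball[of 0 R]]
  have si: "square_integrable u" "square_integrable (?w i)" "square_integrable (d i j)" for i j
    using cc out by (auto intro!: sic simp del: mem_cball)
  have w: "has_weak_derivative i u (?w i)" for i
  proof -
    have p: "partial_derivative i u = ?w i"
      unfolding u_def by (rule radial_partial_derivative(2)[OF D(1)])
    have "u differentiable at x" for x
      unfolding u_def by (rule radial_partial_derivative(1)[OF D(1)])
    from classical_has_weak_derivative[OF this, of i, unfolded p, OF cc(2) si(1) si(2)] show ?thesis .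
  qed
  have w2: "has_weak_derivative j (?w i) (d i j)" for i j
  proof -
    have p: "partial_derivative j (?w i) = d i j"
      unfolding d_def by (rule radial_partial_derivative2(2)[OF D(2)])
    have "?w i differentiable at x" for x
      by (rule radial_partial_derivative2(1)[OF D(2)])
    from classical_has_weak_derivative[OF this, of j, unfolded p, OF cc(3) si(2) si(3)] show ?thesis .
  qed
  show "u \<in> sobolev_H 2"
    unfolding numeral_2_eq_2 using si w w2 by (auto simp del: of_real_mult of_real_add) blast
  show "has_pure_derivatives2 u ?w (\<lambda>i. d i i)"
    unfolding has_pure_derivatives2_def using si w w2 by blast
qed

text \<open>Exchanges the chosen representative of the weak Laplacian, known only almost everywhere,
  for the classical real expression.\<close>

lemma integral_cmod_add_of_real:
  fixes g :: "'a::euclidean_space \<Rightarrow> complex" and l p :: "'a \<Rightarrow> real"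
  assumes [measurable]: "g \<in> borel_measurable borel" "l \<in> borel_measurable borel" "p \<in> borel_measurable borel"
    and ae: "AE x in lborel. g x = complex_of_real (l x)"
  shows "(\<integral>x. (cmod (g x + complex_of_real (p x)))\<^sup>2 \<partial>lborel) = (\<integral>x. (l x + p x)\<^sup>2 \<partial>lborel)"
proof (rule integral_cong_AE)
  show "AE x in lborel. (cmod (g x + complex_of_real (p x)))\<^sup>2 = (l x + p x)\<^sup>2"
    using ae by eventually_elim (simp only: of_real_add[symmetric] norm_of_real power2_abs)
qed measurable

lemma T_functional_radial:
  fixes \<Phi> :: "real \<Rightarrow> real"
  assumes D: "\<And>s. (\<Phi> has_real_derivative \<Phi>' s) (at s)" "\<And>s. (\<Phi>' has_real_derivative \<Phi>'' s) (at s)"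
    and c: "continuous_on UNIV \<Phi>''"
    and 0: "\<And>s. s > R\<^sup>2 \<Longrightarrow> \<Phi> s = 0 \<and> \<Phi>' s = 0 \<and> \<Phi>'' s = 0" and R: "R \<ge> 0"
  shows "T_functional a (\<lambda>x :: real ^ 'n::finite. complex_of_real (\<Phi> (x \<bullet> x)))
    = (\<integral>x. (4 * (x \<bullet> x) * \<Phi>'' (x \<bullet> x) + 2 * real CARD('n) * \<Phi>' (x \<bullet> x) + \<Phi> (x \<bullet> x))\<^sup>2 \<partial>(lborel :: (real ^ 'n) measure))
      + a * (\<integral>x. (\<Phi> (x \<bullet> x))\<^sup>2 \<partial>(lborel :: (real ^ 'n) measure))"
proof -
  let ?u = "\<lambda>x :: real ^ 'n. complex_of_real (\<Phi> (x \<bullet> x))"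
  let ?L = "\<lambda>x :: real ^ 'n. 4 * (x \<bullet> x) * \<Phi>'' (x \<bullet> x) + 2 * real CARD('n) * \<Phi>' (x \<bullet> x)"
  note H = radial_sobolev[where 'n='n, OF D c 0 R]
  note su = T_functional_eq(2)[OF H(1)] and sL = T_functional_eq(3)[OF H(1)]
  note m = su[THEN square_integrable_measurable] sL[THEN square_integrable_measurable]
  have c0: "continuous_on UNIV \<Phi>" "continuous_on UNIV \<Phi>'"
    using D by (meson DERIV_isCont continuous_at_imp_continuous_on)+
  have sq: "continuous_on UNIV (\<lambda>x :: real ^ 'n. f (x \<bullet> x))" if "continuous_on UNIV f" for f :: "real \<Rightarrow> real"
    by (rule continuous_on_compose2[OF that]) (auto intro!: continuous_intros)
  have m': "?L \<in> borel_measurable borel" "(\<lambda>x :: real ^ 'n. \<Phi> (x \<bullet> x)) \<in> borel_measurable borel"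
    by (intro borel_measurable_continuous_onI continuous_on_add continuous_on_mult continuous_on_const
        continuous_on_inner continuous_on_id sq[OF c0(1)] sq[OF c0(2)] sq[OF c])+
  \<comment> \<open>The trace of the Hessian: the N diagonal terms give 2 N Phi' and the squared
    coordinates give 4 s Phi'', with s = |x|^2.\<close>
  have sum: "(\<Sum>i\<in>UNIV. complex_of_real (2 * (axis i 1 $ i) * \<Phi>' (x \<bullet> x) + 4 * x $ i * x $ i * \<Phi>'' (x \<bullet> x)))
      = complex_of_real (?L x)" for x :: "real ^ 'n"
  proof -
    have "(\<Sum>i\<in>UNIV. 2 * (axis i 1 $ i) * \<Phi>' (x \<bullet> x) + 4 * x $ i * x $ i * \<Phi>'' (x \<bullet> x)) = ?L x"
      by (simp add: sum.distrib inner_vec_def[of x x] sum_distrib_left sum_distrib_right mult_ac)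
    then show ?thesis by (simp only: of_real_sum[symmetric])
  qed
  have "AE x in lborel. \<forall>i\<in>UNIV. weak_derivative i (weak_derivative i ?u) x
      = complex_of_real (2 * (axis i 1 $ i) * \<Phi>' (x \<bullet> x) + 4 * x $ i * x $ i * \<Phi>'' (x \<bullet> x))"
    by (intro AE_finite_allI weak_derivative2_props(2)[OF H(2)]) simp
  then have ae: "AE x in lborel. weak_laplacian ?u x = complex_of_real (?L x)"
    by eventually_elim (simp only: weak_laplacian_def sum[symmetric] ball_UNIV)
  have "(\<integral>x. (cmod (weak_laplacian ?u x + ?u x))\<^sup>2 \<partial>lborel) = (\<integral>x. (?L x + \<Phi> (x \<bullet> x))\<^sup>2 \<partial>lborel)"
    by (rule integral_cmod_add_of_real[OF m(2) m' ae])
  then show ?thesis by (simp only: T_functional_eq(1)[OF H(1)] norm_of_real power2_abs)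
qed

subsection \<open>Integrals of radially decaying functions\<close>

text \<open>A mean value estimate, used for the volume of a spherical shell of width 1.\<close>

lemma power_Suc_diff_le:
  fixes n :: real
  assumes "n \<ge> 0"
  shows "(n + 1) ^ Suc k - n ^ Suc k \<le> real (Suc k) * (n + 1) ^ k"
proof (induction k)
  case (Suc k)
  have "(n + 1) ^ Suc (Suc k) - n ^ Suc (Suc k) = (n + 1) ^ Suc k + n * ((n + 1) ^ Suc k - n ^ Suc k)"
    by (simp add: algebra_simps)
  also have "\<dots> \<le> (n + 1) ^ Suc k + n * (real (Suc k) * (n + 1) ^ k)"
    using Suc assms by (intro add_left_mono mult_left_mono) auto
  also have "\<dots> \<le> (n + 1) ^ Suc k + (n + 1) * (real (Suc k) * (n + 1) ^ k)"
    using assms by (intro add_left_mono mult_right_mono) auto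
  also have "\<dots> = real (Suc (Suc k)) * (n + 1) ^ Suc k" by (simp add: algebra_simps)
  finally show ?case .
qed simp

text \<open>In place of polar coordinates, induction over shells of width 1: the shell beyond radius
  n has volume of order n^(N - 1), which cancels the weight, so each shell adds at most a fixed
  amount.\<close>

lemma nn_integral_radial_decay:
  fixes N defines "N \<equiv> CARD('n::finite)"
  shows "n \<ge> 1 \<Longrightarrow> (\<integral>\<^sup>+x. ennreal (1 / (max 1 (norm x)) ^ (N - 1)) * indicator (cball (0 :: real ^ 'n) (real n)) x \<partial>lborel)
    \<le> ennreal (unit_ball_vol N * real N * 2 ^ (N - 1) * real n)"
proof (induction n rule: nat_induct_at_least)
  case base
  have N: "N \<ge> 1" by (simp add: N_def)
  have "(\<integral>\<^sup>+x. ennreal (1 / (max 1 (norm x)) ^ (N - 1)) * indicator (cball (0 :: real ^ 'n) (real 1)) x \<partial>lborel)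
      \<le> (\<integral>\<^sup>+x. indicator (cball (0 :: real ^ 'n) 1) x \<partial>lborel)"
    by (intro nn_integral_mono) (auto simp: indicator_def ennreal_le_1 divide_le_eq one_le_power)
  also have "\<dots> = ennreal (unit_ball_vol N)"
    by (simp add: emeasure_cball N_def)
  also have "\<dots> \<le> ennreal (unit_ball_vol N * real N * 2 ^ (N - 1) * real 1)"
  proof (rule ennreal_leI)
    have "1 \<le> real N * 2 ^ (N - 1)" using N mult_mono[of 1 "real N" 1 "2 ^ (N - 1)"] by simp
    then have "unit_ball_vol N * 1 \<le> unit_ball_vol N * (real N * 2 ^ (N - 1))"
      by (intro mult_left_mono) auto
    then show "unit_ball_vol N \<le> unit_ball_vol N * real N * 2 ^ (N - 1) * real 1" by (simp add: mult.assoc)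
  qed
  finally show ?case .
next
  case (Suc n)
  let ?f = "\<lambda>x :: real ^ 'n. ennreal (1 / (max 1 (norm x)) ^ (N - 1))"
  let ?B = "\<lambda>n. cball (0 :: real ^ 'n) (real n)"
  let ?K = "unit_ball_vol N * real N * 2 ^ (N - 1)"
  have N: "N \<ge> 1" by (simp add: N_def)
  have mf: "?f \<in> borel_measurable lborel" by measurable
  have sub: "?B n \<subseteq> ?B (Suc n)" by auto
  have split: "?f x * indicator (?B (Suc n)) x = ?f x * indicator (?B n) x + ?f x * indicator (?B (Suc n) - ?B n) x" for x
    using sub by (auto simp: indicator_def)
  have "(\<integral>\<^sup>+x. ?f x * indicator (?B (Suc n) - ?B n) x \<partial>lborel)
      \<le> (\<integral>\<^sup>+x. ennreal (1 / real n ^ (N - 1)) * indicator (?B (Suc n) - ?B n) x \<partial>lborel)"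
  proof (rule nn_integral_mono)
    fix x :: "real ^ 'n"
    show "?f x * indicator (?B (Suc n) - ?B n) x \<le> ennreal (1 / real n ^ (N - 1)) * indicator (?B (Suc n) - ?B n) x"
    proof (cases "x \<in> ?B (Suc n) - ?B n")
      case True
      then have "real n \<le> max 1 (norm x)" by auto
      then have "real n ^ (N - 1) \<le> (max 1 (norm x)) ^ (N - 1)" by (rule power_mono) simp
      then have "1 / (max 1 (norm x)) ^ (N - 1) \<le> 1 / real n ^ (N - 1)"
        using Suc.hyps by (intro divide_left_mono) auto
      then show ?thesis by (intro mult_right_mono ennreal_leI) auto
    qed auto
  qed
  also have "\<dots> = ennreal (1 / real n ^ (N - 1)) * emeasure lborel (?B (Suc n) - ?B n)"
    by (rule nn_integral_cmult_indicator) simp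
  also have "emeasure lborel (?B (Suc n) - ?B n) = ennreal (unit_ball_vol N * (real (Suc n) ^ N - real n ^ N))"
  proof -
    have "emeasure lborel (?B (Suc n) - ?B n) = emeasure lborel (?B (Suc n)) - emeasure lborel (?B n)"
      using sub by (intro emeasure_Diff) (auto simp: emeasure_cball)
    also have "\<dots> = ennreal (unit_ball_vol N * real (Suc n) ^ N) - ennreal (unit_ball_vol N * real n ^ N)"
      by (simp add: emeasure_cball N_def)
    also have "\<dots> = ennreal (unit_ball_vol N * real (Suc n) ^ N - unit_ball_vol N * real n ^ N)"
      by (rule ennreal_minus) simp
    finally show ?thesis by (simp add: right_diff_distrib)
  qed
  also have "ennreal (1 / real n ^ (N - 1)) * \<dots> = ennreal (1 / real n ^ (N - 1) * (unit_ball_vol N * (real (Suc n) ^ N - real n ^ N)))"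
    by (intro ennreal_mult[symmetric] mult_nonneg_nonneg) (auto simp: power_mono)
  also have "\<dots> \<le> ennreal ?K"
  proof (rule ennreal_leI)
    have n: "real n \<ge> 1" using Suc.hyps by simp
    have "real (Suc n) ^ N - real n ^ N \<le> real N * real (Suc n) ^ (N - 1)"
      using power_Suc_diff_le[of "real n" "N - 1"] N by (simp add: add.commute)
    \<comment> \<open>n + 1 <= 2 n is the source of 2^(N - 1) in the constant.\<close>
    also have "\<dots> \<le> real N * (2 * real n) ^ (N - 1)"
      using n by (intro mult_left_mono power_mono) auto
    finally have "1 / real n ^ (N - 1) * (unit_ball_vol N * (real (Suc n) ^ N - real n ^ N))
        \<le> 1 / real n ^ (N - 1) * (unit_ball_vol N * (real N * (2 * real n) ^ (N - 1)))"
      by (intro mult_left_mono) auto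
    also have "\<dots> = ?K" using n by (simp add: power_mult_distrib)
    finally show "1 / real n ^ (N - 1) * (unit_ball_vol N * (real (Suc n) ^ N - real n ^ N)) \<le> ?K" .
  qed
  finally have ann: "(\<integral>\<^sup>+x. ?f x * indicator (?B (Suc n) - ?B n) x \<partial>lborel) \<le> ennreal ?K" .
  have "(\<integral>\<^sup>+x. ?f x * indicator (?B (Suc n)) x \<partial>lborel)
      = (\<integral>\<^sup>+x. ?f x * indicator (?B n) x \<partial>lborel) + (\<integral>\<^sup>+x. ?f x * indicator (?B (Suc n) - ?B n) x \<partial>lborel)"
    unfolding split by (rule nn_integral_add) (intro borel_measurable_times_ennreal mf borel_measurable_indicator; simp)+
  also have "\<dots> \<le> ennreal (?K * real n) + ennreal ?K"
    by (intro add_mono Suc.IH ann)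
  also have "\<dots> = ennreal (?K * real (Suc n))"
    by (simp add: ennreal_plus[symmetric] algebra_simps del: ennreal_plus)
  finally show ?case .
qed

lemma integral_radial_decay_le:
  fixes h :: "real ^ 'n::finite \<Rightarrow> real"
  assumes [measurable]: "h \<in> borel_measurable borel" and n: "n \<ge> 1" and A: "A \<ge> 0"
    and b: "\<And>x. norm x \<le> real n \<Longrightarrow> (h x)\<^sup>2 \<le> A / (max 1 (norm x)) ^ (CARD('n) - 1)"
    and 0: "\<And>x. norm x > real n \<Longrightarrow> h x = 0"
  shows "(\<integral>x. (h x)\<^sup>2 \<partial>lborel) \<le> A * (unit_ball_vol CARD('n) * real CARD('n) * 2 ^ (CARD('n) - 1) * real n)"
proof -
  let ?N = "CARD('n)"
  let ?f = "\<lambda>x :: real ^ 'n. ennreal (1 / (max 1 (norm x)) ^ (?N - 1)) * indicator (cball (0 :: real ^ 'n) (real n)) x"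
  let ?K = "unit_ball_vol ?N * real ?N * 2 ^ (?N - 1) * real n"
  have mf: "(\<lambda>x :: real ^ 'n. ennreal (1 / (max 1 (norm x)) ^ (?N - 1))) \<in> borel_measurable lborel"
    by measurable
  have "(\<integral>\<^sup>+x. ennreal ((h x)\<^sup>2) \<partial>lborel) \<le> (\<integral>\<^sup>+x. ennreal A * ?f x \<partial>lborel)"
  proof (rule nn_integral_mono)
    fix x
    show "ennreal ((h x)\<^sup>2) \<le> ennreal A * ?f x"
    proof (cases "norm x \<le> real n")
      case True
      have "ennreal ((h x)\<^sup>2) \<le> ennreal (A * (1 / (max 1 (norm x)) ^ (?N - 1)))"
        using b[OF True] by (intro ennreal_leI) simp
      also have "\<dots> = ennreal A * ennreal (1 / (max 1 (norm x)) ^ (?N - 1))"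
        using A by (intro ennreal_mult) auto
      finally show ?thesis using True by simp
    qed (simp add: 0)
  qed
  also have "\<dots> = ennreal A * (\<integral>\<^sup>+x. ?f x \<partial>lborel)"
    by (rule nn_integral_cmult) (intro borel_measurable_times_ennreal mf borel_measurable_indicator; simp)
  also have "\<dots> \<le> ennreal A * ennreal ?K"
    by (intro mult_left_mono nn_integral_radial_decay[OF n]) auto
  also have "\<dots> = ennreal (A * ?K)" using A by (intro ennreal_mult[symmetric]) auto
  finally have le: "(\<integral>\<^sup>+x. ennreal ((h x)\<^sup>2) \<partial>lborel) \<le> ennreal (A * ?K)" .
  have "integrable lborel (\<lambda>x. (h x)\<^sup>2)"
    by (rule integrableI_nonneg) (simp_all add: order.strict_trans1[OF le])
  from nn_integral_eq_integral[OF this] le have "ennreal (\<integral>x. (h x)\<^sup>2 \<partial>lborel) \<le> ennreal (A * ?K)" by simp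
  moreover have "0 \<le> A * ?K" using A by (intro mult_nonneg_nonneg) auto
  ultimately show ?thesis by (simp only: ennreal_le_iff)
qed

subsection \<open>Truncated Helmholtz solutions and the upper bound\<close>

text \<open>The cube is the least power with a continuous second derivative. The argument is s =
  |x|^2, so q = R^2 cuts at radius R.\<close>

definition cutoff :: "real \<Rightarrow> real \<Rightarrow> real" where
  "cutoff q s = (max 0 (1 - s / q)) ^ 3"

definition cutoff' :: "real \<Rightarrow> real \<Rightarrow> real" where
  "cutoff' q s = - 3 / q * (max 0 (1 - s / q)) ^ 2"

definition cutoff'' :: "real \<Rightarrow> real \<Rightarrow> real" where
  "cutoff'' q s = 6 / q\<^sup>2 * max 0 (1 - s / q)"

lemma cutoff_deriv:
  assumes q: "q > 0"
  shows "(cutoff q has_real_derivative cutoff' q s) (at s)"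
    and "(cutoff' q has_real_derivative cutoff'' q s) (at s)"
proof -
  have l: "((\<lambda>s. 1 - s / q) has_real_derivative - (1 / q)) (at s)"
    using q by (auto intro!: derivative_eq_intros)
  have "((\<lambda>s. (max 0 (1 - s / q)) ^ Suc 2) has_real_derivative real (Suc 2) * (max 0 (1 - s / q)) ^ 2 * - (1 / q)) (at s)"
    by (rule DERIV_chain2[OF max_0_power_deriv l]) simp
  then show "(cutoff q has_real_derivative cutoff' q s) (at s)"
    by (simp add: cutoff_def[abs_def] cutoff'_def eval_nat_numeral)
  have "((\<lambda>s. - 3 / q * (max 0 (1 - s / q)) ^ Suc 1) has_real_derivative - 3 / q * (real (Suc 1) * (max 0 (1 - s / q)) ^ 1 * - (1 / q))) (at s)"
    by (rule DERIV_cmult[OF DERIV_chain2[OF max_0_power_deriv l]]) simp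
  then show "(cutoff' q has_real_derivative cutoff'' q s) (at s)"
    by (simp add: cutoff'_def[abs_def] cutoff''_def eval_nat_numeral)
qed

lemma cutoff_eq_0: "q > 0 \<Longrightarrow> s > q \<Longrightarrow> cutoff q s = 0 \<and> cutoff' q s = 0 \<and> cutoff'' q s = 0"
  by (simp add: cutoff_def cutoff'_def cutoff''_def max_def)

lemma cutoff_bounds:
  assumes "q > 0" "s \<ge> 0"
  shows "\<bar>cutoff q s\<bar> \<le> 1" "\<bar>cutoff' q s\<bar> \<le> 3 / q" "\<bar>cutoff'' q s\<bar> \<le> 6 / q\<^sup>2"
proof -
  let ?t = "max 0 (1 - s / q)"
  have t: "0 \<le> ?t" "?t \<le> 1" using assms by auto
  show "\<bar>cutoff q s\<bar> \<le> 1" using t by (simp add: cutoff_def power_le_one)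
  have "3 / q * ?t ^ 2 \<le> 3 / q * 1" using assms t by (intro mult_left_mono power_le_one) auto
  then show "\<bar>cutoff' q s\<bar> \<le> 3 / q" using assms by (simp add: cutoff'_def abs_mult)
  have "6 / q\<^sup>2 * ?t \<le> 6 / q\<^sup>2 * 1" using assms t by (intro mult_left_mono) auto
  then show "\<bar>cutoff'' q s\<bar> \<le> 6 / q\<^sup>2" using assms t by (simp add: cutoff''_def abs_mult)
qed

definition profile :: "nat \<Rightarrow> real \<Rightarrow> real \<Rightarrow> real" where
  "profile N q s = helmholtz N s * cutoff q s"

definition profile' :: "nat \<Rightarrow> real \<Rightarrow> real \<Rightarrow> real" where
  "profile' N q s = helmholtz' N s * cutoff q s + helmholtz N s * cutoff' q s"

definition profile'' :: "nat \<Rightarrow> real \<Rightarrow> real \<Rightarrow> real" where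
  "profile'' N q s = helmholtz'' N s * cutoff q s + 2 * helmholtz' N s * cutoff' q s + helmholtz N s * cutoff'' q s"

lemma profile_deriv:
  assumes N: "N \<ge> 1" and q: "q > 0"
  shows "(profile N q has_real_derivative profile' N q s) (at s)"
    and "(profile' N q has_real_derivative profile'' N q s) (at s)"
    and "continuous_on UNIV (profile'' N q)"
proof -
  note d = helmholtz_deriv(1,2)[OF N] cutoff_deriv[OF q]
  show "(profile N q has_real_derivative profile' N q s) (at s)"
    unfolding profile_def[abs_def] profile'_def
    using DERIV_mult[OF d(1,3)] by (simp add: mult_ac add_ac)
  show "(profile' N q has_real_derivative profile'' N q s) (at s)"
    unfolding profile'_def[abs_def] profile''_def
    using DERIV_add[OF DERIV_mult[OF d(2,3)] DERIV_mult[OF d(1,4)], of s] by (simp add: mult_ac add_ac)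
  have c: "continuous_on UNIV (helmholtz N)" "continuous_on UNIV (helmholtz' N)" "continuous_on UNIV (helmholtz'' N)"
      "continuous_on UNIV (cutoff q)" "continuous_on UNIV (cutoff' q)"
    using d helmholtz_deriv(3)[OF N] by (meson DERIV_isCont continuous_at_imp_continuous_on)+
  have "continuous_on UNIV (cutoff'' q)"
    unfolding cutoff''_def[abs_def] using q by (auto intro!: continuous_intros)
  then show "continuous_on UNIV (profile'' N q)"
    unfolding profile''_def[abs_def] by (intro continuous_intros c)
qed

lemma profile_eq_0:
  assumes "R \<ge> 1" "s > R\<^sup>2"
  shows "profile N (R\<^sup>2) s = 0 \<and> profile' N (R\<^sup>2) s = 0 \<and> profile'' N (R\<^sup>2) s = 0"
proof -
  have "R\<^sup>2 > 0" using assms(1) by simp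
  from cutoff_eq_0[OF this assms(2)] show ?thesis
    by (simp add: profile_def profile'_def profile''_def)
qed

text \<open>Since \<open>helmholtz\<close> is an exact solution, only terms with derivatives of the cutoff survive.\<close>
lemma profile_remainder:
  assumes "N \<ge> 1"
  shows "4 * s * profile'' N q s + 2 * real N * profile' N q s + profile N q s
    = 8 * s * helmholtz' N s * cutoff' q s + 4 * s * helmholtz N s * cutoff'' q s + 2 * real N * helmholtz N s * cutoff' q s"
proof -
  have "4 * s * profile'' N q s + 2 * real N * profile' N q s + profile N q s
    = (4 * s * helmholtz'' N s + 2 * real N * helmholtz' N s + helmholtz N s) * cutoff q s
      + (8 * s * helmholtz' N s * cutoff' q s + 4 * s * helmholtz N s * cutoff'' q s + 2 * real N * helmholtz N s * cutoff' q s)"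
    by (simp add: profile_def profile'_def profile''_def algebra_simps)
  then show ?thesis by (simp add: helmholtz_ode[OF assms])
qed

text \<open>Each surviving term contains a derivative of the cutoff, of size 1 / R^2 or 1 / R^4. In
  the term with f' one factor r goes to 2 r f', whose decay is known, and the other is at most R; so
  every term is at most of order 1 / R times a decaying function.\<close>

lemma profile_bounds:
  assumes N: "N \<ge> 1"
  obtains C where "C > 0"
    "\<And>R r. R \<ge> 1 \<Longrightarrow> 0 \<le> r \<Longrightarrow> r \<le> R \<Longrightarrow> (profile N (R\<^sup>2) (r\<^sup>2))\<^sup>2 \<le> C / (max 1 r) ^ (N - 1)"
    "\<And>R r. R \<ge> 1 \<Longrightarrow> 0 \<le> r \<Longrightarrow> r \<le> R \<Longrightarrow>
      (4 * r\<^sup>2 * profile'' N (R\<^sup>2) (r\<^sup>2) + 2 * real N * profile' N (R\<^sup>2) (r\<^sup>2) + profile N (R\<^sup>2) (r\<^sup>2))\<^sup>2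
        \<le> C / R\<^sup>2 / (max 1 r) ^ (N - 1)"
proof -
  obtain C where C: "C > 0" "\<And>r. r \<ge> 0 \<Longrightarrow> (max 1 r) ^ (N - 1) * (helmholtz N (r\<^sup>2))\<^sup>2 \<le> C"
    "\<And>r. r \<ge> 0 \<Longrightarrow> (max 1 r) ^ (N - 1) * (2 * r * helmholtz' N (r\<^sup>2))\<^sup>2 \<le> C"
    using helmholtz_decay[OF N] by blast
  \<comment> \<open>The numbers 12, 24 and 6 N come from \<open>b1\<close>, \<open>b2\<close> and
    \<open>b3\<close> below, the outer factors 2 from squaring a sum.\<close>
  define D where "D = 2 * 12\<^sup>2 + 2 * (24 + 6 * real N)\<^sup>2"
  have D: "D \<ge> 1" by (simp add: D_def)
  have bd: "(helmholtz N (r\<^sup>2))\<^sup>2 \<le> C / (max 1 r) ^ (N - 1)" "(2 * r * helmholtz' N (r\<^sup>2))\<^sup>2 \<le> C / (max 1 r) ^ (N - 1)"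
    if "r \<ge> 0" for r
    using C(2,3)[OF that] by (simp_all add: pos_le_divide_eq mult.commute)
  show thesis
  proof (rule that[of "D * C"])
    show "D * C > 0" using C(1) D by simp
    fix R r :: real assume R: "R \<ge> 1" and r: "0 \<le> r" "r \<le> R"
    let ?f = "helmholtz N (r\<^sup>2)" and ?g = "2 * r * helmholtz' N (r\<^sup>2)" and ?\<rho> = "(max 1 r) ^ (N - 1)"
    let ?X = "cutoff (R\<^sup>2) (r\<^sup>2)" and ?X' = "cutoff' (R\<^sup>2) (r\<^sup>2)" and ?X'' = "cutoff'' (R\<^sup>2) (r\<^sup>2)"
    have q: "R\<^sup>2 > 0" using R by simp
    have CD: "C \<le> D * C" using C(1) D by simp
    note X = cutoff_bounds[OF q zero_le_power2[of r]]
    have "(profile N (R\<^sup>2) (r\<^sup>2))\<^sup>2 = ?f\<^sup>2 * ?X\<^sup>2" by (simp add: profile_def power_mult_distrib)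
    also have "\<dots> \<le> ?f\<^sup>2 * 1" using X(1) by (intro mult_left_mono) (auto simp: abs_square_le_1)
    also have "\<dots> \<le> C / ?\<rho>" using bd(1)[OF r(1)] by simp
    also have "\<dots> \<le> D * C / ?\<rho>" using CD by (intro divide_right_mono) auto
    finally show "(profile N (R\<^sup>2) (r\<^sup>2))\<^sup>2 \<le> D * C / ?\<rho>" .
    have rR: "r\<^sup>2 \<le> R\<^sup>2" using r by (intro power_mono) auto
    \<comment> \<open>The terms with f itself are of order 1 / R^2; R >= 1 brings them to the common
      order 1 / R.\<close>
    have R1: "1 / R\<^sup>2 \<le> 1 / R" using R by (simp add: power2_eq_square field_simps)
    have b1: "\<bar>4 * r * ?g * ?X'\<bar> \<le> 12 * \<bar>?g\<bar> / R"
    proof -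
      have "\<bar>4 * r * ?g * ?X'\<bar> = 4 * r * \<bar>?g\<bar> * \<bar>?X'\<bar>" using r(1) by (simp add: abs_mult)
      also have "\<dots> \<le> 4 * R * \<bar>?g\<bar> * (3 / R\<^sup>2)" using r R X(2) by (intro mult_mono) auto
      also have "\<dots> = 12 * \<bar>?g\<bar> / R" using R by (simp add: power2_eq_square)
      finally show ?thesis .
    qed
    have b2: "\<bar>4 * r\<^sup>2 * ?f * ?X''\<bar> \<le> 24 * \<bar>?f\<bar> / R"
    proof -
      have "\<bar>4 * r\<^sup>2 * ?f * ?X''\<bar> = 4 * r\<^sup>2 * \<bar>?f\<bar> * \<bar>?X''\<bar>" by (simp add: abs_mult)
      also have "\<dots> \<le> 4 * R\<^sup>2 * \<bar>?f\<bar> * (6 / (R\<^sup>2)\<^sup>2)" using rR X(3) by (intro mult_mono) auto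
      also have "\<dots> = 24 * \<bar>?f\<bar> * (1 / R\<^sup>2)"
      proof -
        have "4 * Q * t * (6 / Q\<^sup>2) = 24 * t * (1 / Q)" if "Q > 0" for Q t :: real
          using that by (simp add: power2_eq_square field_simps)
        then show ?thesis using q by blast
      qed
      also have "\<dots> \<le> 24 * \<bar>?f\<bar> * (1 / R)" using R1 by (intro mult_left_mono) auto
      finally show ?thesis by simp
    qed
    have b3: "\<bar>2 * real N * ?f * ?X'\<bar> \<le> 6 * real N * \<bar>?f\<bar> / R"
    proof -
      have "\<bar>2 * real N * ?f * ?X'\<bar> = 2 * real N * \<bar>?f\<bar> * \<bar>?X'\<bar>" by (simp add: abs_mult)
      also have "\<dots> \<le> 2 * real N * \<bar>?f\<bar> * (3 * (1 / R))"
        using X(2) R1 by (intro mult_left_mono) auto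
      finally show ?thesis by simp
    qed
    let ?L = "4 * r\<^sup>2 * profile'' N (R\<^sup>2) (r\<^sup>2) + 2 * real N * profile' N (R\<^sup>2) (r\<^sup>2) + profile N (R\<^sup>2) (r\<^sup>2)"
    have "?L = 4 * r * ?g * ?X' + 4 * r\<^sup>2 * ?f * ?X'' + 2 * real N * ?f * ?X'"
      unfolding profile_remainder[OF N] by (simp add: power2_eq_square)
    then have "\<bar>?L\<bar> \<le> 12 * \<bar>?g\<bar> / R + 24 * \<bar>?f\<bar> / R + 6 * real N * \<bar>?f\<bar> / R"
      using b1 b2 b3 by linarith
    also have "\<dots> = (12 * \<bar>?g\<bar> + (24 + 6 * real N) * \<bar>?f\<bar>) / R"
      by (simp add: add_divide_distrib algebra_simps)
    finally have "\<bar>?L\<bar>\<^sup>2 \<le> ((12 * \<bar>?g\<bar> + (24 + 6 * real N) * \<bar>?f\<bar>) / R)\<^sup>2"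
      by (intro power_mono) auto
    then have "?L\<^sup>2 \<le> (12 * \<bar>?g\<bar> + (24 + 6 * real N) * \<bar>?f\<bar>)\<^sup>2 / R\<^sup>2"
      by (simp add: power_divide)
    also have "\<dots> \<le> (2 * (12 * \<bar>?g\<bar>)\<^sup>2 + 2 * ((24 + 6 * real N) * \<bar>?f\<bar>)\<^sup>2) / R\<^sup>2"
    proof (intro divide_right_mono)
      show "(a + b)\<^sup>2 \<le> 2 * a\<^sup>2 + 2 * b\<^sup>2" for a b :: real
        using sum_squares_bound[of a b] by (simp add: power2_sum)
    qed simp
    also have "\<dots> = (2 * 12\<^sup>2 * ?g\<^sup>2 + 2 * (24 + 6 * real N)\<^sup>2 * ?f\<^sup>2) / R\<^sup>2"
      by (simp add: power_mult_distrib)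
    also have "\<dots> \<le> (2 * 12\<^sup>2 * (C / ?\<rho>) + 2 * (24 + 6 * real N)\<^sup>2 * (C / ?\<rho>)) / R\<^sup>2"
      by (intro divide_right_mono add_mono mult_left_mono bd[OF r(1)]) auto
    also have "\<dots> = D * C / R\<^sup>2 / ?\<rho>"
    proof -
      have "(a * (C / \<rho>) + b * (C / \<rho>)) / Q = (a + b) * C / Q / \<rho>" for a b \<rho> Q :: real
        by (simp add: algebra_simps add_divide_distrib)
      then show ?thesis unfolding D_def .
    qed
    finally show "?L\<^sup>2 \<le> D * C / R\<^sup>2 / ?\<rho>" .
  qed
qed

text \<open>Near the origin f is at least 1/2 by continuity and the cutoff at least (3/4)^3, on a
  ball that is the same for all R >= 1. This keeps the L^(2 sigma + 2) norm away from 0.\<close>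

lemma profile_lower_bound:
  assumes N: "N \<ge> 1"
  obtains r where "r > 0" "\<And>R s. R \<ge> 1 \<Longrightarrow> 0 \<le> s \<Longrightarrow> s \<le> r\<^sup>2 \<Longrightarrow> 1 / 8 \<le> profile N (R\<^sup>2) s"
proof -
  have "isCont (helmholtz N) 0" using helmholtz_deriv(1)[OF N] by (rule DERIV_isCont)
  then have "\<forall>\<^sub>F s in at 0. dist (helmholtz N s) 1 < 1/2"
    unfolding isCont_def helmholtz_0 by (rule tendstoD) simp
  then obtain d where d: "d > 0" "\<And>s. s \<noteq> 0 \<Longrightarrow> dist s 0 < d \<Longrightarrow> dist (helmholtz N s) 1 < 1/2"
    by (auto simp: eventually_at)
  have f: "1/2 \<le> helmholtz N s" if "\<bar>s\<bar> < d" for s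
    using d(2)[of s] that by (cases "s = 0") (auto simp: helmholtz_0 dist_real_def abs_if split: if_splits)
  \<comment> \<open>As \<open>?r\<close> is below 1, its square is at most \<open>?r\<close>; hence
    s is both within the neighbourhood where f >= 1/2 and at most 1/4.\<close>
  let ?r = "min (d / 2) (1 / 4)"
  show thesis
  proof (rule that[of "?r"])
    show "?r > 0" using d(1) by simp
    fix R s :: real assume R: "R \<ge> 1" and s: "0 \<le> s" "s \<le> ?r\<^sup>2"
    have "?r\<^sup>2 \<le> ?r * 1" unfolding power2_eq_square using d(1) by (intro mult_left_mono) auto
    then have s': "s \<le> d / 2" "s \<le> 1 / 4" using s by auto
    have "1 / R\<^sup>2 \<le> 1" using R by (simp add: one_le_power)
    then have "s * (1 / R\<^sup>2) \<le> 1 / 4 * 1" using s s' by (intro mult_mono) auto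
    then have "3 / 4 \<le> 1 - s / R\<^sup>2" by simp
    then have "3 / 4 \<le> max 0 (1 - s / R\<^sup>2)" by (rule order_trans) (rule max.cobounded2)
    then have "(3 / 4) ^ 3 \<le> cutoff (R\<^sup>2) s" unfolding cutoff_def by (rule power_mono) simp
    then have "1 / 4 \<le> cutoff (R\<^sup>2) s" by (simp add: eval_nat_numeral)
    moreover have "1/2 \<le> helmholtz N s" using s s' d(1) by (intro f) auto
    ultimately have "1/2 * (1/4) \<le> profile N (R\<^sup>2) s" unfolding profile_def by (intro mult_mono) auto
    then show "1 / 8 \<le> profile N (R\<^sup>2) s" by simp
  qed
qed

text \<open>The truncated solution is divided by its L^(2 sigma + 2) norm. T is quadratic, so this
  multiplies the energy by a^2, which is bounded independently of the radius. Radii are natural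
  numbers to match the shell estimate.\<close>

lemma admissible_truncated_helmholtz:
  assumes p: "0 < \<sigma>"
  obtains C where "C > 0"
    "\<And>c n. c \<ge> 0 \<Longrightarrow> n \<ge> 1 \<Longrightarrow> \<exists>u :: real ^ 'n::finite \<Rightarrow> complex. admissible \<sigma> u \<and> T_functional c u \<le> C * (1 / real n + c * real n)"
proof -
  let ?N = "CARD('n)" and ?p = "2 * \<sigma> + 2"
  have N: "?N \<ge> 1" by simp
  obtain C where C: "C > 0"
    "\<And>R r. R \<ge> 1 \<Longrightarrow> 0 \<le> r \<Longrightarrow> r \<le> R \<Longrightarrow> (profile ?N (R\<^sup>2) (r\<^sup>2))\<^sup>2 \<le> C / (max 1 r) ^ (?N - 1)"
    "\<And>R r. R \<ge> 1 \<Longrightarrow> 0 \<le> r \<Longrightarrow> r \<le> R \<Longrightarrow>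
      (4 * r\<^sup>2 * profile'' ?N (R\<^sup>2) (r\<^sup>2) + 2 * real ?N * profile' ?N (R\<^sup>2) (r\<^sup>2) + profile ?N (R\<^sup>2) (r\<^sup>2))\<^sup>2
        \<le> C / R\<^sup>2 / (max 1 r) ^ (?N - 1)"
    using profile_bounds[OF N] by blast
  obtain r where r: "r > 0" "\<And>R s. R \<ge> 1 \<Longrightarrow> 0 \<le> s \<Longrightarrow> s \<le> r\<^sup>2 \<Longrightarrow> 1 / 8 \<le> profile ?N (R\<^sup>2) s"
    using profile_lower_bound[OF N] by blast
  \<comment> \<open>A lower bound, common to all radii, for the integral of the power 2 sigma + 2 of
    the profile; the ball of \<open>profile_lower_bound\<close> alone supplies it.\<close>
  define \<kappa> where "\<kappa> = (1/8) powr ?p * measure lborel (cball (0 :: real ^ 'n) r)"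
  have \<kappa>: "\<kappa> > 0" using r(1) by (simp add: \<kappa>_def content_cball)
  define K where "K = unit_ball_vol ?N * real ?N * 2 ^ (?N - 1)"
  have K: "K > 0" using N by (simp add: K_def)
  let ?C = "\<kappa> powr (- 2 / ?p) * (C * K)"
  show thesis
  proof (rule that[of ?C])
    show "?C > 0" using \<kappa> C(1) K by simp
    fix c :: real and n :: nat assume c: "c \<ge> 0" and n: "n \<ge> 1"
    define R where "R = real n"
    have R: "R \<ge> 1" using n by (simp add: R_def)
    have q: "R\<^sup>2 > 0" using R by simp
    let ?F = "profile ?N (R\<^sup>2)" and ?F' = "profile' ?N (R\<^sup>2)" and ?F'' = "profile'' ?N (R\<^sup>2)"
    note D = profile_deriv[OF N q]
    have cF: "continuous_on UNIV ?F" "continuous_on UNIV ?F'"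
      using D(1,2) by (meson DERIV_isCont continuous_at_imp_continuous_on)+
    have cx: "continuous_on UNIV (\<lambda>x :: real ^ 'n. f (x \<bullet> x))" if "continuous_on UNIV f" for f :: "real \<Rightarrow> real"
      by (rule continuous_on_compose2[OF that]) (auto intro!: continuous_intros)
    have out: "?F (x \<bullet> x) = 0" "?F' (x \<bullet> x) = 0" "?F'' (x \<bullet> x) = 0" if "norm x > R" for x :: "real ^ 'n"
    proof -
      have "(norm x)\<^sup>2 > R\<^sup>2" using that R by (intro power_strict_mono) auto
      then have "x \<bullet> x > R\<^sup>2" by (simp add: power2_norm_eq_inner)
      from profile_eq_0[OF R this, of ?N] show "?F (x \<bullet> x) = 0" "?F' (x \<bullet> x) = 0" "?F'' (x \<bullet> x) = 0" by auto
    qed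
    let ?h = "\<lambda>x :: real ^ 'n. \<bar>?F (x \<bullet> x)\<bar> powr ?p"
    have ch: "continuous_on UNIV ?h"
      using p by (intro continuous_on_powr' continuous_on_rabs cx cF continuous_on_const) auto
    have "integrable lborel (\<lambda>x. indicator (cball 0 R) x *\<^sub>R ?h x)"
      by (rule borel_integrable_compact[OF compact_cball continuous_on_subset[OF ch]]) simp
    also have "(\<lambda>x. indicator (cball 0 R) x *\<^sub>R ?h x) = ?h"
      using out by (auto simp: fun_eq_iff indicator_def not_le)
    finally have ih: "integrable lborel ?h" .
    define I where "I = (\<integral>x. ?h x \<partial>lborel)"
    have I: "I \<ge> \<kappa>"
    proof -
      have "\<kappa> = (\<integral>x. indicator (cball 0 r) x * (1/8) powr ?p \<partial>(lborel :: (real ^ 'n) measure))"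
        by (simp add: \<kappa>_def)
      also have "\<dots> \<le> I"
        unfolding I_def
      proof (rule integral_mono[OF _ ih])
        show "integrable lborel (\<lambda>x :: real ^ 'n. indicator (cball 0 r) x * (1/8) powr ?p)"
          by (intro integrable_mult_left integrable_real_indicator emeasure_bounded_finite) auto
        fix x :: "real ^ 'n"
        show "indicator (cball 0 r) x * (1/8) powr ?p \<le> ?h x"
        proof (cases "x \<in> cball 0 r")
          case True
          then have "(norm x)\<^sup>2 \<le> r\<^sup>2" by (intro power_mono) auto
          then have "x \<bullet> x \<le> r\<^sup>2" by (simp add: power2_norm_eq_inner)
          from r(2)[OF R _ this] have "1/8 \<le> \<bar>?F (x \<bullet> x)\<bar>" by (simp add: abs_if)
          then have "(1/8) powr ?p \<le> ?h x" using p by (intro powr_mono2) auto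
          with True show ?thesis by simp
        qed simp
      qed
      finally show ?thesis .
    qed
    with \<kappa> have I0: "I > 0" by linarith
    \<comment> \<open>Chosen so that the scaled function has integral 1. It decreases in I, so the
      lower bound on I bounds it from above.\<close>
    define a where "a = I powr (- 1 / ?p)"
    have a0: "a > 0" using I0 by (simp add: a_def)
    have a2: "a\<^sup>2 \<le> \<kappa> powr (- 2 / ?p)"
    proof -
      have "a\<^sup>2 = I powr (- 2 / ?p)"
        unfolding power2_eq_square a_def powr_add[symmetric] by (simp add: add_divide_distrib[symmetric])
      also have "\<dots> \<le> \<kappa> powr (- 2 / ?p)"
        using p \<kappa> I by (intro powr_mono2') auto
      finally show ?thesis .
    qed
    let ?\<Phi> = "\<lambda>s. a * ?F s" and ?\<Phi>' = "\<lambda>s. a * ?F' s" and ?\<Phi>'' = "\<lambda>s. a * ?F'' s"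
    have R0: "R \<ge> 0" using R by simp
    have c\<Phi>: "continuous_on UNIV ?\<Phi>''" by (intro continuous_intros D(3))
    have o\<Phi>: "?\<Phi> s = 0 \<and> ?\<Phi>' s = 0 \<and> ?\<Phi>'' s = 0" if "s > R\<^sup>2" for s
      using profile_eq_0[OF R that, of ?N] by simp
    note d\<Phi> = DERIV_cmult[OF D(1), of a] DERIV_cmult[OF D(2), of a]
    let ?u = "\<lambda>x :: real ^ 'n. complex_of_real (?\<Phi> (x \<bullet> x))"
    have u2: "?u \<in> sobolev_H 2"
      by (rule radial_sobolev(1)[OF d\<Phi> c\<Phi> o\<Phi> R0])
    have "cmod (?u x) powr ?p = a powr ?p * ?h x" for x
      using a0 by (simp add: abs_mult powr_mult norm_mult)
    then have "(\<integral>x. cmod (?u x) powr ?p \<partial>lborel) = a powr ?p * I"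
      by (simp add: I_def)
    also have "a powr ?p = I powr (-1)"
      unfolding a_def powr_powr using p by simp
    also have "I powr (-1) * I = 1" using I0 by (simp add: powr_minus_divide)
    finally have adm: "admissible \<sigma> ?u" using u2 by (simp add: admissible_def)
    let ?L = "\<lambda>x :: real ^ 'n. 4 * (x \<bullet> x) * ?F'' (x \<bullet> x) + 2 * real ?N * ?F' (x \<bullet> x) + ?F (x \<bullet> x)"
    have mL: "?L \<in> borel_measurable borel" and mF: "(\<lambda>x :: real ^ 'n. ?F (x \<bullet> x)) \<in> borel_measurable borel"
      by (intro borel_measurable_continuous_onI continuous_on_add continuous_on_mult continuous_on_const
          continuous_on_inner continuous_on_id cx[OF cF(1)] cx[OF cF(2)] cx[OF D(3)])+
    \<comment> \<open>The factor 1 / R^2 of the residual against the linear growth in R of the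
      integrated weight leaves 1 / R.\<close>
    have LI: "(\<integral>x. (?L x)\<^sup>2 \<partial>lborel) \<le> C / R\<^sup>2 * (K * R)"
      unfolding R_def K_def
    proof (rule integral_radial_decay_le[OF mL[unfolded R_def] n])
      show "0 \<le> C / (real n)\<^sup>2" using C(1) by simp
      fix x :: "real ^ 'n"
      show "norm x \<le> real n \<Longrightarrow> (4 * (x \<bullet> x) * profile'' ?N ((real n)\<^sup>2) (x \<bullet> x) + 2 * real ?N * profile' ?N ((real n)\<^sup>2) (x \<bullet> x) + profile ?N ((real n)\<^sup>2) (x \<bullet> x))\<^sup>2
          \<le> C / (real n)\<^sup>2 / (max 1 (norm x)) ^ (?N - 1)"
        using C(3)[OF R norm_ge_zero[of x]] unfolding R_def power2_norm_eq_inner .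
      show "norm x > real n \<Longrightarrow> 4 * (x \<bullet> x) * profile'' ?N ((real n)\<^sup>2) (x \<bullet> x) + 2 * real ?N * profile' ?N ((real n)\<^sup>2) (x \<bullet> x) + profile ?N ((real n)\<^sup>2) (x \<bullet> x) = 0"
        using out[of x] unfolding R_def by simp
    qed
    have FI: "(\<integral>x. (?F (x \<bullet> x))\<^sup>2 \<partial>(lborel :: (real ^ 'n) measure)) \<le> C * (K * R)"
      unfolding R_def K_def
    proof (rule integral_radial_decay_le[OF mF[unfolded R_def] n])
      show "0 \<le> C" using C(1) by simp
      fix x :: "real ^ 'n"
      show "norm x \<le> real n \<Longrightarrow> (profile ?N ((real n)\<^sup>2) (x \<bullet> x))\<^sup>2 \<le> C / (max 1 (norm x)) ^ (?N - 1)"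
        using C(2)[OF R norm_ge_zero[of x]] unfolding R_def power2_norm_eq_inner .
      show "norm x > real n \<Longrightarrow> profile ?N ((real n)\<^sup>2) (x \<bullet> x) = 0"
        using out[of x] unfolding R_def by simp
    qed
    have "T_functional c ?u = (\<integral>x. (4 * (x \<bullet> x) * ?\<Phi>'' (x \<bullet> x) + 2 * real ?N * ?\<Phi>' (x \<bullet> x) + ?\<Phi> (x \<bullet> x))\<^sup>2 \<partial>(lborel :: (real ^ 'n) measure))
        + c * (\<integral>x. (?\<Phi> (x \<bullet> x))\<^sup>2 \<partial>(lborel :: (real ^ 'n) measure))"
      by (rule T_functional_radial[OF d\<Phi> c\<Phi> o\<Phi> R0])
    also have "(\<lambda>x :: real ^ 'n. (4 * (x \<bullet> x) * ?\<Phi>'' (x \<bullet> x) + 2 * real ?N * ?\<Phi>' (x \<bullet> x) + ?\<Phi> (x \<bullet> x))\<^sup>2) = (\<lambda>x. a\<^sup>2 * (?L x)\<^sup>2)"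
    proof
      fix x :: "real ^ 'n"
      have "4 * (x \<bullet> x) * ?\<Phi>'' (x \<bullet> x) + 2 * real ?N * ?\<Phi>' (x \<bullet> x) + ?\<Phi> (x \<bullet> x) = a * ?L x"
        by (simp add: algebra_simps)
      then show "(4 * (x \<bullet> x) * ?\<Phi>'' (x \<bullet> x) + 2 * real ?N * ?\<Phi>' (x \<bullet> x) + ?\<Phi> (x \<bullet> x))\<^sup>2 = a\<^sup>2 * (?L x)\<^sup>2"
        by (simp only: power_mult_distrib)
    qed
    also have "(\<lambda>x :: real ^ 'n. (?\<Phi> (x \<bullet> x))\<^sup>2) = (\<lambda>x. a\<^sup>2 * (?F (x \<bullet> x))\<^sup>2)"
      by (simp only: power_mult_distrib)
    also have "(\<integral>x. a\<^sup>2 * (?L x)\<^sup>2 \<partial>lborel) + c * (\<integral>x. a\<^sup>2 * (?F (x \<bullet> x))\<^sup>2 \<partial>(lborel :: (real ^ 'n) measure))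
        = a\<^sup>2 * ((\<integral>x. (?L x)\<^sup>2 \<partial>lborel) + c * (\<integral>x. (?F (x \<bullet> x))\<^sup>2 \<partial>(lborel :: (real ^ 'n) measure)))"
      by (simp only: integral_mult_right_zero) (simp only: distrib_left mult_ac)
    also have "\<dots> \<le> a\<^sup>2 * (C / R\<^sup>2 * (K * R) + c * (C * (K * R)))"
      using c by (intro mult_left_mono add_mono LI FI) auto
    also have "\<dots> = a\<^sup>2 * (C * K * (1 / R + c * R))"
      using R by (simp add: power2_eq_square field_simps)
    also have "\<dots> \<le> \<kappa> powr (- 2 / ?p) * (C * K * (1 / R + c * R))"
      using a2 C(1) K R c by (intro mult_right_mono) auto
    finally have "T_functional c ?u \<le> ?C * (1 / real n + c * real n)"
      unfolding R_def by (simp only: mult.assoc)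
    with adm show "\<exists>u :: real ^ 'n \<Rightarrow> complex. admissible \<sigma> u \<and> T_functional c u \<le> ?C * (1 / real n + c * real n)"
      by blast
  qed
qed

text \<open>The terms 1 / n and c n balance at n = c^(-1/2). Rounding n up adds at most c, which is
  below sqrt c for c < 1, whence the factor 3.\<close>

lemma t_inf_upper_bound:
  assumes \<sigma>: "0 < \<sigma>"
  obtains C where "C > 0" "\<And>c. 0 < c \<Longrightarrow> c < 1 \<Longrightarrow> t_inf TYPE('n::finite) \<sigma> c \<le> C * sqrt c"
proof -
  obtain C where C: "C > 0"
    "\<And>c n. c \<ge> 0 \<Longrightarrow> n \<ge> 1 \<Longrightarrow> \<exists>u :: real ^ 'n \<Rightarrow> complex. admissible \<sigma> u \<and> T_functional c u \<le> C * (1 / real n + c * real n)"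
    using admissible_truncated_helmholtz[OF \<sigma>] by blast
  show thesis
  proof (rule that[of "3 * C"])
    show "3 * C > 0" using C(1) by simp
    fix c :: real assume c: "0 < c" "c < 1"
    have s: "0 < sqrt c" "sqrt c < 1" using c by auto
    define n where "n = nat \<lceil>1 / sqrt c\<rceil>"
    have n1: "1 / sqrt c \<le> real n" unfolding n_def by linarith
    have pos: "1 / sqrt c > 0" using s by simp
    have n2: "real n \<le> 1 / sqrt c + 1" unfolding n_def using pos by linarith
    have "1 \<le> 1 / sqrt c" using s by (simp add: field_simps)
    with n1 have n: "n \<ge> 1" by linarith
    obtain u :: "real ^ 'n \<Rightarrow> complex" where u: "admissible \<sigma> u" "T_functional c u \<le> C * (1 / real n + c * real n)"
      using C(2)[of c n] c n by auto
    have "t_inf TYPE('n) \<sigma> c \<le> T_functional c u" using u(1) c by (intro t_inf_le) auto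
    also note u(2)
    also have "C * (1 / real n + c * real n) \<le> C * (3 * sqrt c)"
    proof (intro mult_left_mono)
      have "1 / real n \<le> 1 / (1 / sqrt c)" using n1 pos n by (intro divide_left_mono mult_pos_pos) auto
      then have a: "1 / real n \<le> sqrt c" by simp
      have cs: "c = sqrt c * sqrt c" using c by simp
      have "c * real n \<le> c * (1 / sqrt c + 1)" using n2 c by (intro mult_left_mono) auto
      also have "\<dots> = sqrt c + c" using s by (subst (1 2) cs) (simp add: field_simps)
      also have "\<dots> \<le> sqrt c + sqrt c" using mult_left_le[of "sqrt c" "sqrt c"] s cs by linarith
      finally show "1 / real n + c * real n \<le> 3 * sqrt c" using a by linarith
    qed (use C(1) in auto)
    finally show "t_inf TYPE('n) \<sigma> c \<le> 3 * C * sqrt c" by (simp add: mult_ac)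
  qed
qed

theorem proposition3p7:
  fixes \<sigma> :: real
  assumes "0 < \<sigma>"
    and "CARD('n::finite) \<ge> 5 \<Longrightarrow> \<sigma> < 4 / (real CARD('n) - 4)"
  shows "strict_mono_on {0<..} (t_inf TYPE('n) \<sigma>)
    \<and> (\<exists>C>0. \<exists>c\<^sub>0>0. \<forall>c. 0 < c \<and> c < c\<^sub>0 \<longrightarrow> t_inf TYPE('n) \<sigma> c \<le> C * sqrt c)
    \<and> (t_inf TYPE('n) \<sigma> \<longlongrightarrow> 0) (at_right 0)"
proof (intro conjI)
  \<comment> \<open>Without an admissible function t(c) would be the infimum of the empty set, about
    which nothing is known.\<close>
  have ne: "\<exists>u :: real ^ 'n \<Rightarrow> complex. admissible \<sigma> u"
    using admissible_truncated_helmholtz[OF assms(1), where 'n='n] by (metis order_refl)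
  show "strict_mono_on {0<..} (t_inf TYPE('n) \<sigma>)"
    by (rule t_inf_strict_mono[OF assms ne])
  obtain C where C: "C > 0" "\<And>c. 0 < c \<Longrightarrow> c < 1 \<Longrightarrow> t_inf TYPE('n) \<sigma> c \<le> C * sqrt c"
    using t_inf_upper_bound[OF assms(1), where 'n='n] by blast
  then show "\<exists>C>0. \<exists>c\<^sub>0>0. \<forall>c. 0 < c \<and> c < c\<^sub>0 \<longrightarrow> t_inf TYPE('n) \<sigma> c \<le> C * sqrt c"
    by (intro exI[of _ C] exI[of _ 1] conjI) auto
  have "((\<lambda>c. C * sqrt c) \<longlongrightarrow> C * sqrt 0) (at_right 0)"
    by (intro tendsto_intros)
  then have lim: "((\<lambda>c. C * sqrt c) \<longlongrightarrow> 0) (at_right 0)" by simp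
  have ev: "\<forall>\<^sub>F c::real in at_right 0. 0 < c \<and> c < 1"
    by (auto simp: eventually_at_right_field intro!: exI[of _ 1])
  show "(t_inf TYPE('n) \<sigma> \<longlongrightarrow> 0) (at_right 0)"
  proof (rule tendsto_sandwich[OF _ _ tendsto_const lim])
    show "\<forall>\<^sub>F c in at_right 0. 0 \<le> t_inf TYPE('n) \<sigma> c"
      using ev by eventually_elim (auto intro: t_inf_nonneg[OF ne])
    show "\<forall>\<^sub>F c in at_right 0. t_inf TYPE('n) \<sigma> c \<le> C * sqrt c"
      using ev by eventually_elim (auto intro: C)
  qed
qed

end
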